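(* Let $N$ be the set of complex numbers $s=\sigma+it$ with $|s-1|>2\pi e^2$ and $\sigma<1$, and such that either $t\le2\pi e$, or $t>2\pi e$ and $\sigma\le1-8\pi\bigl(\frac{t}{2\pi}\log\frac{t}{2\pi}\bigr)^{1/2}$. For $s\in N$, $$\mathcal{R}(s)=\frac{(-1)^m}{2i}\,\chi(s)\,\eta^{s-1}e^{-\pi i\eta^2}\,\overline{G}(p)\bigl(1+O(|\eta|^{-1})\bigr),$$ with an absolute implied constant, where $\eta,m,p,\overline{G},\chi$ are as in the context.
   Context: Riemann's auxiliary function is the entire function $$\mathcal{R}(s)=\int_{0\swarrow1}\frac{x^{-s}e^{\pi i x^2}}{e^{\pi i x}-e^{-\pi i x}}\,dx,$$ where the path is a straight line of direction $e^{-3\pi i/4}$ (running from the upper right to the lower left) crossing the real axis at a point strictly between $0$ and $1$, and $x^{-s}=\exp(-s\log x)$ with the principal logarithm. $\chi(s)=\pi^{s-\frac12}\Gamma(\frac{1-s}{2})/\Gamma(\frac{s}{2})$, so that $\zeta(s)=\chi(s)\zeta(1-s)$. For $s-1$ not a nonnegative real number, put $\eta=\sqrt{(s-1)/(2\pi i)}$ with $-\frac{\pi}{4}<\arg\eta<\frac{3\pi}{4}$, $\eta_1=\operatorname{Re}\eta$, $\eta_2=\operatorname{Im}\eta$, $m=\lfloor\eta_1+\eta_2\rfloor$, $p=-2(m+\tfrac12-\eta)$; $\eta^{s-1}=\exp((s-1)\log\eta)$ with $\log\eta=\log|\eta|+i\arg\eta$. $G$ is the entire function $$G(q)=\frac{e^{\frac{\pi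 i}{2}q^2}-\sqrt2\,e^{\frac{\pi i}{8}}\cos\frac{\pi q}{2}}{\cos\pi q}$$ (with removable singularities removed), and $\overline{G}(p):=\overline{G(\overline{p})}$. *)

theory Defs
  imports "HOL-Complex_Analysis.Complex_Analysis"
begin

text \<open>
  Riemann's auxiliary function. The line of integration is parametrised by
  \<open>u \<mapsto> c + u \<omega>\<close> with \<open>\<omega> = exp (-3 \<pi> i / 4)\<close>, so \<open>c\<close> is its crossing point with the real
  axis. The value does not depend on \<open>c\<close> as long as \<open>0 < c < 1\<close>. On this line \<open>x \<noteq> 0\<close>, so
  \<open>x powr (- s)\<close> is \<open>exp (- s * Ln x)\<close> with the principal logarithm.
\<close>

definition aux_R_integrand :: "complex \<Rightarrow> complex \<Rightarrow> complex" where
  "aux_R_integrand s x =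
     x powr (- s) * exp (of_real pi * \<i> * x\<^sup>2) /
       (exp (of_real pi * \<i> * x) - exp (- (of_real pi * \<i> * x)))"

definition aux_R :: "real \<Rightarrow> complex \<Rightarrow> complex" where
  "aux_R c s =
     (let \<omega> = exp (- (3 * of_real pi * \<i> / 4))
      in (LINT u|lborel. aux_R_integrand s (of_real c + of_real u * \<omega>) * \<omega>))"

text \<open>
  At the poles \<open>s = 0, -2, -4, \<dots>\<close> of \<open>Gamma (s / 2)\<close> the library has \<open>Gamma (s / 2) = 0\<close> and
  division by zero yields zero, which is the correct value \<open>\<chi> s = 0\<close> there. The poles
  \<open>s = 1, 3, 5, \<dots>\<close> of the numerator all have real part at least 1.
\<close>

definition chi :: "complex \<Rightarrow> complex" where
  "chi s = of_real pi powr (s - 1 / 2) * Gamma ((1 - s) / 2) / Gamma (s / 2)"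

definition eta :: "complex \<Rightarrow> complex" where
  "eta s = (THE z. z\<^sup>2 = (s - 1) / (2 * of_real pi * \<i>) \<and> - (pi / 4) < Arg z \<and> Arg z < 3 * pi / 4)"

definition m_of :: "complex \<Rightarrow> int" where
  "m_of s = \<lfloor>Re (eta s) + Im (eta s)\<rfloor>"

definition p_of :: "complex \<Rightarrow> complex" where
  "p_of s = - 2 * (of_int (m_of s) + 1 / 2 - eta s)"

definition G :: "complex \<Rightarrow> complex" where
  "G = remove_sings (\<lambda>q.
     (exp (of_real pi * \<i> / 2 * q\<^sup>2)
        - of_real (sqrt 2) * exp (of_real pi * \<i> / 8) * cos (of_real pi * q / 2))
     / cos (of_real pi * q))"

definition G_bar :: "complex \<Rightarrow> complex" where
  "G_bar p = cnj (G (cnj p))"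

definition region_N :: "complex set" where
  "region_N = {s. norm (s - 1) > 2 * pi * (exp 1)\<^sup>2 \<and> Re s < 1 \<and>
     (Im s \<le> 2 * pi * exp 1 \<or>
      Im s > 2 * pi * exp 1 \<and>
        Re s \<le> 1 - 8 * pi * sqrt (Im s / (2 * pi) * ln (Im s / (2 * pi))))}"

text \<open>The definite description in \<^const>\<open>eta\<close> is well defined off the cut.\<close>

lemma eta_eqI:
  assumes "s - 1 \<notin> \<real>\<^sub>\<ge>\<^sub>0"
    and z: "z\<^sup>2 = (s - 1) / (2 * of_real pi * \<i>)" "- (pi / 4) < Arg z" "Arg z < 3 * pi / 4"
  shows "eta s = z"
  unfolding eta_def
proof (rule the_equality)
  show "z\<^sup>2 = (s - 1) / (2 * of_real pi * \<i>) \<and> - (pi / 4) < Arg z \<and> Arg z < 3 * pi / 4"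
    using z by simp
next
  fix w
  assume w: "w\<^sup>2 = (s - 1) / (2 * of_real pi * \<i>) \<and> - (pi / 4) < Arg w \<and> Arg w < 3 * pi / 4"
  have "s - 1 \<noteq> 0"
    using assms(1) by auto
  hence "z \<noteq> 0"
    using z(1) by auto
  have "w\<^sup>2 = z\<^sup>2"
    using w z by simp
  hence "w = z \<or> w = - z"
    by (simp add: power2_eq_iff)
  moreover have "w \<noteq> - z"
  proof
    assume "w = - z"
    hence "Arg w = (if Arg z \<le> 0 then Arg z + pi else Arg z - pi)"
      using Arg_minus[OF \<open>z \<noteq> 0\<close>] by simp
    thus False
      using w z pi_gt_zero by (auto split: if_splits)
  qed
  ultimately show "w = z" by blast
qed

lemma eta_eq_csqrt:
  assumes "s - 1 \<notin> \<real>\<^sub>\<ge>\<^sub>0"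
  shows "eta s = exp (\<i> * of_real pi / 4) * csqrt ((1 - s) / (2 * of_real pi))"
proof -
  define y where "y = (1 - s) / (2 * of_real pi)"
  define z where "z = exp (\<i> * of_real pi / 4) * csqrt y"
  have "1 - s = - (s - 1)" by simp
  hence "1 - s \<notin> \<real>\<^sub>\<le>\<^sub>0"
    using assms uminus_nonneg_Reals_iff by (metis minus_minus uminus_nonpos_Reals_iff)
  hence y: "Arg y \<noteq> pi" "y \<noteq> 0"
    by (auto simp: y_def Arg_eq_pi complex_nonpos_Reals_iff divide_less_0_iff)
  have "exp (\<i> * of_real pi / 4) ^ 2 = exp (\<i> * of_real pi / 2)"
    by (simp flip: exp_double add: field_simps)
  also have "\<dots> = \<i>"
    using cis_conv_exp[of "pi / 2"] by (simp add: cis_pi_half)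
  finally have "z\<^sup>2 = (s - 1) / (2 * of_real pi * \<i>)"
    by (simp add: z_def power_mult_distrib y_def divide_simps algebra_simps)
  moreover have "Arg z = Arg y / 2 + pi / 4"
  proof (rule Arg_unique)
    show "of_real (norm (csqrt y)) * exp (\<i> * of_real (Arg y / 2 + pi / 4)) = z"
      using Arg_eq[of "csqrt y"] y by (simp add: z_def exp_add norm_mult algebra_simps)
  qed (use y Arg_bounded[of y] in auto)
  ultimately show ?thesis
    using eta_eqI[OF assms, of z] y Arg_bounded[of y] by (simp add: z_def y_def)
qed

end

theory Submission
  imports Defs "HOL-Probability.Characteristic_Functions" "HOL-Real_Asymp.Real_Asymp"
begin

text \<open>
  Put \<open>e = exp (\<pi> i / 4)\<close>, \<open>f x = x powr (s - 1) * exp (- \<pi> i x\<^sup>2)\<close> and write \<open>F\<close> for the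
  integrand of \<open>aux_R\<close>. Up to the factor \<open>1 / x\<close> and the sine kernel, \<open>F\<close> is \<open>1 / f\<close>, which has its
  saddle point at \<open>\<eta>\<close> with steepest descent direction \<open>e\<close>. Since \<open>F (- x) = - exp (\<pi> i s) * F x\<close>
  in the upper half-plane, the two halves of the line fold together and
  \<open>aux_R c s = (exp (\<pi> i s) - 1) * I\<close>, where \<open>I\<close> is an integral over a path in the upper
  half-plane ending with the ray \<open>\<eta> + y e\<close>, \<open>y \<ge> - Im \<eta> / sqrt 2\<close>. On this ray \<open>F\<close> is Gaussian up
  to a relative error \<open>O(1 / norm \<eta>)\<close>, and the Gaussian integrals of the geometric series of
  \<open>1 / sin (\<pi> x)\<close> add up to \<open>z (1 - z\<^sup>2) / (1 + z ^ 4)\<close> with \<open>z = exp (\<pi> i \<eta>)\<close>, which is the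
  cosine part of \<open>G_bar\<close>. In \<open>region_N\<close> we have \<open>norm \<eta> ^ 4 \<le> exp ((Im \<eta>)\<^sup>2 + 3)\<close>, so quantities of
  order \<open>exp (- \<pi> (Im \<eta>)\<^sup>2 / 2)\<close>, such as the rest of the path and the Gaussian part of \<open>G_bar\<close>, are
  negligible. Finally Stirling's formula gives
  \<open>chi s * (f \<eta>)\<^sup>2 * \<eta> = e * (1 - exp (\<pi> i s)) * (1 + O(1 / norm (1 - s)))\<close>.

  For \<open>Re s \<le> - 5\<close> the path starts at \<open>0\<close>, so that the factor \<open>exp (\<pi> i s) - 1\<close>, which carries the
  zeros of \<open>chi\<close>, splits off exactly. Otherwise \<open>Im s\<close> is negative and large, and it is enough
  that the segments from \<open>1 / 2\<close> are small compared with \<open>norm (exp (\<pi> i s))\<close>.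
\<close>

subsection \<open>Stirling's formula in the right half-plane\<close>

text \<open>Once \<open>chi s\<close> times f(\<eta>) is known, the claim compares f(\<eta>) \<eta>
  I with a number of modulus about exp(-pi Im \<eta>). The obstacle is that this number is
  exponentially small while the error has to be relative, so every bound must carry the factor
  exp(-pi Im \<eta>) / |\<eta>|. An error exp(-pi (Im \<eta>)^2 / 2) is useful only if |\<eta>| is
  at most about exp((Im \<eta>)^2 / 4), and this is what the curve bounding \<open>region_N\<close>
  provides. The same need shapes the path. The poles of the kernel are real, so the descent line has
  to be left above the real axis. At height Im \<eta> / 2 the kernel still has size exp(-pi Im x),
  and 1 / f has already dropped by exp(-pi (Im \<eta>)^2 / 2). No residues are collected. The
  integer m occurs only in \<open>G_bar\<close>: the translation by m changes the cosine part only
  by the sign (-1)^m, and the choice of m as a floor makes the Gaussian part small.\<close>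

lemma norm_Ln_quadratic_approx:
  fixes u :: complex
  assumes "norm u \<le> 1 / 2"
  shows "norm (Ln (1 + u) - u + u\<^sup>2 / 2) \<le> 2 * norm u ^ 3"
proof -
  define g where "g = (\<lambda>v::complex. Ln (1 + v) - v + v\<^sup>2 / 2)"
  have "norm (g u - g 0) \<le> (2 * norm u ^ 2) * norm (u - 0)"
  proof (rule field_differentiable_bound[of "cball 0 (norm u)" g "\<lambda>v. v\<^sup>2 / (1 + v)"])
    fix v :: complex assume v: "v \<in> cball 0 (norm u)"
    hence nv: "norm v \<le> 1 / 2" "norm v \<le> norm u" using assms by auto
    have "1 - norm v \<le> norm (1 + v)"
      using norm_triangle_ineq2[of 1 "- v"] by simp
    hence n1: "norm (1 + v) \<ge> 1 / 2" using nv by linarith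
    have nz: "1 + v \<noteq> 0" using n1 by force
    have "1 + Re v > 0" using abs_Re_le_cmod[of v] nv by linarith
    hence "1 + v \<notin> \<real>\<^sub>\<le>\<^sub>0" by (auto simp: complex_nonpos_Reals_iff)
    thus "(g has_field_derivative v\<^sup>2 / (1 + v)) (at v within cball 0 (norm u))"
      unfolding g_def using nz
      by (auto intro!: derivative_eq_intros) (simp add: divide_simps power2_eq_square algebra_simps)
    have "norm (v\<^sup>2 / (1 + v)) = norm v ^ 2 / norm (1 + v)" by (simp add: norm_divide norm_power)
    also have "\<dots> \<le> norm u ^ 2 / (1 / 2)" using n1 nv by (intro frac_le power_mono) auto
    finally show "norm (v\<^sup>2 / (1 + v)) \<le> 2 * norm u ^ 2" by simp
  qed auto
  thus ?thesis by (simp add: g_def power3_eq_cube power2_eq_square)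
qed

definition stirling_exponent :: "complex \<Rightarrow> complex" where
  "stirling_exponent w = (w - 1 / 2) * Ln w - w"

text \<open>On a logarithmic scale, the defect of \<open>exp (stirling_exponent w)\<close> in the
  functional equation Gamma (w + 1) = w Gamma w.\<close>

definition stirling_step :: "complex \<Rightarrow> complex" where
  "stirling_step w = stirling_exponent (w + 1) - stirling_exponent w - Ln w"

text \<open>Both w and 1 + t / w have positive real part, so their arguments lie in (-pi/2, pi/2)
  and add up without meeting the branch cut.\<close>

lemma Ln_plus_one_diff:
  assumes "Re w > 0" "t \<ge> 0"
  shows "Ln (w + of_real t) = Ln w + Ln (1 + of_real t / w)"
proof -
  have w: "w \<noteq> 0" using assms by auto
  have R: "Re (1 + of_real t / w) > 0"
  proof -
    have "Re (1 + of_real t / w) = 1 + t * Re w / (norm w)\<^sup>2"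
      by (simp add: Re_divide cmod_power2)
    thus ?thesis using assms by (smt (verit) divide_nonneg_nonneg mult_nonneg_nonneg zero_le_power2)
  qed
  have "Ln (w * (1 + of_real t / w)) = Ln w + Ln (1 + of_real t / w)"
  proof (rule Ln_times_simple)
    have "1 + of_real t / w \<noteq> 0" using R by force
    thus "w \<noteq> 0" "1 + of_real t / w \<noteq> 0" using w by auto
    have "\<bar>Im (Ln w)\<bar> < pi / 2" using Re_Ln_pos_lt[OF w] assms by simp
    moreover have "\<bar>Im (Ln (1 + of_real t / w))\<bar> < pi / 2"
      using Re_Ln_pos_lt[OF \<open>1 + of_real t / w \<noteq> 0\<close>] R by simp
    ultimately show "- pi < Im (Ln w) + Im (Ln (1 + of_real t / w))"
      "Im (Ln w) + Im (Ln (1 + of_real t / w)) \<le> pi" by linarith+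
  qed
  moreover have "w * (1 + of_real t / w) = w + of_real t" using w by (simp add: field_simps)
  ultimately show ?thesis by simp
qed

text \<open>With u = 1 / w the terms of order 1 and u cancel, leaving -u^2 / 4 and the remainder of
  the logarithm. This quadratic decay makes the steps summable.\<close>

lemma norm_stirling_step_le:
  assumes "Re w > 0" "norm w \<ge> 2"
  shows "norm (stirling_step w) \<le> 3 / (norm w)\<^sup>2"
proof -
  define u where "u = 1 / w"
  define r where "r = Ln (1 + u) - u + u\<^sup>2 / 2"
  have w0: "w \<noteq> 0" using assms by auto
  have u0: "u \<noteq> 0" and wu: "w = 1 / u" using w0 by (auto simp: u_def)
  have nu: "norm u \<le> 1 / 2"
    using frac_le[of 1 1 2 "norm w"] assms unfolding u_def norm_divide by simp
  have r: "norm r \<le> 2 * norm u ^ 3" unfolding r_def by (rule norm_Ln_quadratic_approx[OF nu])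
  have L: "Ln (w + 1) = Ln w + (u - u\<^sup>2 / 2 + r)"
    using Ln_plus_one_diff[of w 1] assms by (simp add: r_def u_def)
  have "stirling_step w = (w + 1 / 2) * (u - u\<^sup>2 / 2 + r) - 1"
    unfolding stirling_step_def stirling_exponent_def L by (simp add: field_simps)
  also have "\<dots> = - (u\<^sup>2 / 4) + (w + 1 / 2) * r"
    unfolding wu using u0 by (simp add: field_simps power2_eq_square)
  finally have "norm (stirling_step w) \<le> norm (u\<^sup>2 / 4) + norm ((w + 1 / 2) * r)"
    by (metis norm_triangle_ineq norm_minus_cancel)
  also have "norm (u\<^sup>2 / 4) = norm u ^ 2 / 4" by (simp add: norm_divide norm_power)
  also have "norm ((w + 1 / 2) * r) \<le> (norm w + 1 / 2) * (2 * norm u ^ 3)"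
    unfolding norm_mult using r norm_triangle_ineq[of w "1 / 2"]
    by (intro mult_mono) auto
  also have "norm w = 1 / norm u" by (simp add: wu norm_divide)
  also have "norm u ^ 2 / 4 + (1 / norm u + 1 / 2) * (2 * norm u ^ 3)
      = norm u ^ 2 * (9 / 4 + norm u)"
    using u0 by (simp add: field_simps power2_eq_square power3_eq_cube)
  also have "\<dots> \<le> norm u ^ 2 * 3" using nu by (intro mult_left_mono) auto
  finally show ?thesis by (simp add: u_def norm_divide field_simps)
qed

text \<open>Telescoping against 1 / (b - 1) - 1 / b; for a >= 2 one has 1 / (a - 1) <= 2 /
  a.\<close>

lemma sum_inverse_square_shift_le:
  fixes a :: real
  assumes "a \<ge> 2"
  shows "(\<Sum>j<n. 1 / (a + real j)\<^sup>2) \<le> 2 / a"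
proof -
  have "(\<Sum>j<n. 1 / (a + real j)\<^sup>2) \<le> 1 / (a - 1) - 1 / (a + real n - 1)"
  proof (induction n)
    case (Suc n)
    define b where "b = a + real n"
    have b: "b \<ge> 2" using assms by (simp add: b_def)
    have "1 / b\<^sup>2 \<le> 1 / (b - 1) - 1 / b"
      using b by (simp add: field_simps power2_eq_square)
    thus ?case using Suc by (simp add: b_def algebra_simps)
  qed auto
  also have "\<dots> \<le> 1 / (a - 1)" using assms by simp
  also have "\<dots> \<le> 2 / a" using assms by (simp add: field_simps)
  finally show ?thesis .
qed

text \<open>Re w > 0 gives |w + j|^2 >= |w|^2 + j^2, so the steps are compared with a real series
  that depends on w only through |w|.\<close>

lemma norm_add_of_nat_ge:
  assumes "Re w > 0"
  shows "(norm w + real j)\<^sup>2 \<le> 2 * (norm (w + of_nat j))\<^sup>2" "norm w \<le> norm (w + of_nat j)"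
proof -
  have "(norm (w + of_nat j))\<^sup>2 = (norm w)\<^sup>2 + (real j)\<^sup>2 + 2 * real j * Re w"
    unfolding cmod_power2 by (simp add: power2_eq_square algebra_simps)
  hence *: "(norm (w + of_nat j))\<^sup>2 \<ge> (norm w)\<^sup>2 + (real j)\<^sup>2" using assms by simp
  show "norm w \<le> norm (w + of_nat j)"
    by (rule power2_le_imp_le) (use * in \<open>smt (verit) zero_le_power2 norm_ge_zero\<close>)+
  have "(norm w + real j)\<^sup>2 \<le> 2 * ((norm w)\<^sup>2 + (real j)\<^sup>2)"
    using zero_le_power2[of "norm w - real j"] by (simp add: power2_eq_square algebra_simps)
  also have "\<dots> \<le> 2 * (norm (w + of_nat j))\<^sup>2" using * by simp
  finally show "(norm w + real j)\<^sup>2 \<le> 2 * (norm (w + of_nat j))\<^sup>2" .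
qed

lemma norm_stirling_step_add_le:
  assumes "Re w > 0" "norm w \<ge> 2"
  shows "norm (stirling_step (w + of_nat j)) \<le> 6 / (norm w + real j)\<^sup>2"
proof -
  have "norm (stirling_step (w + of_nat j)) \<le> 3 / (norm (w + of_nat j))\<^sup>2"
    using norm_add_of_nat_ge(2)[OF assms(1), of j] assms by (intro norm_stirling_step_le) auto
  also have "\<dots> = 6 / (2 * (norm (w + of_nat j))\<^sup>2)" by simp
  also have "\<dots> \<le> 6 / (norm w + real j)\<^sup>2"
    using norm_add_of_nat_ge[OF assms(1), of j] assms
    by (intro divide_left_mono) (auto intro!: mult_pos_pos zero_less_power)
  finally show ?thesis .
qed

text \<open>Binet's function, the logarithmic correction in Stirling's formula, as the sum of the
  defects of the functional equation.\<close>

definition stirling_mu :: "complex \<Rightarrow> complex" where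
  "stirling_mu w = (\<Sum>j. stirling_step (w + of_nat j))"

lemma stirling_mu_summable:
  assumes "Re w > 0" "norm w \<ge> 2"
  shows "summable (\<lambda>j. norm (stirling_step (w + of_nat j)))"
    and "(\<Sum>j. norm (stirling_step (w + of_nat j))) \<le> 12 / norm w"
proof -
  have le: "(\<Sum>j<n. norm (stirling_step (w + of_nat j))) \<le> 12 / norm w" for n
  proof -
    have "(\<Sum>j<n. norm (stirling_step (w + of_nat j))) \<le> (\<Sum>j<n. 6 * (1 / (norm w + real j)\<^sup>2))"
      using norm_stirling_step_add_le[OF assms] by (intro sum_mono) auto
    also have "\<dots> \<le> 6 * (2 / norm w)"
      unfolding sum_distrib_left[symmetric]
      using sum_inverse_square_shift_le[OF assms(2), of n] by linarith
    finally show ?thesis by simp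
  qed
  show sm: "summable (\<lambda>j. norm (stirling_step (w + of_nat j)))"
    by (rule bounded_imp_summable[where B = "12 / norm w"])
       (use le[of "Suc _"] in \<open>auto simp: lessThan_Suc_atMost\<close>)
  show "(\<Sum>j. norm (stirling_step (w + of_nat j))) \<le> 12 / norm w"
    by (rule suminf_le_const[OF sm le])
qed

lemma norm_stirling_mu_le:
  assumes "Re w > 0" "norm w \<ge> 2"
  shows "norm (stirling_mu w) \<le> 12 / norm w"
  unfolding stirling_mu_def
  using summable_norm[OF stirling_mu_summable(1)[OF assms]] stirling_mu_summable(2)[OF assms]
    by linarith

text \<open>Its limit along w + n is its value at w times exp (-\<open>stirling_mu w\<close>);
  Stirling's formula says that this limit is sqrt (2 pi) for every w.\<close>

definition stirling_quotient :: "complex \<Rightarrow> complex" where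
  "stirling_quotient w = Gamma w * exp (- stirling_exponent w)"

lemma Re_pos_imp_not_nonpos_Int: "Re w > 0 \<Longrightarrow> w \<notin> \<int>\<^sub>\<le>\<^sub>0"
  by (auto elim!: nonpos_Ints_cases)

lemma stirling_quotient_add:
  assumes "Re w > 0"
  shows "stirling_quotient (w + of_nat n) =
           stirling_quotient w * exp (- (\<Sum>j<n. stirling_step (w + of_nat j)))"
proof (induction n)
  case (Suc n)
  define v where "v = w + of_nat n"
  have v: "Re v > 0" "v \<noteq> 0" using assms by (auto simp: v_def complex_eq_iff)
  have "stirling_quotient (v + 1) = stirling_quotient v * exp (- stirling_step v)"
    using v Gamma_plus1[OF Re_pos_imp_not_nonpos_Int[OF v(1)]]
    by (simp add: stirling_quotient_def stirling_step_def exp_diff exp_minus field_simps exp_add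
      exp_Ln)
  thus ?case using Suc by (simp add: v_def add_ac exp_diff exp_minus field_simps)
qed auto

lemma stirling_quotient_limit:
  assumes "Re w > 0" "norm w \<ge> 2"
  shows "(\<lambda>n. stirling_quotient (w + of_nat n)) \<longlonglongrightarrow> stirling_quotient w * exp (- stirling_mu w)"
proof -
  have "(\<lambda>n. \<Sum>j<n. stirling_step (w + of_nat j)) \<longlonglongrightarrow> stirling_mu w"
    unfolding stirling_mu_def
    using summable_norm_cancel[OF stirling_mu_summable(1)[OF assms]] by (rule summable_LIMSEQ)
  thus ?thesis unfolding stirling_quotient_add[OF assms(1)] by (intro tendsto_intros)
qed

text \<open>The derivative of Ln (1 + h) at h = 0 is 1; the bounded part w - 1/2 of the factor
  contributes nothing in the limit.\<close>

lemma Ln_mult_of_nat_limit: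
  "(\<lambda>n. (w + of_nat n - 1 / 2) * Ln (1 + w / of_nat n)) \<longlonglongrightarrow> w"
proof -
  have der: "((\<lambda>v. Ln (1 + v)) has_field_derivative 1) (at (0::complex))"
    by (auto intro!: derivative_eq_intros)
  have a: "(\<lambda>n. w / of_nat n) \<longlonglongrightarrow> (0::complex)"
    by (rule lim_const_over_n)
  have "(\<lambda>n. of_nat n * Ln (1 + w / of_nat n)) \<longlonglongrightarrow> w"
  proof (cases "w = 0")
    case False
    have "((\<lambda>h. Ln (1 + h) / h) \<longlongrightarrow> 1) (at (0::complex))"
      using der by (simp add: has_field_derivative_iff)
    moreover have "filterlim (\<lambda>n. w / of_nat n) (at (0::complex)) sequentially"
      unfolding filterlim_at
      using a False by (auto intro!: eventually_mono[OF eventually_gt_at_top[of 0]])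
    ultimately have "(\<lambda>n. Ln (1 + w / of_nat n) / (w / of_nat n)) \<longlonglongrightarrow> 1"
      by (rule filterlim_compose)
    hence "(\<lambda>n. w * (Ln (1 + w / of_nat n) / (w / of_nat n))) \<longlonglongrightarrow> w * 1"
      by (intro tendsto_intros)
    thus ?thesis using False by (simp add: field_simps)
  qed auto
  moreover have "(\<lambda>n. (w - 1 / 2) * Ln (1 + w / of_nat n)) \<longlonglongrightarrow> (w - 1 / 2) * Ln (1 + 0)"
    by (intro tendsto_intros a) auto
  ultimately have "(\<lambda>n. of_nat n * Ln (1 + w / of_nat n) + (w - 1 / 2) * Ln (1 + w / of_nat n))
      \<longlonglongrightarrow> w + (w - 1 / 2) * Ln (1 + 0)"
    by (rule tendsto_add)
  thus ?thesis by (simp add: algebra_simps)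
qed

text \<open>The product limit \<open>Gamma_series'\<close> for Gamma compares w + n with n. Hence
  the limit of \<open>stirling_quotient\<close> along w + n does not depend on w.\<close>

lemma stirling_quotient_ratio_limit:
  assumes "Re w > 0"
  shows "(\<lambda>n. stirling_quotient (w + of_nat n) / stirling_quotient (of_nat n)) \<longlonglongrightarrow> 1"
proof -
  have nn: "w \<notin> \<int>\<^sub>\<le>\<^sub>0" using assms by (rule Re_pos_imp_not_nonpos_Int)
  have w0: "w \<noteq> 0" using assms by auto
  have Gw: "Gamma w \<noteq> 0" using nn by (simp add: Gamma_eq_zero_iff)
  have eq: "stirling_quotient (w + of_nat n) / stirling_quotient (of_nat n) =
      (Gamma w / Gamma_series' w n) * exp (w - (w + of_nat n - 1 / 2) * Ln (1 + w / of_nat n))"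
    if n: "n > 0" for n
  proof -
    have g1: "Gamma (w + of_nat n) = pochhammer w n * Gamma w"
      using pochhammer_Gamma[OF nn, of n] Gw by (simp add: field_simps)
    have g2: "Gamma (of_nat n :: complex) = fact (n - 1)"
      using n Gamma_fact[of "n - 1", where ?'a = complex] by (simp add: of_nat_diff)
    have p0: "pochhammer w n \<noteq> 0"
      using nn by (auto simp: pochhammer_eq_0_iff)
    have "Ln (of_nat n + w) = Ln (of_nat n) + Ln (1 + w / of_nat n)"
    proof -
      have Rn: "Re (1 + w / of_nat n) > 0" using assms n by (simp add: add_pos_nonneg)
      hence nz: "1 + w / of_nat n \<noteq> 0" by force
      have "Ln (of_real (real n) * (1 + w / of_nat n))
          = of_real (ln (real n)) + Ln (1 + w / of_nat n)"
        using n Ln_times_of_nat[OF n nz]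
          by (metis Ln_of_nat Ln_of_real of_nat_0_less_iff of_real_of_nat_eq)
      moreover have "of_real (real n) * (1 + w / of_nat n) = of_nat n + w" using n
        by (simp add: field_simps)
      moreover have "Ln (of_nat n) = of_real (ln (real n))" using n by (metis Ln_of_nat)
      ultimately show ?thesis by simp
    qed
    hence "stirling_exponent (of_nat n) - stirling_exponent (w + of_nat n) =
        - w * Ln (of_nat n) + (w - (w + of_nat n - 1 / 2) * Ln (1 + w / of_nat n))"
      by (simp add: stirling_exponent_def algebra_simps)
    hence "exp (stirling_exponent (of_nat n)) / exp (stirling_exponent (w + of_nat n)) =
        exp (- w * Ln (of_nat n)) * exp (w - (w + of_nat n - 1 / 2) * Ln (1 + w / of_nat n))"
      by (metis exp_add exp_diff)
    moreover have "exp (w * Ln (of_nat n)) = exp (w * of_real (ln (real n)))"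
      using n by (metis Ln_of_nat)
    ultimately show ?thesis
      using p0 Gw unfolding stirling_quotient_def Gamma_series'_def g1 g2
      by (simp add: exp_minus field_simps)
  qed
  have lim: "(\<lambda>n. (Gamma w / Gamma_series' w n) *
      exp (w - (w + of_nat n - 1 / 2) * Ln (1 + w / of_nat n))) \<longlonglongrightarrow> (Gamma w / Gamma w) * exp (w - w)"
    using Gw by (intro tendsto_intros Ln_mult_of_nat_limit Gamma_series'_LIMSEQ) auto
  have "eventually (\<lambda>n. (Gamma w / Gamma_series' w n) *
      exp (w - (w + of_nat n - 1 / 2) * Ln (1 + w / of_nat n)) =
      stirling_quotient (w + of_nat n) / stirling_quotient (of_nat n)) sequentially"
    using eventually_gt_at_top[of 0] by eventually_elim (use eq in auto)
  from Lim_transform_eventually[OF lim this] show ?thesis using Gw by simp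
qed

text \<open>The exponential factors that remain when the Gamma values in Legendre's duplication
  formula at n are replaced by \<open>stirling_quotient\<close>; they determine the constant in
  Stirling's formula.\<close>

lemma stirling_exponent_duplication_limit:
  "(\<lambda>n. exp (stirling_exponent (2 * of_nat n) - stirling_exponent (of_nat n)
      - stirling_exponent (of_nat n + 1 / 2) + (1 - 2 * of_nat n) * of_real (ln 2))) \<longlonglongrightarrow>
      of_real (sqrt 2)"
proof -
  define r :: "nat \<Rightarrow> real" where "r = (\<lambda>n. 1 / 2 + ln 2 / 2 - real n * ln (1 + 1 / (2 * real n)))"
  have eq: "stirling_exponent (2 * of_nat n) - stirling_exponent (of_nat n)
      - stirling_exponent (of_nat n + 1 / 2) + (1 - 2 * of_nat n) * of_real (ln 2) = of_real (r n)"
    if n: "n > 0" for n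
  proof -
    have a: "stirling_exponent (of_real x) = of_real ((x - 1 / 2) * ln x - x)" if "x > 0" for x
      using that by (simp add: stirling_exponent_def Ln_of_real)
    have l: "ln (real n + 1 / 2) = ln (real n) + ln (1 + 1 / (2 * real n))"
    proof -
      have "real n + 1 / 2 = real n * (1 + 1 / (2 * real n))" using n by (simp add: field_simps)
      moreover have "1 + 1 / (2 * real n) > 0" by (simp add: add_pos_nonneg)
      ultimately show ?thesis using n by (metis ln_mult_pos of_nat_0_less_iff)
    qed
    have l2: "ln (2 * real n) = ln 2 + ln (real n)" using n by (simp add: ln_mult)
    have e1: "stirling_exponent (2 * of_nat n)
        = of_real ((2 * real n - 1 / 2) * ln (2 * real n) - 2 * real n)"
      using a[of "2 * real n"] n by simp
    have e2: "stirling_exponent (of_nat n) = of_real ((real n - 1 / 2) * ln (real n) - real n)"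
      using a[of "real n"] n by simp
    have e3: "stirling_exponent (of_nat n + 1 / 2) =
        of_real ((real n + 1 / 2 - 1 / 2) * ln (real n + 1 / 2) - (real n + 1 / 2))"
      using a[of "real n + 1 / 2"] n by simp
    have e4: "(1 - 2 * of_nat n) * of_real (ln 2) = complex_of_real ((1 - 2 * real n) * ln 2)"
      by simp
    show ?thesis
      unfolding e1 e2 e3 e4 r_def l l2 of_real_diff[symmetric] of_real_add[symmetric] of_real_eq_iff
      by (simp add: algebra_simps)
  qed
  have "r \<longlonglongrightarrow> ln 2 / 2" unfolding r_def by real_asymp
  hence "(\<lambda>n. exp (complex_of_real (r n))) \<longlonglongrightarrow> exp (of_real (ln 2 / 2))"
    by (intro tendsto_intros)
  moreover have "exp (complex_of_real (ln 2 / 2)) = of_real (sqrt 2)"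
    unfolding exp_of_real by (simp add: ln_sqrt[symmetric])
  ultimately have lim: "(\<lambda>n. exp (complex_of_real (r n))) \<longlonglongrightarrow> of_real (sqrt 2)" by simp
  have "eventually (\<lambda>n. exp (complex_of_real (r n))
      = exp (stirling_exponent (2 * of_nat n) - stirling_exponent (of_nat n)
      - stirling_exponent (of_nat n + 1 / 2) + (1 - 2 * of_nat n) * of_real (ln 2))) sequentially"
    using eventually_gt_at_top[of 0] by eventually_elim (use eq in auto)
  from Lim_transform_eventually[OF lim this] show ?thesis .
qed

lemma stirling_quotient_nat_nonzero:
  assumes "n > 0"
  shows "stirling_quotient (of_nat n) \<noteq> 0"
  using assms by (simp add: stirling_quotient_def Gamma_eq_zero_iff Re_pos_imp_not_nonpos_Int)

lemma stirling_quotient_shift_limit: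
  assumes "Re w > 0" "(\<lambda>n. stirling_quotient (of_nat n)) \<longlonglongrightarrow> L"
  shows "(\<lambda>n. stirling_quotient (w + of_nat n)) \<longlonglongrightarrow> L"
proof -
  have "(\<lambda>n. stirling_quotient (w
      + of_nat n) / stirling_quotient (of_nat n) * stirling_quotient (of_nat n))
      \<longlonglongrightarrow> 1 * L"
    by (intro tendsto_mult assms stirling_quotient_ratio_limit)
  moreover have "eventually (\<lambda>n. stirling_quotient (w
      + of_nat n) / stirling_quotient (of_nat n) * stirling_quotient (of_nat n)
      = stirling_quotient (w + of_nat n)) sequentially"
    using eventually_gt_at_top[of 0] by eventually_elim (use stirling_quotient_nat_nonzero in auto)
  ultimately show ?thesis using Lim_transform_eventually by fastforce
qed

text \<open>The duplication formula becomes L^2 = sqrt pi sqrt 2 L in the limit, and L is nonzero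
  because it is a Gamma value times exponentials.\<close>

lemma stirling_quotient_nat_limit:
  "(\<lambda>n. stirling_quotient (of_nat n)) \<longlonglongrightarrow> of_real (sqrt (2 * pi))"
proof -
  \<comment> \<open>The limit is known to exist along 2, 3, ..., since the series for
    \<open>stirling_mu\<close> was bounded for modulus at least 2.\<close>
  define L where "L = stirling_quotient 2 * exp (- stirling_mu 2)"
  have "(\<lambda>n. stirling_quotient (of_nat (n + 2))) \<longlonglongrightarrow> L"
    using stirling_quotient_limit[of 2] by (simp add: L_def add_ac)
  hence L: "(\<lambda>n. stirling_quotient (of_nat n)) \<longlonglongrightarrow> L" by (rule LIMSEQ_offset)
  have L0: "L \<noteq> 0"
  proof -
    have "Gamma (2::complex) \<noteq> 0" by (simp add: Gamma_eq_zero_iff Re_pos_imp_not_nonpos_Int)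
    thus ?thesis by (simp add: L_def stirling_quotient_def)
  qed
  have Lh: "(\<lambda>n. stirling_quotient (1 / 2 + of_nat n)) \<longlonglongrightarrow> L"
    by (rule stirling_quotient_shift_limit[OF _ L]) auto
  have L2: "(\<lambda>n. stirling_quotient (of_nat (2 * n))) \<longlonglongrightarrow> L"
    using L by (rule filterlim_compose) (intro mult_nat_left_at_top, simp)
  have eq: "stirling_quotient (of_nat n) * stirling_quotient (1 / 2 + of_nat n) =
      of_real (sqrt pi) * stirling_quotient (of_nat (2 * n)) *
      exp (stirling_exponent (2 * of_nat n) - stirling_exponent (of_nat n)
      - stirling_exponent (of_nat n + 1 / 2) + (1 - 2 * of_nat n) * of_real (ln 2))" if n: "n >
        0" for n
  proof -
    have "Gamma (of_nat n) * Gamma (of_nat n + 1 / 2) =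
        exp ((1 - 2 * of_nat n) * of_real (ln 2)) * of_real (sqrt pi) * Gamma (2 * of_nat n ::
          complex)"
      by (intro Gamma_legendre_duplication Re_pos_imp_not_nonpos_Int) (use n in auto)
    moreover have "exp (stirling_exponent (2 * of_nat n) - stirling_exponent (of_nat n)
      - stirling_exponent (of_nat n + 1 / 2) + (1 - 2 * of_nat n) * of_real (ln 2)) =
      exp (stirling_exponent (2 * of_nat n)) * exp (- stirling_exponent (of_nat n)) *
      exp (- stirling_exponent (1 / 2 + of_nat n)) * exp ((1 - 2 * of_nat n) * of_real (ln 2))"
      by (simp flip: exp_add add: add_ac)
    moreover have "exp (stirling_exponent (2 * of_nat n)) * exp (- stirling_exponent (2 * of_nat n))
        = 1"
      by (simp flip: exp_add)
    ultimately show ?thesis unfolding stirling_quotient_def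
      by (simp add: algebra_simps)
  qed
  have "(\<lambda>n. stirling_quotient (of_nat n) * stirling_quotient (1 / 2 + of_nat n)) \<longlonglongrightarrow> L * L"
    by (intro tendsto_intros L Lh)
  moreover have "(\<lambda>n. of_real (sqrt pi) * stirling_quotient (of_nat (2 * n)) *
      exp (stirling_exponent (2 * of_nat n) - stirling_exponent (of_nat n)
      - stirling_exponent (of_nat n + 1 / 2) + (1 - 2 * of_nat n) * of_real (ln 2)))
      \<longlonglongrightarrow> of_real (sqrt pi) * L * of_real (sqrt 2)"
    by (intro tendsto_mult tendsto_const L2 stirling_exponent_duplication_limit)
  hence "(\<lambda>n. stirling_quotient (of_nat n) * stirling_quotient (1 / 2 + of_nat n))
      \<longlonglongrightarrow> of_real (sqrt pi) * L * of_real (sqrt 2)"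
    by (rule Lim_transform_eventually)
       (auto intro!: eventually_mono[OF eventually_gt_at_top[of 0]] simp: eq)
  ultimately have "L * L = of_real (sqrt pi) * L * of_real (sqrt 2)" by (rule LIMSEQ_unique)
  hence "L = of_real (sqrt (2 * pi))" using L0 by (simp add: real_sqrt_mult)
  thus ?thesis using L by simp
qed

theorem Gamma_stirling_complex:
  assumes "Re w > 0" "norm w \<ge> 2"
  shows "Gamma w = of_real (sqrt (2 * pi)) * exp ((w - 1 / 2) * Ln w - w + stirling_mu w)"
proof -
  have "stirling_quotient w * exp (- stirling_mu w) = of_real (sqrt (2 * pi))"
    using LIMSEQ_unique[OF stirling_quotient_limit[OF assms]
      stirling_quotient_shift_limit[OF assms(1) stirling_quotient_nat_limit]] .
  hence "Gamma w * (exp (- stirling_exponent w) * exp (- stirling_mu w)) = of_real (sqrt (2 * pi))"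
    by (simp add: stirling_quotient_def mult_ac)
  moreover have "exp (- stirling_exponent w) * exp (- stirling_mu w) *
      exp (stirling_exponent w + stirling_mu w) = 1"
    by (simp flip: exp_add)
  ultimately have "Gamma w = of_real (sqrt (2 * pi)) * exp (stirling_exponent w + stirling_mu w)"
    by (metis mult.assoc mult.right_neutral)
  thus ?thesis by (simp add: stirling_exponent_def)
qed

subsection \<open>The saddle point and the factor chi\<close>

text \<open>The f of the overview. The factor \<eta>^(s-1) exp (-pi i \<eta>^2) of the theorem is
  its value at \<eta>.\<close>

definition saddle_monomial :: "complex \<Rightarrow> complex \<Rightarrow> complex" where
  "saddle_monomial s x = x powr (s - 1) * exp (- (of_real pi * \<i> * x\<^sup>2))"

text \<open>Reflection for Gamma (s / 2) and duplication for Gamma ((1 - s) / 2). In this form Gamma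
  is taken at 1 - s, in the half-plane where Stirling's formula is available, and the zeros of
  \<open>chi\<close> sit in the sine.\<close>

lemma chi_reflected:
  assumes "Re s < 1"
  shows "chi s = exp (s * of_real (ln 2) + (s - 1) * of_real (ln pi)) *
           sin (of_real pi * s / 2) * Gamma (1 - s)"
proof -
  have g1: "Gamma (1 - s / 2) \<noteq> 0"
    using assms by (simp add: Gamma_eq_zero_iff Re_pos_imp_not_nonpos_Int)
  have refl: "Gamma (s / 2) * Gamma (1 - s / 2) = of_real pi / sin (of_real pi * s / 2)"
    using Gamma_reflection_complex[of "s / 2"] by simp
  have inv: "1 / Gamma (s / 2) = sin (of_real pi * s / 2) * Gamma (1 - s / 2) / of_real pi"
  \<comment> \<open>At a pole of Gamma (s / 2) the library value is 0. The reflection formula then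
    forces the sine to be 0, and both sides are 0 because division by zero yields zero.\<close>
  proof (cases "Gamma (s / 2) = 0")
    case True
    hence "sin (of_real pi * s / 2) = 0" using refl by simp
    thus ?thesis using True by simp
  next
    case False
    hence "sin (of_real pi * s / 2) \<noteq> 0" using refl g1 by auto
    thus ?thesis using refl False by (simp add: field_simps)
  qed
  have "Gamma ((1 - s) / 2) * Gamma ((1 - s) / 2 + 1 / 2) =
      exp ((1 - 2 * ((1 - s) / 2)) * of_real (ln 2)) * of_real (sqrt pi) * Gamma (2 * ((1 - s) /
        2))"
    using assms
      by (intro Gamma_legendre_duplication Re_pos_imp_not_nonpos_Int) (auto simp: add_pos_pos)
  moreover have "(1 - s) / 2 + 1 / 2 = 1 - s / 2" "1 - 2 * ((1 - s) / 2) = s" "2 * ((1 - s) / 2)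
      = 1 - s"
    by (simp_all add: field_simps)
  ultimately have dup: "Gamma ((1 - s) / 2) * Gamma (1 - s / 2) =
      exp (s * of_real (ln 2)) * of_real (sqrt pi) * Gamma (1 - s)" by (simp only:)
  have p: "of_real pi powr (s - 1 / 2) * of_real (sqrt pi) / of_real pi
      = exp ((s - 1) * of_real (ln pi))"
  proof -
    have "complex_of_real (sqrt pi) = exp (of_real (ln pi / 2))"
      unfolding exp_of_real by (simp add: ln_sqrt[symmetric])
    moreover have "complex_of_real pi = exp (of_real (ln pi))" unfolding exp_of_real by simp
    moreover have "of_real pi powr (s - 1 / 2) = exp ((s - 1 / 2) * of_real (ln pi))"
      by (simp add: powr_def Ln_of_real)
    ultimately have "of_real pi powr (s - 1 / 2) * of_real (sqrt pi) / of_real pi =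
       exp ((s - 1 / 2) * of_real (ln pi)) * exp (of_real (ln pi / 2)) / exp (of_real (ln
         pi))" by metis
    also have "\<dots> = exp ((s - 1) * of_real (ln pi))"
      unfolding exp_add[symmetric] exp_diff[symmetric]
        by (rule arg_cong[of _ _ exp]) (simp add: algebra_simps)
    finally show ?thesis .
  qed
  have "chi s = of_real pi powr (s - 1 / 2) * Gamma ((1 - s) / 2) * (1 / Gamma (s / 2))"
    by (simp add: chi_def)
  also have "\<dots> = of_real pi powr (s - 1 / 2) * (Gamma ((1 - s) / 2) * Gamma (1 - s / 2)) *
      sin (of_real pi * s / 2) / of_real pi" unfolding inv by simp
  also have "\<dots> = exp (s * of_real (ln 2)) *
      (of_real pi powr (s - 1 / 2) * of_real (sqrt pi) / of_real pi) * sin (of_real pi * s / 2) *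
        Gamma (1 - s)"
    unfolding dup by simp
  finally show ?thesis unfolding p by (simp add: exp_add)
qed

text \<open>With w = 1 - s, the power \<eta>^(2 s - 1) cancels Stirling's term (w - 1/2) Ln w,
  because Ln \<eta> contains Ln w / 2, and the two Gaussians cancel exp (-w). There remain a factor
  2, the phase (2 s - 1) pi i / 4 and Binet's function; multiplied by the sine, the phase becomes 1
  - exp (pi i s).\<close>

lemma chi_saddle:
  assumes s: "s - 1 = 2 * of_real pi * \<i> * \<eta>\<^sup>2"
    and Ln: "Ln \<eta> = \<i> * of_real pi / 4 + (Ln (1 - s) - of_real (ln (2 * pi))) / 2"
    and "Re s < 1" "norm (1 - s) \<ge> 2" "\<eta> \<noteq> 0"
  shows "chi s * (saddle_monomial s \<eta>)\<^sup>2 * \<eta> =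
     cis (pi / 4) * (1 - exp (\<i> * of_real pi * s)) * exp (stirling_mu (1 - s))"
proof -
  define w where "w = 1 - s"
  have eta: "\<eta> = exp (Ln \<eta>)" using exp_Ln[OF assms(5)] by simp
  have ws: "w = - (2 * of_real pi * \<i> * \<eta>\<^sup>2)" using s by (simp add: w_def algebra_simps)
  have sq: "complex_of_real (sqrt (2 * pi)) = exp (of_real (ln (2 * pi)) / 2)"
  proof -
    have "complex_of_real (sqrt (2 * pi)) = exp (of_real (ln (2 * pi) / 2))"
      unfolding exp_of_real by (simp add: ln_sqrt[symmetric])
    thus ?thesis by simp
  qed
  have G: "Gamma w = exp (of_real (ln (2 * pi)) / 2 + ((w - 1 / 2) * Ln w - w + stirling_mu w))"
    using Gamma_stirling_complex[of w] assms unfolding sq exp_add by (simp add: w_def)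
  have sm: "saddle_monomial s \<eta> = exp ((s - 1) * Ln \<eta> + w / 2)"
    using assms(5) unfolding saddle_monomial_def powr_def exp_add ws by (simp add: mult.assoc)
  have l2p: "complex_of_real (ln (2 * pi)) = of_real (ln 2) + of_real (ln pi)"
    by (simp add: ln_mult)
  have sw: "s = 1 - w" by (simp add: w_def)
  have "exp (s * of_real (ln 2) + (s - 1) * of_real (ln pi)) * Gamma w * (saddle_monomial s \<eta>)\<^sup>2 * \<eta>
     = exp ((s * of_real (ln 2) + (s - 1) * of_real (ln pi)) +
       (of_real (ln (2 * pi)) / 2 + ((w - 1 / 2) * Ln w - w + stirling_mu w)) +
       (((s - 1) * Ln \<eta> + w / 2) + ((s - 1) * Ln \<eta> + w / 2)) + Ln \<eta>)"
    unfolding exp_add[of "_ + _ + _" "Ln \<eta>"] eta[symmetric] G sm power2_eq_square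
    by (simp only: exp_add mult_ac)
  also have "\<dots> = exp (of_real (ln 2) + (2 * s - 1) * \<i> * of_real pi / 4 + stirling_mu w)"
    unfolding Ln w_def[symmetric] l2p sw by (rule arg_cong[of _ _ exp]) (simp add: field_simps)
  also have "\<dots> = 2 * exp ((2 * s - 1) * \<i> * of_real pi / 4) * exp (stirling_mu w)"
    unfolding exp_add exp_of_real by simp
  finally have A: "exp (s * of_real (ln 2)
      + (s - 1) * of_real (ln pi)) * Gamma w * (saddle_monomial s \<eta>)\<^sup>2 * \<eta>
     = 2 * exp ((2 * s - 1) * \<i> * of_real pi / 4) * exp (stirling_mu w)" .
  have B: "2 * exp ((2 * s - 1) * \<i> * of_real pi / 4) * sin (of_real pi * s / 2) =
     cis (pi / 4) * (1 - exp (\<i> * of_real pi * s))"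
  proof -
    define a where "a = exp (\<i> * of_real pi * s / 2)"
    have a0: "a \<noteq> 0" by (simp add: a_def)
    have c: "cis (pi / 4) * cis (pi / 4) = \<i>" by (simp add: cis_mult cis_pi_half)
    have "(2 * s - 1) * \<i> * of_real pi / 4 = \<i> * of_real pi * s / 2 - \<i> * of_real (pi / 4)"
      by (simp add: field_simps)
    hence e: "exp ((2 * s - 1) * \<i> * of_real pi / 4) = a / cis (pi / 4)"
      unfolding a_def cis_conv_exp exp_diff[symmetric] by (simp only:)
    have sn: "sin (of_real pi * s / 2) = (a - 1 / a) / (2 * \<i>)"
      unfolding sin_exp_eq a_def by (simp add: exp_minus field_simps)
    have aa: "exp (\<i> * of_real pi * s) = a * a"
      unfolding a_def exp_add[symmetric] by (rule arg_cong[of _ _ exp]) simp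
    have inv: "1 / (cis (pi / 4) * \<i>) = - cis (pi / 4)"
    proof -
      have "cis (pi / 4) * \<i> * - cis (pi / 4) = - ((cis (pi / 4) * cis (pi / 4)) * \<i>)"
        by (simp only: mult_ac mult_minus_right)
      also have "\<dots> = 1" unfolding c by simp
      finally show ?thesis by (metis divide_inverse inverse_unique mult_1)
    qed
    have "2 * (a / e) * (x / (2 * j)) = (a * x) * (1 / (e * j))" for e x j :: complex by simp
    from this[of "cis (pi / 4)" "a - 1 / a" \<i>]
    have "2 * (a / cis (pi / 4)) * ((a - 1 / a) / (2 * \<i>))
        = (a * (a - 1 / a)) * (1 / (cis (pi / 4) * \<i>))" .
    also have "a * (a - 1 / a) = a * a - 1" using a0 by (simp add: right_diff_distrib)
    finally show ?thesis unfolding e sn aa inv by (simp add: algebra_simps)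
  qed
  have "chi s * (saddle_monomial s \<eta>)\<^sup>2 * \<eta> =
     (exp (s * of_real (ln 2) + (s - 1) * of_real (ln pi)) * Gamma w * (saddle_monomial s \<eta>)\<^sup>2 * \<eta>)
       *
       sin (of_real pi * s / 2)"
    unfolding chi_reflected[OF assms(3)] w_def by simp
  also have "\<dots> = (2 * exp ((2 * s - 1) * \<i> * of_real pi / 4) * sin (of_real pi * s / 2))
      * exp (stirling_mu w)"
    unfolding A by simp
  finally show ?thesis unfolding B w_def .
qed

lemma exp_one_bounds: "exp 1 \<ge> (5/2::real)" "exp 1 \<le> (272/100::real)"
proof -
  show "exp 1 \<ge> (5/2::real)" using exp_lower_Taylor_quadratic[of "1::real"] by simp
  show "exp 1 \<le> (272/100::real)" using e_less_272 by simp
qed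

text \<open>For Re s < 1 the number (1 - s) / (2 pi) lies in the right half-plane, so \<eta> lies in
  the open first quadrant. The logarithm is needed exactly, without a multiple of 2 pi i, for the
  cancellation against Stirling's formula.\<close>

lemma eta_basic:
  assumes "Re s < 1"
  shows "s - 1 = 2 * of_real pi * \<i> * (eta s)\<^sup>2" "Re (eta s) > 0" "Im (eta s) > 0"
    "Ln (eta s) = \<i> * of_real pi / 4 + (Ln (1 - s) - of_real (ln (2 * pi))) / 2"
proof -
  have nn: "s - 1 \<notin> \<real>\<^sub>\<ge>\<^sub>0" using assms by (auto simp: complex_nonneg_Reals_iff)
  define y where "y = (1 - s) / (2 * of_real pi)"
  have Rs: "Re y > 0"
  proof -
    have "y = (1 - s) / of_real (2 * pi)" by (simp add: y_def)
    thus ?thesis using assms by (simp only: Re_divide_of_real) simp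
  qed
  hence y0: "y \<noteq> 0" by auto
  have e: "eta s = exp (\<i> * of_real pi / 4) * csqrt y"
    using eta_eq_csqrt[OF nn] by (simp add: y_def)
  have i2: "exp (\<i> * of_real pi / 4) ^ 2 = \<i>"
  proof -
    have "exp (\<i> * of_real pi / 4) = cis (pi / 4)" by (simp add: cis_conv_exp)
    thus ?thesis by (simp add: power2_eq_square cis_mult cis_pi_half)
  qed
  show "s - 1 = 2 * of_real pi * \<i> * (eta s)\<^sup>2"
    unfolding e power_mult_distrib i2 by (simp add: y_def field_simps)

  have Lw: "Ln y = Ln (1 - s) - of_real (ln (2 * pi))"
  proof -
    have "Ln ((1 - s) / of_real (2 * pi)) = Ln (1 - s) - ln (2 * pi)"
      using y0 by (intro Ln_divide_of_real) (auto simp: y_def)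
    thus ?thesis by (simp add: y_def)
  qed
  have im: "\<bar>Im (Ln y)\<bar> < pi / 2" using Re_Ln_pos_lt[OF y0] Rs by simp
  have eL: "eta s = exp (\<i> * of_real pi / 4 + Ln y / 2)"
    unfolding e exp_add using csqrt_exp_Ln[OF y0] by simp
  define a where "a = pi / 4 + Im (Ln y) / 2"
  have a: "0 < a" "a < pi / 2" using im by (auto simp: a_def)
  have I: "Im (\<i> * of_real pi / 4 + Ln y / 2) = a" by (simp add: a_def)
  show "Re (eta s) > 0" unfolding eL Re_exp I using a by (auto intro!: mult_pos_pos cos_gt_zero)
  show "Im (eta s) > 0" unfolding eL Im_exp I using a by (auto intro!: mult_pos_pos sin_gt_zero2)
  have "Ln (eta s) = \<i> * of_real pi / 4 + Ln y / 2"
    unfolding eL by (rule Ln_exp) (use I a pi_gt_zero in \<open>linarith+\<close>)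
  thus "Ln (eta s) = \<i> * of_real pi / 4 + (Ln (1 - s) - of_real (ln (2 * pi))) / 2"
    unfolding Lw .
qed

lemma saddle_coordinates:
  assumes "s - 1 = 2 * of_real pi * \<i> * \<eta>\<^sup>2"
  shows "1 - Re s = 4 * pi * Re \<eta> * Im \<eta>" "Im s = 2 * pi * ((Re \<eta>)\<^sup>2 - (Im \<eta>)\<^sup>2)"
    "norm (s - 1) = 2 * pi * (norm \<eta>)\<^sup>2"
proof -
  have "Re (s - 1) = - (4 * pi * Re \<eta> * Im \<eta>)" "Im (s - 1) = 2 * pi * ((Re \<eta>)\<^sup>2 - (Im \<eta>)\<^sup>2)"
    unfolding assms by (simp_all add: power2_eq_square algebra_simps)
  thus "1 - Re s = 4 * pi * Re \<eta> * Im \<eta>" "Im s = 2 * pi * ((Re \<eta>)\<^sup>2 - (Im \<eta>)\<^sup>2)" by simp_all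
  show "norm (s - 1) = 2 * pi * (norm \<eta>)\<^sup>2"
    unfolding assms by (simp add: norm_mult norm_power)
qed

text \<open>The tangent of ln at exp 2, the value that |\<eta>|^2 exceeds in
  \<open>region_N\<close>.\<close>

lemma ln_le_tangent_e2:
  assumes "N > (0::real)"
  shows "ln N \<le> 1 + N / (exp 1)\<^sup>2"
proof -
  have "ln (N / (exp 1)\<^sup>2) \<le> N / (exp 1)\<^sup>2 - 1" using assms by (intro ln_le_minus_one) auto
  moreover have "ln (N / (exp 1)\<^sup>2) = ln N - 2" using assms by (simp add: ln_div ln_realpow)
  ultimately show ?thesis by simp
qed

text \<open>With B = (Im \<eta>)^2 and T = Im s / (2 pi) one has |\<eta>|^2 = T + 2 B, and 2 ln
  |\<eta>|^2 has to be bounded by B + 3. By the last claim, the part of the region with Re s > -5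
  lies far below the real axis, where exp (pi i s) is huge.\<close>

lemma region_N_eta:
  assumes "s \<in> region_N"
  shows "(norm (eta s))\<^sup>2 \<ge> 25 / 4" "(Im (eta s))\<^sup>2 \<ge> 9 / 5"
    "(norm (eta s)) ^ 4 \<le> exp ((Im (eta s))\<^sup>2 + 3)"
    "Re s > -5 \<Longrightarrow> Im s < -30"
proof -
  define \<eta> where "\<eta> = eta s"
  have R1: "Re s < 1" and n1: "norm (s - 1) > 2 * pi * (exp 1)\<^sup>2" using assms
    by (auto simp: region_N_def)
  note b = eta_basic[OF R1, folded \<eta>_def]
  note sc = saddle_coordinates[OF b(1)]
  define B where "B = (Im \<eta>)\<^sup>2"
  define T where "T = (Re \<eta>)\<^sup>2 - B"
  define N where "N = (norm \<eta>)\<^sup>2"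
  have N: "N = T + 2 * B" by (simp add: N_def T_def B_def cmod_power2)
  have Im: "Im s = 2 * pi * T" using sc(2) by (simp add: T_def B_def)
  have e2: "(exp 1)\<^sup>2 \<ge> (25/4::real)"
    using power_mono[OF exp_one_bounds(1), of 2] by (simp add: power2_eq_square)
  have Ne: "N > (exp 1)\<^sup>2" using n1 unfolding sc(3) N_def by simp
  hence N25: "N > 25/4" using e2 by linarith
  have lnN: "ln N \<le> 1 + N * (4/25)"
  proof -
    have "ln N \<le> 1 + N / (exp 1)\<^sup>2" using N25 by (intro ln_le_tangent_e2) simp
    also have "N / (exp 1)\<^sup>2 \<le> N / (25/4)" using N25 e2 by (intro divide_left_mono) auto
    finally show ?thesis by simp
  qed
  have B0: "B > 0" using b by (simp add: B_def)
  have key: "B \<ge> 9/5 \<and> 2 * ln N \<le> B + 3"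
  \<comment> \<open>For bounded T, B is about half of |\<eta>|^2 and a linear bound for the
    logarithm is enough. Only for larger T does the curve in the definition of
    \<open>region_N\<close> enter.\<close>
  proof (cases "T \<le> exp 1")
    case True
    hence "T \<le> 272/100" using exp_one_bounds by linarith
    hence "B \<ge> (N - 272/100) / 2" using N by simp
    moreover have "B \<ge> 9/5"
    proof -
      have "N - exp 1 > exp 1 * (exp 1 - 1)" using Ne by (simp add: power2_eq_square algebra_simps)
      moreover have "exp 1 * (exp 1 - 1) \<ge> (5/2) * (3/2::real)"
        using exp_one_bounds by (intro mult_mono) auto
      ultimately have "N - exp 1 \<ge> 15/4" by simp
      thus ?thesis using N True by simp
    qed
    ultimately show ?thesis using lnN N25 by simp
  next
    case False
    hence T: "T > exp 1" "T > 5/2" using exp_one_bounds by linarith+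
    have "Im s / (2 * pi) = T" using Im by simp
    moreover have "Im s > 2 * pi * exp 1" using T unfolding Im by simp
    ultimately have A: "1 - Re s \<ge> 8 * pi * sqrt (T * ln T)"
      using assms by (auto simp: region_N_def)
    have lnT: "ln T > 1" using T ln_less_cancel_iff[of "exp 1" T] by simp
    \<comment> \<open>Since 1 - Re s = 4 pi Re \<eta> Im \<eta>, the condition on Re s squares to 4
      T ln T <= (T + B) B.\<close>
    have "pi * (8 * sqrt (T * ln T)) \<le> pi * (4 * Re \<eta> * Im \<eta>)" using A sc(1) by (simp add: mult_ac)
    hence h: "2 * sqrt (T * ln T) \<le> Re \<eta> * Im \<eta>" by (simp add: mult.commute)
    have "(2 * sqrt (T * ln T))\<^sup>2 \<le> (Re \<eta> * Im \<eta>)\<^sup>2"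
      by (rule power_mono[OF h]) (use T lnT in auto)
    moreover have "(Re \<eta> * Im \<eta>)\<^sup>2 = (T + B) * B" by (simp add: T_def B_def power_mult_distrib)
    moreover have "(2 * sqrt (T * ln T))\<^sup>2 = 4 * (T * ln T)" using T lnT
      by (simp add: power_mult_distrib)
    ultimately have TB: "4 * (T * ln T) \<le> (T + B) * B" by simp
    \<comment> \<open>For B < T the inequality gives B >= 2 ln T, while |\<eta>|^2 < 3 T. The 3 in
      the claim comes from 2 ln 3 <= 3.\<close>
    show ?thesis
    proof (cases "B \<ge> T")
      case True
      hence "N \<le> 3 * B" using N by linarith
      moreover from this have "B \<ge> 9/5" using N25 by linarith
      ultimately show ?thesis using lnN by simp
    next
      case False
      have "(T + B) * B \<le> (2 * T) * B" using False B0 by (intro mult_right_mono) auto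
      hence "T * (2 * ln T) \<le> T * B" using TB by (simp add: algebra_simps)
      hence BT: "B \<ge> 2 * ln T" using T by simp
      have "ln N \<le> ln (3 * T)" using N25 False N T by (subst ln_le_cancel_iff) auto
      also have "\<dots> = ln 3 + ln T" using T by (intro ln_mult_pos) auto
      also have "ln 3 \<le> (3/2::real)"
      proof -
        have "3 \<le> exp (3/2::real)" using exp_lower_Taylor_quadratic[of "3/2::real"]
          by (simp add: power2_eq_square)
        hence "ln 3 \<le> ln (exp (3/2::real))" by (subst ln_le_cancel_iff) auto
        thus ?thesis by simp
      qed
      finally show ?thesis using BT lnT by simp
    qed
  qed
  show "(norm (eta s))\<^sup>2 \<ge> 25 / 4" using N25 by (simp add: N_def \<eta>_def)
  show "(Im (eta s))\<^sup>2 \<ge> 9 / 5" using key by (simp add: B_def \<eta>_def)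
  have "(norm \<eta>) ^ 4 = N * N" by (simp add: N_def power2_eq_square power4_eq_xxxx)
  also have "\<dots> = exp (ln N + ln N)" unfolding exp_add using N25 by simp
  also have "\<dots> \<le> exp (B + 3)" using key by simp
  finally show "(norm (eta s)) ^ 4 \<le> exp ((Im (eta s))\<^sup>2 + 3)" by (simp add: B_def \<eta>_def)
  assume s5: "Re s > -5"
  \<comment> \<open>For larger Im s the bounding curve would force 1 - Re s >= 24, against Re s >
    -5.\<close>
  have tle: "Im s \<le> 2 * pi * exp 1"
  proof (rule ccontr)
    assume "\<not> ?thesis"
    hence t: "Im s > 2 * pi * exp 1" by simp
    hence A: "1 - Re s \<ge> 8 * pi * sqrt (T * ln T)" using assms Im by (auto simp: region_N_def)
    have T: "T > exp 1" using t unfolding Im by simp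
    hence lnT: "ln T > 1" using ln_less_cancel_iff[of "exp 1" T]
      by (simp add: less_trans[OF exp_gt_zero])
    have "T > 1" using T exp_one_bounds(1) by linarith
    hence "T * ln T \<ge> 1 * 1" using lnT by (intro mult_mono) auto
    hence "sqrt (T * ln T) \<ge> 1" by simp
    hence "8 * pi * sqrt (T * ln T) \<ge> 8 * 3 * 1" using pi_gt3 by (intro mult_mono) auto
    thus False using A s5 by simp
  qed
  have "pi * exp 1 \<le> 3.1416 * (272/100)" using pi_approx exp_one_bounds by (intro mult_mono) auto
  hence t18: "Im s \<le> 18" using tle by simp
  have "norm (s - 1) \<le> \<bar>Re (s - 1)\<bar> + \<bar>Im (s - 1)\<bar>" by (rule cmod_le)
  moreover have "norm (s - 1) > 37"
  proof -
    have "2 * pi * (exp 1)\<^sup>2 \<ge> 2 * 3 * (25/4)" using pi_gt3 e2 by (intro mult_mono) auto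
    thus ?thesis using n1 by simp
  qed
  ultimately have "\<bar>Im s\<bar> > 31" using s5 R1 by simp
  thus "Im s < -30" using t18 by simp
qed

subsection \<open>The function G away from the real axis\<close>

text \<open>The sum of z - z^3 - z^5 + z^7 + z^9 - ... for |z| < 1. At z = exp (pi i \<eta>) it
  equals -i sin (pi \<eta>) / cos (2 pi \<eta>).\<close>

definition mordell_main :: "complex \<Rightarrow> complex" where
  "mordell_main z = z * (1 - z\<^sup>2) / (1 + z ^ 4)"

lemma norm_sin_ge:
  fixes x :: complex
  assumes "Im x \<ge> 1 / 2"
  shows "norm (sin x) \<ge> exp (Im x) / 4"
proof -
  have "norm (sin x) = norm (exp (\<i> * x) - exp (- (\<i> * x))) / 2"
    unfolding sin_exp_eq by (simp add: norm_divide norm_mult)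
  moreover have "norm (exp (- (\<i> * x))) - norm (exp (\<i> * x)) \<le> norm (exp (\<i> * x) - exp (- (\<i> * x)))"
    by (metis norm_minus_commute norm_triangle_ineq2)
  moreover have "norm (exp (- (\<i> * x))) = exp (Im x)" "norm (exp (\<i> * x)) = exp (- Im x)"
    by simp_all
  moreover have "exp (- Im x) \<le> exp (Im x) / 2"
  proof -
    have "2 \<le> exp (1::real)" using exp_one_bounds by linarith
    also have "\<dots> \<le> exp (2 * Im x)" using assms by simp
    finally have "2 * exp (- Im x) \<le> exp (2 * Im x) * exp (- Im x)" by (intro mult_right_mono) auto
    also have "\<dots> = exp (Im x)" by (simp flip: exp_add)
    finally show ?thesis by simp
  qed
  ultimately show ?thesis by simp
qed

lemma cos_nonzero_of_Im_nonzero: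
  assumes "Im x \<noteq> 0"
  shows "cos (x::complex) \<noteq> 0"
proof
  assume "cos x = 0"
  hence "exp (\<i> * x) = - exp (- (\<i> * x))" by (simp add: cos_exp_eq add_eq_0_iff2)
  hence "norm (exp (\<i> * x)) = norm (exp (- (\<i> * x)))" by (metis norm_minus_cancel)
  thus False using assms by simp
qed

text \<open>The zeros of cos (pi q) are real, so off the real axis the quotient is analytic and
  \<open>remove_sings\<close> leaves its value unchanged.\<close>

lemma G_bar_eq:
  assumes "Im p \<noteq> 0"
  shows "G_bar p = (exp (- (of_real pi * \<i> / 2 * p\<^sup>2))
     - of_real (sqrt 2) * exp (- (of_real pi * \<i> / 8)) * cos (of_real pi * p / 2)) / cos (of_real pi
       * p)"
proof -
  have nz: "cos (of_real pi * cnj p) \<noteq> 0" using assms by (intro cos_nonzero_of_Im_nonzero) simp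
  have "(\<lambda>q. (exp (of_real pi * \<i> / 2 * q\<^sup>2)
        - of_real (sqrt 2) * exp (of_real pi * \<i> / 8) * cos (of_real pi * q / 2))
     / cos (of_real pi * q)) analytic_on {cnj p}"
    using nz by (intro analytic_intros) auto
  hence "G (cnj p) = (exp (of_real pi * \<i> / 2 * (cnj p)\<^sup>2)
        - of_real (sqrt 2) * exp (of_real pi * \<i> / 8) * cos (of_real pi * cnj p / 2))
     / cos (of_real pi * cnj p)"
    unfolding G_def by (rule remove_sings_at_analytic)
  thus ?thesis unfolding G_bar_def
    by (simp add: exp_cnj cnj_cos)
qed

lemma sin_over_cos_double:
  "sin (of_real pi * \<eta>) / cos (2 * of_real pi * \<eta>) = \<i> * mordell_main (exp (of_real pi * \<i> * \<eta>))"
proof -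
  define z where "z = exp (of_real pi * \<i> * \<eta>)"
  have z0: "z \<noteq> 0" by (simp add: z_def)
  have a: "exp (\<i> * (of_real pi * \<eta>)) = z" by (simp add: z_def mult_ac)
  have b: "exp (- (\<i> * (of_real pi * \<eta>))) = 1 / z" by (simp add: exp_minus a divide_inverse)
  have c: "exp (\<i> * (2 * of_real pi * \<eta>)) = z\<^sup>2"
    unfolding z_def power2_eq_square exp_add[symmetric] by (simp add: algebra_simps)
  have d: "exp (- (\<i> * (2 * of_real pi * \<eta>))) = 1 / z\<^sup>2" by (simp add: exp_minus c divide_inverse)
  have s: "sin (of_real pi * \<eta>) = (z - 1 / z) / (2 * \<i>)" unfolding sin_exp_eq a b by simp
  have t: "cos (2 * of_real pi * \<eta>) = (z\<^sup>2 + 1 / z\<^sup>2) / 2" unfolding cos_exp_eq c d by simp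
  have "(z - 1 / z) = (z\<^sup>2 - 1) / z" using z0 by (simp add: field_simps power2_eq_square)
  moreover have "z\<^sup>2 + 1 / z\<^sup>2 = (1 + z ^ 4) / z\<^sup>2"
    using z0 by (simp add: field_simps power2_eq_square power4_eq_xxxx)
  moreover have "((z\<^sup>2 - 1) / z / (2 * \<i>)) / ((1 + z ^ 4) / z\<^sup>2 / 2)
      = \<i> * (z * (1 - z\<^sup>2) / (1 + z ^ 4))"
    using z0 by (simp add: power2_eq_square) (simp add: divide_simps power2_eq_square algebra_simps)
  ultimately show ?thesis unfolding s t mordell_main_def z_def[symmetric] by simp
qed

lemma cos_shift_int:
  "cos (x - of_int m * of_real pi :: complex) = (- 1) powi m * cos x"
proof -
  have "cos (x - of_int m * of_real pi) =
      cos x * cos (of_int m * of_real pi) + sin x * sin (of_int m * of_real pi)" by (rule cos_diff)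
  moreover have "cos (of_int m * of_real pi :: complex) = of_real (cos (of_int m * pi))"
    by (metis cos_of_real of_real_of_int_eq of_real_mult)
  moreover have "sin (of_int m * of_real pi :: complex) = of_real (sin (of_int m * pi))"
    by (metis sin_of_real of_real_of_int_eq of_real_mult)
  moreover have "sin (of_int m * pi) = 0" by (simp add: sin_zero_iff_int2)
  moreover have "cos (of_int m * pi) = (- 1) powi m"
  proof (cases "even m")
    case True
    then obtain k where k: "m = 2 * k" by (elim evenE)
    have "(- 1 :: real) powi m = ((- 1) powi 2) powi k" unfolding k by (rule power_int_mult)
    thus ?thesis using cos_int_2pin[of k] by (simp add: k mult_ac)
  next
    case False
    then obtain k where k: "m = 2 * k + 1" by (elim oddE)
    have "(- 1) powi m = ((- 1) powi 2) powi k * (- 1 :: real)"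
      unfolding k by (subst power_int_add) (auto simp: power_int_mult)
    moreover have "cos (of_int m * pi) = cos (2 * pi * of_int k + pi)"
      by (simp add: k algebra_simps)
    ultimately show ?thesis using cos_int_2pin[of k] sin_int_2pin[of k]
      by (simp add: cos_add)
  qed
  ultimately show ?thesis by (simp add: mult_ac)
qed

lemma norm_le_exp_quarter:
  assumes "(norm \<eta>) ^ 4 \<le> exp (B + 3)"
  shows "norm \<eta> \<le> exp ((B + 3) / 4)"
proof -
  have "exp (B + 3) = (exp ((B + 3) / 4)) ^ 4" unfolding exp_of_nat_mult[symmetric] by simp
  hence "(norm \<eta>) ^ 4 \<le> (exp ((B + 3) / 4)) ^ 4" using assms by simp
  thus ?thesis by (rule power_mono_iff[THEN iffD1, rotated 3]) auto
qed

text \<open>As pi p / 2 and pi \<eta> - pi / 2 differ by m pi, the cosine part is (-1)^m times a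
  function of \<eta> alone, and the prefactor removes the sign. The Gaussian part \<open>E\<close>
  is relatively negligible: its modulus is exp (pi Re p Im p), and the floor keeps Re p below 1 - 2
  Im \<eta>.\<close>

lemma G_bar_saddle:
  assumes e2: "(Im \<eta>)\<^sup>2 \<ge> 9 / 5" "Im \<eta> > 0"
    and n4: "(norm \<eta>) ^ 4 \<le> exp ((Im \<eta>)\<^sup>2 + 3)"
    and m: "m = \<lfloor>Re \<eta> + Im \<eta>\<rfloor>" and p: "p = - 2 * (of_int m + 1 / 2 - \<eta>)"
  obtains \<epsilon> where "norm \<epsilon> \<le> 1 / norm \<eta>"
    "(- 1) powi m / (2 * \<i>) * G_bar p =
       of_real (1 / sqrt 2) * cis (- pi / 8) * mordell_main (exp (of_real pi * \<i> * \<eta>)) * (1 + \<epsilon>)"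
proof -
  define B where "B = (Im \<eta>)\<^sup>2"
  define c where "c = of_real (sqrt 2) * exp (- (of_real pi * \<i> / 8))"
  define sn where "sn = sin (of_real pi * \<eta>)"
  define cs where "cs = cos (2 * of_real pi * \<eta>)"
  define E where "E = exp (- (of_real pi * \<i> / 2 * p\<^sup>2))"
  define sg :: complex where "sg = (- 1) powi m"
  define \<epsilon> where "\<epsilon> = - (sg * E / (c * sn))"
  have e21: "Im \<eta> \<ge> 1" using e2 by (intro power2_le_imp_le[of 1]) auto
  have n0: "norm \<eta> > 0" using e2 by (auto simp: complex_eq_iff)
  have Ip: "Im p = 2 * Im \<eta>" and Rp: "Re p = 2 * (Re \<eta> - of_int m) - 1" unfolding p by simp_all
  have sg2: "sg * sg = 1" unfolding sg_def by (simp flip: power_int_mult_distrib)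
  have nsg: "norm sg = 1" unfolding sg_def by (simp add: norm_power_int)
  have c1: "cos (of_real pi * p / 2) = sg * sn"
  proof -
    have "of_real pi * p / 2 = (of_real pi * \<eta> - of_real pi / 2) - of_int m * of_real pi"
      unfolding p by (simp add: field_simps)
    hence "cos (of_real pi * p / 2) = sg * cos (of_real pi * \<eta> - of_real pi / 2)"
      unfolding sg_def by (metis cos_shift_int)
    also have "cos (of_real pi * \<eta> - of_real pi / 2) = sn" unfolding sn_def by (simp add: cos_diff)
    finally show ?thesis .
  qed
  have c2: "cos (of_real pi * p) = - cs"
  proof -
    have "of_real pi * p = (2 * of_real pi * \<eta> - of_real pi) - of_int (2 * m) * of_real pi"
      unfolding p by (simp add: algebra_simps)
    hence "cos (of_real pi * p) = (- 1) powi (2 * m) * cos (2 * of_real pi * \<eta> - of_real pi)"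
      by (metis cos_shift_int)
    also have "cos (2 * of_real pi * \<eta> - of_real pi) = - cs" unfolding cs_def
      by (simp add: cos_diff)
    finally show ?thesis by (simp add: power_int_mult)
  qed
  have nsn: "norm sn \<ge> exp (pi * Im \<eta>) / 4"
  proof -
    have "pi * Im \<eta> \<ge> 3 * 1" using e21 pi_gt3 by (intro mult_mono) auto
    thus ?thesis unfolding sn_def using norm_sin_ge[of "of_real pi * \<eta>"] by simp
  qed
  hence sn0: "sn \<noteq> 0"
    by (metis exp_gt_zero norm_zero not_less zero_less_divide_iff zero_less_numeral)
  have c0: "c \<noteq> 0" by (simp add: c_def)
  have nc: "norm c = sqrt 2" by (simp add: c_def norm_mult)
  have csc: "sn / cs = \<i> * mordell_main (exp (of_real pi * \<i> * \<eta>))"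
    unfolding sn_def cs_def by (rule sin_over_cos_double)
  have "(- 1) powi m / (2 * \<i>) * G_bar p = sg / (2 * \<i>) * ((E - c * (sg * sn)) / (- cs))"
    using Ip e21 by (subst G_bar_eq) (auto simp: E_def c_def c1 c2 sg_def)
  also have "\<dots> = c / (2 * \<i>) * (sn / cs) * (1 + \<epsilon>)"
  proof -
    have "c * sn * (1 + \<epsilon>) = c * sn - sg * E" unfolding \<epsilon>_def using c0 sn0
      by (simp add: field_simps)
    also have "\<dots> = - (sg * (E - c * (sg * sn)))" using sg2 by (simp add: algebra_simps)
    finally have *: "c * sn * (1 + \<epsilon>) = - (sg * (E - c * (sg * sn)))" .
    have "c / (2 * \<i>) * (sn / cs) * (1 + \<epsilon>) = (c * sn * (1 + \<epsilon>)) / (2 * \<i>) / cs" by simp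
    also have "\<dots> = sg / (2 * \<i>) * ((E - c * (sg * sn)) / (- cs))" unfolding * by simp
    finally show ?thesis by simp
  qed
  also have "c / (2 * \<i>) * (sn / cs)
      = of_real (1 / sqrt 2) * cis (- pi / 8) * mordell_main (exp (of_real pi * \<i> * \<eta>))"
  proof -
    have "of_real (sqrt 2) / 2 = complex_of_real (1 / sqrt 2)"
    proof -
      have "sqrt 2 / 2 = 1 / sqrt 2" by (simp add: field_simps)
      hence "complex_of_real (sqrt 2 / 2) = complex_of_real (1 / sqrt 2)" by (simp only:)
      thus ?thesis by simp
    qed
    moreover have "exp (- (of_real pi * \<i> / 8)) = cis (- pi / 8)"
      by (simp add: cis_conv_exp mult.commute)
    moreover have "c / (2 * \<i>) * (\<i> * x) = of_real (sqrt 2) / 2 * exp (- (of_real pi * \<i> / 8)) * x"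
      for x
      using complex_i_mult_minus[of "c * x / 2"] by (simp add: c_def mult_ac)
    ultimately show ?thesis unfolding csc by (simp only:)
  qed
  finally have eq: "(- 1) powi m / (2 * \<i>) * G_bar p =
       of_real (1 / sqrt 2) * cis (- pi / 8) * mordell_main (exp (of_real pi * \<i> * \<eta>)) * (1 + \<epsilon>)" .
  have "norm E = exp (pi * (Re p * Im p))"
    unfolding E_def by (simp add: power2_eq_square)
  also have "\<dots> \<le> exp (pi * (2 * Im \<eta> - 4 * B))"
  proof -
    have "Re \<eta> + Im \<eta> < of_int m + 1" unfolding m by linarith
    hence "Re p \<le> 1 - 2 * Im \<eta>" unfolding Rp by simp
    hence "Re p * Im p \<le> (1 - 2 * Im \<eta>) * (2 * Im \<eta>)" unfolding Ip using e21
      by (intro mult_right_mono) auto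
    also have "\<dots> = 2 * Im \<eta> - 4 * B" by (simp add: B_def power2_eq_square algebra_simps)
    finally show ?thesis by simp
  qed
  finally have nE: "norm E \<le> exp (pi * (2 * Im \<eta> - 4 * B))" .
  have "norm \<epsilon> = norm E / (sqrt 2 * norm sn)" by (simp add: \<epsilon>_def norm_mult norm_divide nsg nc)
  also have "\<dots> \<le> exp (pi * (2 * Im \<eta> - 4 * B)) / (1 * (exp (pi * Im \<eta>) / 4))"
    using nE nsn by (intro frac_le mult_mono) auto
  also have "\<dots> = 4 * exp (pi * (Im \<eta> - 4 * B))"
    by (simp add: exp_diff[symmetric] field_simps flip: exp_add)
  also have "pi * (Im \<eta> - 4 * B) \<le> 3 * (- 3 * B)"
  proof -
    have IB: "Im \<eta> \<le> B" using e21 by (simp add: B_def power2_eq_square)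
    have "pi * (Im \<eta> - 4 * B) \<le> pi * (- 3 * B)" using IB by (intro mult_left_mono) auto
    also have "\<dots> = - (pi * (3 * B))" by simp
    also have "\<dots> \<le> - (3 * (3 * B))" using e2 pi_gt3 unfolding B_def[symmetric]
      by (intro le_imp_neg_le mult_right_mono) auto
    finally show ?thesis by simp
  qed
  also have "4 * exp (3 * (- 3 * B)) \<le> exp 2 * exp (3 * (- 3 * B))"
  proof -
    have "4 \<le> exp (2::real)" using exp_lower_Taylor_quadratic[of "2::real"] by simp
    thus ?thesis by (intro mult_right_mono) auto
  qed
  also have "\<dots> \<le> exp (- (B + 3) / 4)" using e2 unfolding exp_add[symmetric] B_def[symmetric] by simp
  also have "\<dots> \<le> 1 / norm \<eta>"
  proof -
    have "norm \<eta> \<le> exp ((B + 3) / 4)" unfolding B_def by (rule norm_le_exp_quarter[OF n4])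
    hence "1 / exp ((B + 3) / 4) \<le> 1 / norm \<eta>" using n0 by (intro divide_left_mono) auto
    moreover have "exp (- (B + 3) / 4) = 1 / exp ((B + 3) / 4)"
      by (metis exp_minus inverse_eq_divide minus_divide_left)
    ultimately show ?thesis by (simp only:)
  qed
  finally have "norm \<epsilon> \<le> 1 / norm \<eta>" by simp
  from that[OF this eq] show ?thesis .
qed

subsection \<open>Gaussian integrals and the sine kernel\<close>

lemma integrable_std_normal_iexp:
  "integrable lborel (\<lambda>x. std_normal_density x *\<^sub>R iexp (t * x))"
proof -
  have n: "integrable lborel std_normal_density"
    by (rule integrable_normal_density[OF zero_less_one])
  show ?thesis
  proof (rule Bochner_Integration.integrable_bound[OF n])
    have "(\<lambda>x. iexp (t * x)) \<in> borel_measurable borel"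
      by (intro borel_measurable_continuous_onI continuous_on_exp continuous_on_mult
            continuous_on_const continuous_on_of_real continuous_on_id)
    thus "(\<lambda>x. std_normal_density x *\<^sub>R iexp (t * x)) \<in> borel_measurable lborel"
      using borel_measurable_integrable[OF n]
      by (intro borel_measurable_scaleR) simp_all
    show "AE x in lborel. norm (std_normal_density x *\<^sub>R iexp (t * x))
        \<le> norm (std_normal_density x)"
      by (rule AE_I2) (simp only: norm_scaleR norm_exp_i_times mult_1_right real_norm_def
        order_refl)
  qed
qed

text \<open>The characteristic function of the standard normal law after the substitution x = t + c
  y: the scale c produces exp (-2 pi y^2), the shift t absorbs Re b, and the frequency \<tau>
  carries Im b.\<close>

lemma gaussian_integral_complex:
  fixes b :: complex
  shows "has_bochner_integral lborel (\<lambda>y. exp (of_real (- 2 * pi * y\<^sup>2) + b * of_real y))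
     (of_real (1 / sqrt 2) * exp (b\<^sup>2 / (8 * of_real pi)))"
proof -
  define c where "c = 2 * sqrt pi"
  define t where "t = - Re b / c"
  define \<tau> where "\<tau> = Im b / c"
  define F where "F = (\<lambda>x. std_normal_density x *\<^sub>R iexp (\<tau> * x))"
  have c0: "c \<noteq> 0" "c > 0" by (simp_all add: c_def)
  have cc: "c * c = 4 * pi" by (simp add: c_def)
  have int: "integrable lborel F"
    unfolding F_def by (rule integrable_std_normal_iexp)
  have "(CLINT x|std_normal_distribution. iexp (\<tau> * x)) = (CLINT x|lborel. F x)"
    unfolding F_def by (subst integral_density) (auto intro!: AE_I2)
  hence val: "(CLINT x|lborel. F x) = of_real (exp (- (\<tau>\<^sup>2) / 2))"
    using char_std_normal_distribution unfolding char_def by (metis (no_types, lifting))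
  have hb: "has_bochner_integral lborel F (of_real (exp (- (\<tau>\<^sup>2) / 2)))"
    using int val by (simp add: has_bochner_integral_iff)
  have "has_bochner_integral lborel (\<lambda>y. F (t + c * y)) (of_real (exp (- (\<tau>\<^sup>2) / 2)) /\<^sub>R \<bar>c\<bar>)"
    by (rule lborel_has_bochner_integral_real_affine_iff[THEN iffD1, OF c0(1) hb])
  moreover have "F (t + c * y) = (exp (of_real (- 2 * pi * y\<^sup>2) + b * of_real y)) *
      (of_real (1 / sqrt (2 * pi)) * exp (of_real (- (t\<^sup>2) / 2) + \<i> * of_real (\<tau> * t)))" for y
  proof -
    have ct: "c * t = - Re b" using c0 by (simp add: t_def)
    have tc: "\<tau> * c = Im b" using c0 by (simp add: \<tau>_def)
    have "(t + c * y)\<^sup>2 = t\<^sup>2 + 2 * (c * t) * y + (c * c) * y\<^sup>2"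
      by (simp add: power2_eq_square algebra_simps)
    hence sq: "- (t + c * y)\<^sup>2 / 2 = - (t\<^sup>2) / 2 + Re b * y - 2 * pi * y\<^sup>2"
      unfolding ct cc by simp
    have tt: "\<tau> * (t + c * y) = \<tau> * t + Im b * y"
      unfolding distrib_left mult.assoc[symmetric] tc by simp
    have "F (t + c * y) = of_real (1 / sqrt (2 * pi)) *
       (of_real (exp (- (t + c * y)\<^sup>2 / 2)) * exp (\<i> * of_real (\<tau> * (t + c * y))))"
      unfolding F_def std_normal_density_def by (simp add: scaleR_conv_of_real)
    also have "of_real (exp (- (t + c * y)\<^sup>2 / 2)) * exp (\<i> * of_real (\<tau> * (t + c * y))) =
       exp (of_real (- (t\<^sup>2) / 2 + Re b * y - 2 * pi * y\<^sup>2) + \<i> * of_real (\<tau> * t + Im b * y))"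
      unfolding sq tt exp_add exp_of_real ..
    also have "of_real (- (t\<^sup>2) / 2 + Re b * y - 2 * pi * y\<^sup>2) + \<i> * of_real (\<tau> * t + Im b * y) =
       (of_real (- 2 * pi * y\<^sup>2) + b * of_real y) + (of_real (- (t\<^sup>2) / 2) + \<i> * of_real (\<tau> * t))"
      by (simp add: complex_eq_iff)
    finally show ?thesis unfolding exp_add by (simp only: mult_ac)
  qed
  ultimately have hb2: "has_bochner_integral lborel (\<lambda>y. exp (of_real (- 2 * pi * y\<^sup>2)
      + b * of_real y) *
      (of_real (1 / sqrt (2 * pi)) * exp (of_real (- (t\<^sup>2) / 2) + \<i> * of_real (\<tau> * t))))
      (of_real (exp (- (\<tau>\<^sup>2) / 2)) /\<^sub>R \<bar>c\<bar>)" by simp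
  define d where "d = of_real (1 / sqrt (2 * pi)) * exp (of_real (- (t\<^sup>2) / 2)
      + \<i> * of_real (\<tau> * t))"
  have d0: "d \<noteq> 0" by (simp add: d_def)
  have "has_bochner_integral lborel (\<lambda>y. exp (of_real (- 2 * pi * y\<^sup>2)
      + b * of_real y) * d * (1 / d))
      ((of_real (exp (- (\<tau>\<^sup>2) / 2)) /\<^sub>R \<bar>c\<bar>) * (1 / d))"
    using hb2 unfolding d_def[symmetric] by (rule has_bochner_integral_mult_left[rotated])
  moreover have "(of_real (exp (- (\<tau>\<^sup>2) / 2)) /\<^sub>R \<bar>c\<bar>) * (1 / d)
      = of_real (1 / sqrt 2) * exp (b\<^sup>2 / (8 * of_real pi))"
  proof -
    have "1 / d = of_real (sqrt (2 * pi)) * exp (- (of_real (- (t\<^sup>2) / 2) + \<i> * of_real (\<tau> * t)))"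
      unfolding d_def exp_minus by (simp add: field_simps)
    moreover have "(x /\<^sub>R \<bar>c\<bar>) * (of_real r * y) = of_real (r / c) * (x * y)" for x y :: complex
      and r
      using c0 by (simp add: scaleR_conv_of_real divide_inverse mult_ac)
    ultimately have "(of_real (exp (- (\<tau>\<^sup>2) / 2)) /\<^sub>R \<bar>c\<bar>) * (1 / d) = of_real (sqrt (2 * pi) / c) *
       (exp (of_real (- (\<tau>\<^sup>2) / 2)) * exp (- (of_real (- (t\<^sup>2) / 2) + \<i> * of_real (\<tau> * t))))"
      unfolding exp_of_real by (simp only:)
    also have "sqrt (2 * pi) / c = 1 / sqrt 2"
      unfolding c_def real_sqrt_mult by (simp add: field_simps)
    also have "exp (of_real (- (\<tau>\<^sup>2) / 2)) * exp (- (of_real (- (t\<^sup>2) / 2) + \<i> * of_real (\<tau> * t))) =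
        exp (b\<^sup>2 / (8 * of_real pi))"
    proof -
      have c2: "c\<^sup>2 = 4 * pi" by (simp add: power2_eq_square cc)
      have "of_real (- (\<tau>\<^sup>2) / 2) + (- (of_real (- (t\<^sup>2) / 2) + \<i> * of_real (\<tau> * t))) =
        (of_real ((Re b)\<^sup>2 / (8 * pi) - (Im b)\<^sup>2 / (8 * pi)) + \<i> * of_real (2 * Re b * Im b / (8 *
          pi)))"
        unfolding t_def \<tau>_def by (simp add: complex_eq_iff power_divide c2 cc)
      also have "\<dots> = b\<^sup>2 / of_real (8 * pi)"
        by (simp add: complex_eq_iff Re_divide_of_real Im_divide_of_real power2_eq_square
          diff_divide_distrib del: of_real_mult)
      finally show ?thesis unfolding exp_add[symmetric] by simp
    qed
    finally show ?thesis .
  qed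
  ultimately show ?thesis using d0 by simp
qed

lemma set_integral_dominated:
  fixes f :: "real \<Rightarrow> complex"
  assumes "continuous_on A f" "A \<in> sets borel" "integrable lborel g" "\<And>y. y \<in> A \<Longrightarrow> norm (f y) \<le> g y"
    and "\<And>y. g y \<ge> 0"
  shows "set_integrable lborel A f" "norm (LINT y:A|lborel. f y) \<le> (LINT y|lborel. g y)"
proof -
  have m: "(\<lambda>y. indicator A y *\<^sub>R f y) \<in> borel_measurable borel"
    by (rule borel_measurable_continuous_on_indicator[OF assms(2,1)])
  have le: "norm (indicator A y *\<^sub>R f y) \<le> g y" for y
    using assms(4)[of y] assms(5)[of y] by (auto simp: indicator_def)
  show si: "set_integrable lborel A f" unfolding set_integrable_def
    by (rule Bochner_Integration.integrable_bound[OF assms(3)]) (use m le in \<open>auto intro!: AE_I2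
      order.trans[OF le[unfolded norm_scaleR]] simp: abs_of_nonneg assms(5)\<close>)
  show "norm (LINT y:A|lborel. f y) \<le> (LINT y|lborel. g y)"
    unfolding set_lebesgue_integral_def
    by (rule Bochner_Integration.integral_norm_bound_integral) (use si le assms(3) in \<open>auto simp:
      set_integrable_def\<close>)
qed

lemma gaussian_integral_real:
  "has_bochner_integral lborel (\<lambda>y. exp (- 2 * pi * y\<^sup>2
      + b * y)) (1 / sqrt 2 * exp (b\<^sup>2 / (8 * pi)))"
proof -
  have "has_bochner_integral lborel (\<lambda>y. complex_of_real (exp (- 2 * pi * y\<^sup>2 + b * y)))
    (complex_of_real (1 / sqrt 2 * exp (b\<^sup>2 / (8 * pi))))"
    using gaussian_integral_complex[of "of_real b"] unfolding exp_of_real[symmetric]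
    by (simp add: exp_of_real[symmetric] del: exp_of_real)
  from has_bochner_integral_bounded_linear[OF bounded_linear_Re this] show ?thesis by simp
qed

text \<open>The phases of the completed Gaussian integrals, from (2 k + 1)^2 pi / 8 = pi / 8 + pi k
  (k + 1) / 2. They run through 1, -1, -1, 1 with period 4.\<close>

definition mordell_sign :: "nat \<Rightarrow> complex" where
  "mordell_sign k = cis (- (pi * real k * (real k + 1) / 2))"

lemma mordell_sign_add_2: "mordell_sign (k + 2) = - mordell_sign k"
proof -
  have e: "- (pi * real (k + 2) * (real (k + 2) + 1) / 2) =
     - (pi * real k * (real k + 1) / 2) - (2 * pi * real (k + 1) + pi)"
    by (simp add: field_simps)
  have "cis (2 * pi * real (k + 1) + pi) = - 1"
    using cis_multiple_2pi[of "real (k + 1)"] by (simp add: cis_mult[symmetric] mult.commute)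
  thus ?thesis unfolding mordell_sign_def e cis_divide[symmetric] by simp
qed

text \<open>The signs are reversed after two steps, so the sum consists of two geometric
  progressions of ratio -z^4; the subtracted term is their common tail.\<close>

lemma sum_mordell_sign:
  assumes "1 + z ^ 4 \<noteq> 0"
  shows "(\<Sum>k<M. mordell_sign k * z ^ (2 * k + 1)) =
    mordell_main z - z ^ (2 * M + 1) * (mordell_sign M + mordell_sign (M + 1) * z\<^sup>2) / (1 + z ^ 4)"
proof (induction M)
  case 0
  have "cis (- (pi * 2 / 2)) = -1" by (simp add: cis_mult[symmetric] complex_eq_iff)
  hence "mordell_sign 0 = 1" "mordell_sign 1 = - 1" by (simp_all add: mordell_sign_def)
  thus ?case by (simp add: mordell_main_def)
next
  case (Suc M)
  have "z ^ (2 * M + 1) * (mordell_sign M + mordell_sign (M + 1) * z\<^sup>2)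
      - mordell_sign M * z ^ (2 * M + 1) * (1 + z ^ 4) =
      z ^ (2 * Suc M + 1) * (mordell_sign (Suc M) + mordell_sign (Suc M + 1) * z\<^sup>2)"
    using mordell_sign_add_2[of M]
      by (simp add: power_add algebra_simps power2_eq_square power4_eq_xxxx)
  hence "mordell_sign M * z ^ (2 * M + 1) =
     (z ^ (2 * M + 1) * (mordell_sign M + mordell_sign (M + 1) * z\<^sup>2) -
      z ^ (2 * Suc M + 1) * (mordell_sign (Suc M) + mordell_sign (Suc M + 1) * z\<^sup>2)) / (1 + z ^ 4)"
    using assms by (simp add: eq_divide_eq algebra_simps)
  thus ?case using Suc by (simp add: diff_divide_distrib)
qed

text \<open>Equal to i / (2 sin (pi x)). This is the negative of the kernel in
  \<open>aux_R_integrand\<close>, so that it expands in the upper half-plane as z + z^3 + ... with z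
  = exp (pi i x).\<close>

definition sine_kernel :: "complex \<Rightarrow> complex" where
  "sine_kernel x = 1 / (exp (- (of_real pi * \<i> * x)) - exp (of_real pi * \<i> * x))"

lemma norm_exp_pi_ii: "norm (exp (of_real pi * \<i> * x)) = exp (- (pi * Im x))"
  by simp

lemma sine_kernel_bound:
  assumes "Im x \<ge> 1 / 4"
  shows "norm (sine_kernel x) \<le> 2 * exp (- (pi * Im x))"
    "exp (- (of_real pi * \<i> * x)) - exp (of_real pi * \<i> * x) \<noteq> 0"
proof -
  define r where "r = exp (pi * Im x)"
  have r0: "r > 0" by (simp add: r_def)
  have "2 \<le> exp (2 * (pi * Im x))"
  proof -
    have "2 * (pi * Im x) \<ge> 2 * (3 * (1 / 4))" using assms pi_gt3
      by (intro mult_left_mono mult_mono) auto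
    hence "2 \<le> 1 + 2 * (pi * Im x)" by linarith
    thus ?thesis using exp_ge_add_one_self[of "2 * (pi * Im x)"] by linarith
  qed
  hence "2 \<le> r * r" by (simp add: r_def flip: exp_add)
  hence "1 / r \<le> r / 2" using r0 by (simp add: field_simps)
  moreover have "norm (exp (- (of_real pi * \<i> * x))) - norm (exp (of_real pi * \<i> * x)) \<le>
      norm (exp (- (of_real pi * \<i> * x)) - exp (of_real pi * \<i> * x))"
    by (rule norm_triangle_ineq2)
  moreover have "norm (exp (- (of_real pi * \<i> * x))) = r" "norm (exp (of_real pi * \<i> * x)) = 1 / r"
    unfolding norm_exp_eq_Re r_def by (simp_all add: exp_minus divide_inverse)
  ultimately have ge: "r / 2 \<le> norm (exp (- (of_real pi * \<i> * x)) - exp (of_real pi * \<i> * x))"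
    by linarith
  have "d \<noteq> 0" if "r / 2 \<le> norm d" for d :: complex using that r0 by auto
  from this[OF ge] show nz: "exp (- (of_real pi * \<i> * x)) - exp (of_real pi * \<i> * x) \<noteq> 0" .
  have "norm (sine_kernel x) \<le> 1 / (r / 2)"
    unfolding sine_kernel_def norm_divide norm_one
    by (rule frac_le[OF zero_le_one order_refl half_gt_zero[OF r0] ge])
  also have "1 / (r / 2) = 2 * inverse r" using r0 by (simp add: field_simps)
  also have "inverse r = exp (- (pi * Im x))" unfolding r_def exp_minus ..
  finally show "norm (sine_kernel x) \<le> 2 * exp (- (pi * Im x))" .
qed

text \<open>Iteration of 1 / (1/z - z) = z + z^2 / (1/z - z). The sum stays finite because the
  Gaussian integrals of high powers are no longer concentrated on the ray.\<close>

lemma sine_kernel_geometric: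
  assumes "Im x \<ge> 1 / 4"
  shows "sine_kernel x = (\<Sum>k<M. exp (of_real pi * \<i> * x) ^ (2 * k + 1)) +
     exp (of_real pi * \<i> * x) ^ (2 * M) * sine_kernel x"
proof -
  define z where "z = exp (of_real pi * \<i> * x)"
  have z0: "z \<noteq> 0" by (simp add: z_def)
  have k: "sine_kernel x = 1 / (1 / z - z)"
    by (simp add: sine_kernel_def z_def exp_minus divide_inverse)
  have nz: "1 / z - z \<noteq> 0" using sine_kernel_bound(2)[OF assms]
    by (simp add: z_def exp_minus divide_inverse)
  have kz: "sine_kernel x = z + z\<^sup>2 * sine_kernel x"
    unfolding k using nz z0 by (simp add: divide_simps power2_eq_square) (simp add: algebra_simps)
  show ?thesis unfolding z_def[symmetric]
  proof (induction M)
    case (Suc M)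
    have "z ^ (2 * M) * sine_kernel x = z ^ (2 * M) * (z + z\<^sup>2 * sine_kernel x)" using kz by simp
    also have "\<dots> = z ^ (2 * M + 1) + z ^ (2 * Suc M) * sine_kernel x"
      by (simp add: algebra_simps power_add power2_eq_square)
    finally show ?case using Suc by (simp add: add.assoc)
  qed auto
qed

subsection \<open>The kernel against a Gaussian\<close>

lemma cis_pi_4_squared: "cis (pi / 4) * cis (pi / 4) = \<i>"
  by (simp add: cis_mult cis_pi_half)

definition saddle_line :: "complex \<Rightarrow> real \<Rightarrow> complex" where
  "saddle_line \<eta> y = \<eta> + of_real y * cis (pi / 4)"

lemma Re_Im_saddle_line:
  "Re (saddle_line \<eta> y) = Re \<eta> + y * (sqrt 2 / 2)" "Im (saddle_line \<eta> y) = Im \<eta> + y * (sqrt 2 / 2)"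
  unfolding saddle_line_def by (simp_all add: cos_45 sin_45)

lemma continuous_on_saddle_line: "continuous_on A (saddle_line \<eta>)"
  unfolding saddle_line_def by (intro continuous_intros)

text \<open>A power of z = exp (pi i x) on the saddle line against exp (-2 pi y^2), the leading part
  of F near the saddle point.\<close>

definition gaussian_mode :: "complex \<Rightarrow> nat \<Rightarrow> real \<Rightarrow> complex" where
  "gaussian_mode \<eta> n y = of_real (exp (- 2 * pi * y\<^sup>2))
      * exp (of_real pi * \<i> * saddle_line \<eta> y) ^ n"

lemma continuous_on_gaussian_mode: "continuous_on A (gaussian_mode \<eta> n)"
  unfolding gaussian_mode_def
  by (intro continuous_intros continuous_on_saddle_line)

lemma norm_gaussian_mode:
  "norm (gaussian_mode \<eta> n y) = exp (- 2 * pi * y\<^sup>2 - real n * pi * (Im \<eta> + y * (sqrt 2 / 2)))"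
proof -
  have "norm (gaussian_mode \<eta> n y) =
     exp (- 2 * pi * y\<^sup>2) * exp (- (pi * Im (saddle_line \<eta> y))) ^ n"
    unfolding gaussian_mode_def norm_mult norm_power norm_exp_pi_ii by simp
  also have "exp (- (pi * Im (saddle_line \<eta> y))) ^ n
      = exp (real n * (- (pi * Im (saddle_line \<eta> y))))"
    by (rule exp_of_nat_mult[symmetric])
  finally show ?thesis unfolding Re_Im_saddle_line exp_add[symmetric] by (simp add: algebra_simps)
qed

text \<open>Completing the square. In the direction cis (pi / 4) the linear coefficient satisfies
  b^2 = -i (n pi)^2 with n = 2 k + 1, so the square contributes only a phase.\<close>

lemma has_bochner_integral_gaussian_mode:
  "has_bochner_integral lborel (gaussian_mode \<eta> (2 * k + 1))
     (of_real (1 / sqrt 2) * cis (- pi / 8) * (mordell_sign k * exp (of_real pi * \<i> * \<eta>) ^ (2 * k +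
       1)))"
proof -
  define n where "n = 2 * k + 1"
  define b where "b = of_real (real n * pi) * \<i> * cis (pi / 4)"
  have eq: "gaussian_mode \<eta> n y
      = exp (of_real (- 2 * pi * y\<^sup>2) + b * of_real y) * exp (of_real pi * \<i> * \<eta>) ^ n" for y
  proof -
    have "exp (of_real pi * \<i> * saddle_line \<eta> y) ^ n
        = exp (of_nat n * (of_real pi * \<i> * saddle_line \<eta> y))"
      by (rule exp_of_nat_mult[symmetric])
    also have "of_nat n * (of_real pi * \<i> * saddle_line \<eta> y)
        = b * of_real y + of_nat n * (of_real pi * \<i> * \<eta>)"
      unfolding saddle_line_def b_def by (simp add: algebra_simps)
    also have "exp (b * of_real y + of_nat n * (of_real pi * \<i> * \<eta>))
        = exp (b * of_real y) * exp (of_real pi * \<i> * \<eta>) ^ n"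
      unfolding exp_add exp_of_nat_mult ..
    finally show ?thesis unfolding gaussian_mode_def exp_add exp_of_real by (simp only: mult.assoc)
  qed
  have b2: "b\<^sup>2 / (8 * of_real pi) = \<i> * of_real (- pi / 8 + - (pi * real k * (real k + 1) / 2))"
  proof -
    have "b\<^sup>2 = (of_real (real n * pi))\<^sup>2 * (\<i> * \<i>) * (cis (pi / 4) * cis (pi / 4))"
      unfolding b_def power2_eq_square by (simp only: mult_ac)
    also have "\<dots> = - ((of_real (real n * pi))\<^sup>2 * \<i>)" unfolding cis_pi_4_squared by simp
    finally have "b\<^sup>2 / (8 * of_real pi) = \<i> * of_real (- (real n)\<^sup>2 * pi / 8)"
      by (simp add: power2_eq_square field_simps)
    also have "- (real n)\<^sup>2 * pi / 8 = - pi / 8 + - (pi * real k * (real k + 1) / 2)"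
      unfolding n_def by (simp add: power2_eq_square field_simps)
    finally show ?thesis .
  qed
  have "exp (b\<^sup>2 / (8 * of_real pi)) = cis (- pi / 8) * mordell_sign k"
    unfolding b2 mordell_sign_def cis_mult by (simp only: cis_conv_exp)
  hence "has_bochner_integral lborel (\<lambda>y. exp (of_real (- 2 * pi * y\<^sup>2)
      + b * of_real y) * exp (of_real pi * \<i> * \<eta>) ^ n)
     (of_real (1 / sqrt 2) * (cis (- pi / 8) * mordell_sign k) * exp (of_real pi * \<i> * \<eta>) ^ n)"
    using gaussian_integral_complex[of b] by (intro has_bochner_integral_mult_left) simp_all
  hence "has_bochner_integral lborel (gaussian_mode \<eta> n)
     (of_real (1 / sqrt 2) * (cis (- pi / 8) * mordell_sign k) * exp (of_real pi * \<i> * \<eta>) ^ n)"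
    unfolding eq[symmetric] .
  thus ?thesis unfolding n_def by (simp only: mult.assoc)
qed

text \<open>The modulus of the mode is a Gaussian centred at y = -n sqrt 2 / 8. For n <= 4 Im \<eta>
  this centre is not to the left of -y0, so the tail lies beyond the peak.\<close>

lemma gaussian_mode_tail:
  assumes "Im \<eta> > 0" "real n \<le> 4 * Im \<eta>"
  defines "y0 \<equiv> Im \<eta> * (sqrt 2 / 2)"
  shows "norm (LINT y:{..<- y0}|lborel. gaussian_mode \<eta> n y) \<le>
     exp (- pi * (Im \<eta>)\<^sup>2 - real n * pi * Im \<eta> / 2)"
proof -
  \<comment> \<open>The comparison function is a Gaussian centred at the cut point -y0 that agrees
    there with the modulus of the mode.\<close>
  define c0 where "c0 = - pi * (Im \<eta>)\<^sup>2 - real n * pi * Im \<eta> / 2 - 2 * pi * y0\<^sup>2"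
  define b where "b = - 4 * pi * y0"
  have s2: "sqrt 2 * sqrt 2 = 2" by simp
  have y02: "y0\<^sup>2 = (Im \<eta>)\<^sup>2 / 2" unfolding y0_def by (simp add: power_mult_distrib power_divide)
  have hb: "has_bochner_integral lborel (\<lambda>y. exp c0 * exp (- 2 * pi * y\<^sup>2 + b * y))
     (exp c0 * (1 / sqrt 2 * exp (b\<^sup>2 / (8 * pi))))"
    by (intro has_bochner_integral_mult_right gaussian_integral_real)
  have le: "norm (gaussian_mode \<eta> n y) \<le> exp c0 * exp (- 2 * pi * y\<^sup>2 + b * y)" if "y \<in> {..<- y0}"
    for y
  proof -
    define r where "r = - y - y0"
    have r: "r > 0" and y: "y = - r - y0" using that by (auto simp: r_def)
    have "real n * (sqrt 2 / 2) \<le> 4 * Im \<eta> * (sqrt 2 / 2)"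
      using assms by (intro mult_right_mono) auto
    hence "real n * (sqrt 2 / 2) \<le> 4 * y0" by (simp add: y0_def)
    hence "r * (pi * (real n * (sqrt 2 / 2))) \<le> r * (pi * (4 * y0))"
      using r by (intro mult_left_mono) auto
    moreover have "y0 * (sqrt 2 / 2) = Im \<eta> / 2" unfolding y0_def by simp
    hence "real n * pi * (Im \<eta> + y * (sqrt 2 / 2))
        = real n * pi * Im \<eta> / 2 - r * (pi * (real n * (sqrt 2 / 2)))"
      unfolding y by (simp add: algebra_simps) (simp add: field_simps)
    moreover have "- 2 * pi * y\<^sup>2 = - 2 * pi * r\<^sup>2 - r * (pi * (4 * y0)) - 2 * pi * y0\<^sup>2"
      unfolding y by (simp add: power2_eq_square algebra_simps)
    moreover have "- 2 * pi * y\<^sup>2 + b * y = - 2 * pi * r\<^sup>2 + 2 * pi * y0\<^sup>2"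
      unfolding y b_def by (simp add: power2_eq_square algebra_simps)
    moreover have "pi * (Im \<eta>)\<^sup>2 = 2 * pi * y0\<^sup>2" unfolding y02 by simp
    ultimately have "- 2 * pi * y\<^sup>2 - real n * pi * (Im \<eta> + y * (sqrt 2 / 2))
        \<le> c0 + (- 2 * pi * y\<^sup>2 + b * y)"
      unfolding c0_def by linarith
    thus ?thesis unfolding norm_gaussian_mode exp_add[symmetric] by (subst exp_le_cancel_iff)
  qed
  have "norm (LINT y:{..<- y0}|lborel. gaussian_mode \<eta> n y) \<le>
      (LINT y|lborel. exp c0 * exp (- 2 * pi * y\<^sup>2 + b * y))"
    by (rule set_integral_dominated(2)[OF continuous_on_gaussian_mode]) (use le hb in \<open>auto simp:
      has_bochner_integral_iff\<close>)
  also have "\<dots> = exp c0 * (1 / sqrt 2 * exp (b\<^sup>2 / (8 * pi)))"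
    using hb by (rule has_bochner_integral_integral_eq)
  also have "\<dots> = exp (c0 + b\<^sup>2 / (8 * pi)) * (1 / sqrt 2)" unfolding exp_add by (simp only: mult_ac)
  also have "c0 + b\<^sup>2 / (8 * pi) = - pi * (Im \<eta>)\<^sup>2 - real n * pi * Im \<eta> / 2"
    unfolding c0_def b_def by (simp add: power2_eq_square)
  also have "exp (- pi * (Im \<eta>)\<^sup>2 - real n * pi * Im \<eta> / 2) * (1 / sqrt 2) \<le>
      exp (- pi * (Im \<eta>)\<^sup>2 - real n * pi * Im \<eta> / 2) * 1"
    by (intro mult_left_mono) auto
  finally show ?thesis by simp
qed

lemma Im_saddle_line_half:
  assumes "y \<ge> - (Im \<eta> * (sqrt 2 / 2))"
  shows "Im (saddle_line \<eta> y) \<ge> Im \<eta> / 2"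
proof -
  have "y * (sqrt 2 / 2) \<ge> - (Im \<eta> * (sqrt 2 / 2)) * (sqrt 2 / 2)" using assms
    by (intro mult_right_mono) auto
  thus ?thesis unfolding Re_Im_saddle_line by simp
qed

text \<open>The kernel is bounded like one further power of z, so the integrand is at most a
  constant times the modulus of the mode of order n + 1; the integral of the latter over the whole
  line gives (n + 1)^2 pi / 16.\<close>

lemma gaussian_kernel_remainder:
  assumes "Im \<eta> \<ge> 1"
  defines "y0 \<equiv> Im \<eta> * (sqrt 2 / 2)"
  shows "set_integrable lborel {- y0..} (\<lambda>y. gaussian_mode \<eta> n y * sine_kernel (saddle_line \<eta> y))"
    and "norm (LINT y:{- y0..}|lborel. gaussian_mode \<eta> n y * sine_kernel (saddle_line \<eta> y)) \<le>
     2 * exp (- (real n + 1) * pi * Im \<eta> + (real n + 1)\<^sup>2 * pi / 16)"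
proof -
  define c0 where "c0 = - (real n + 1) * pi * Im \<eta>"
  define b where "b = - (real n + 1) * pi * (sqrt 2 / 2)"
  have hb: "has_bochner_integral lborel (\<lambda>y. 2 * exp c0 * exp (- 2 * pi * y\<^sup>2 + b * y))
     (2 * exp c0 * (1 / sqrt 2 * exp (b\<^sup>2 / (8 * pi))))"
    by (intro has_bochner_integral_mult_right gaussian_integral_real)
  have im: "Im (saddle_line \<eta> y) \<ge> 1 / 4" if "y \<in> {- y0..}" for y
    using Im_saddle_line_half[of \<eta> y] that assms(1) unfolding y0_def by simp
  have cont: "continuous_on {- y0..} (\<lambda>y. gaussian_mode \<eta> n y * sine_kernel (saddle_line \<eta> y))"
    unfolding sine_kernel_def
    using sine_kernel_bound(2)[OF im]
    by (intro continuous_intros continuous_on_gaussian_mode continuous_on_saddle_line) auto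
  have le: "norm (gaussian_mode \<eta> n y * sine_kernel (saddle_line \<eta> y))
      \<le> 2 * exp c0 * exp (- 2 * pi * y\<^sup>2 + b * y)"
    if y: "y \<in> {- y0..}" for y
  proof -
    have "norm (gaussian_mode \<eta> n y * sine_kernel (saddle_line \<eta> y)) \<le>
       exp (- 2 * pi * y\<^sup>2 - real n * pi * (Im \<eta> + y * (sqrt 2 / 2))) * (2 * exp (- (pi * (Im \<eta> + y
         * (sqrt 2 / 2)))))"
      unfolding norm_mult norm_gaussian_mode
      using sine_kernel_bound(1)[OF im[OF y]] unfolding Re_Im_saddle_line
        by (intro mult_left_mono) auto
    also have "\<dots> = 2 * exp ((- 2 * pi * y\<^sup>2 - real n * pi * (Im \<eta> + y * (sqrt 2 / 2)))
        + (- (pi * (Im \<eta> + y * (sqrt 2 / 2)))))"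
      unfolding exp_add by (simp only: mult_ac)
    also have "(- 2 * pi * y\<^sup>2 - real n * pi * (Im \<eta> + y * (sqrt 2 / 2)))
        + (- (pi * (Im \<eta> + y * (sqrt 2 / 2)))) =
       c0 + (- 2 * pi * y\<^sup>2 + b * y)"
      unfolding c0_def b_def by (simp add: algebra_simps)
    finally show ?thesis unfolding exp_add by (simp only: mult_ac)
  qed
  note d = set_integral_dominated[OF cont _ has_bochner_integral_iff[THEN iffD1, OF hb, THEN
    conjunct1] le]
  show "set_integrable lborel {- y0..} (\<lambda>y. gaussian_mode \<eta> n y * sine_kernel (saddle_line \<eta> y))"
    by (rule d) auto
  have "norm (LINT y:{- y0..}|lborel. gaussian_mode \<eta> n y * sine_kernel (saddle_line \<eta> y)) \<le>
     (LINT y|lborel. 2 * exp c0 * exp (- 2 * pi * y\<^sup>2 + b * y))"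
    by (rule d) auto
  also have "\<dots> = 2 * exp c0 * (1 / sqrt 2 * exp (b\<^sup>2 / (8 * pi)))"
    using hb by (rule has_bochner_integral_integral_eq)
  also have "\<dots> = (2 * exp (c0 + b\<^sup>2 / (8 * pi))) * (1 / sqrt 2)" unfolding exp_add
    by (simp only: mult_ac)
  also have "\<dots> \<le> (2 * exp (c0 + b\<^sup>2 / (8 * pi))) * 1" by (intro mult_left_mono) auto
  also have "b\<^sup>2 = ((real n + 1) * pi)\<^sup>2 * (1 / 2)"
    unfolding b_def
      by (simp add: power_mult_distrib power_divide power2_eq_square) (simp add: algebra_simps)
  also have "((real n + 1) * pi)\<^sup>2 * (1 / 2) / (8 * pi) = (real n + 1)\<^sup>2 * pi / 16"
    by (simp add: power2_eq_square)
  finally show "norm (LINT y:{- y0..}|lborel. gaussian_mode \<eta> n y * sine_kernel (saddle_line \<eta> y)) \<le>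
     2 * exp (- (real n + 1) * pi * Im \<eta> + (real n + 1)\<^sup>2 * pi / 16)" by (simp add: c0_def)
qed

lemma norm_mordell_sign: "norm (mordell_sign k) = 1"
  by (simp add: mordell_sign_def)

lemma mordell_main_truncation:
  assumes "norm z \<le> 1 / 2"
  shows "norm ((\<Sum>k<M. mordell_sign k * z ^ (2 * k + 1)) - mordell_main z)
      \<le> 4 * norm z ^ (2 * M + 1)"
proof -
  have "norm z ^ 4 \<le> (1 / 2) ^ 4" using assms by (intro power_mono) auto
  also have "(1 / 2) ^ 4 \<le> (1 / 2 :: real)" by (simp add: power4_eq_xxxx)
  finally have n4: "norm (z ^ 4) \<le> 1 / 2" by (simp only: norm_power)
  have ge: "1 / 2 \<le> norm (1 + z ^ 4)" using norm_triangle_ineq2[of 1 "- (z ^ 4)"] n4 by simp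
  hence nz: "1 + z ^ 4 \<noteq> 0" by auto
  have "norm (mordell_sign M + mordell_sign (M + 1) * z\<^sup>2) \<le> 1 + 1 * 1"
  proof -
    have "norm z ^ 2 \<le> 1 ^ 2" using assms by (intro power_mono) auto
    thus ?thesis
      using norm_triangle_ineq[of "mordell_sign M" "mordell_sign (M + 1) * z\<^sup>2"]
      by (simp add: norm_mult norm_power norm_mordell_sign)
  qed
  hence "norm (z ^ (2 * M + 1) * (mordell_sign M + mordell_sign (M + 1) * z\<^sup>2) / (1 + z ^ 4)) \<le>
     norm z ^ (2 * M + 1) * 2 / (1 / 2)"
    unfolding norm_divide norm_mult norm_power using ge by (intro frac_le mult_left_mono) auto
  thus ?thesis unfolding sum_mordell_sign[OF nz] by simp
qed

text \<open>Trades the quadratic decay in x = Im \<eta> for exp (-pi x) / n with n = |\<eta>|. By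
  the third hypothesis the division by n costs only (x^2 + 3) / 4 in the exponent; exp 4 absorbs the
  lower terms.\<close>

lemma exp_quadratic_bounds:
  fixes x n :: real
  assumes "x \<ge> 1" "n > 0" "n \<le> exp ((x\<^sup>2 + 3) / 4)"
  shows "exp (- 2 * pi * x\<^sup>2 + pi * x / 2) \<le> exp 4 * exp (- pi * x) / n"
    "2 * x * exp (- pi * x\<^sup>2 - pi * x / 2) \<le> exp 4 * exp (- pi * x) / n"
proof -
  have inv: "exp (- ((x\<^sup>2 + 3) / 4)) \<le> 1 / n"
    using assms unfolding exp_minus inverse_eq_divide by (intro divide_left_mono) auto
  have px: "pi * x \<le> 4 * x" using pi_less_4 assms by (intro mult_right_mono) auto
  have px2: "pi * x\<^sup>2 \<ge> 3 * x\<^sup>2" using pi_gt3 by (intro mult_right_mono) auto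
  have q: "2 * x \<le> x\<^sup>2 + 1" using zero_le_power2[of "x - 1"]
    by (simp add: power2_eq_square algebra_simps)
  have step: "exp u \<le> exp 4 * exp (- pi * x) / n" if "u \<le> 4 - pi * x - (x\<^sup>2 + 3) / 4" for u
  proof -
    have "exp u \<le> exp (4 + (- pi * x) + (- ((x\<^sup>2 + 3) / 4)))" using that by simp
    also have "\<dots> = exp 4 * exp (- pi * x) * exp (- ((x\<^sup>2 + 3) / 4))" unfolding exp_add ..
    also have "\<dots> \<le> exp 4 * exp (- pi * x) * (1 / n)" using inv by (intro mult_left_mono) auto
    finally show ?thesis by simp
  qed
  define a b s where "a = pi * x" and "b = pi * x\<^sup>2" and "s = x\<^sup>2"
  have e1: "- 2 * pi * x\<^sup>2 + pi * x / 2 = - 2 * b + a / 2"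
    and e2: "2 * x + (- pi * x\<^sup>2 - pi * x / 2) = 2 * x - b - a / 2"
    by (simp_all add: a_def b_def)
  have f: "a \<le> 4 * x" "b \<ge> 3 * s" "2 * x \<le> s + 1" "s \<ge> 0" using px px2 q
    by (simp_all add: a_def b_def s_def)
  have g1: "- 2 * b + a / 2 \<le> 4 - a - (s + 3) / 4" using f by argo
  have g2: "2 * x - b - a / 2 \<le> 4 - a - (s + 3) / 4" using f by argo
  note g = g1[unfolded a_def b_def s_def] g2[unfolded a_def b_def s_def]
  show "exp (- 2 * pi * x\<^sup>2 + pi * x / 2) \<le> exp 4 * exp (- pi * x) / n"
    by (rule step, unfold e1 a_def b_def, rule g)
  have "2 * x * exp (- pi * x\<^sup>2 - pi * x / 2) \<le> exp (2 * x) * exp (- pi * x\<^sup>2 - pi * x / 2)"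
  proof (rule mult_right_mono)
    show "2 * x \<le> exp (2 * x)" using exp_ge_add_one_self[of "2 * x"] by linarith
  qed auto
  also have "\<dots> = exp (2 * x + (- pi * x\<^sup>2 - pi * x / 2))" unfolding exp_add ..
  also have "\<dots> \<le> exp 4 * exp (- pi * x) / n"
    by (rule step, unfold e2 a_def b_def, rule g)
  finally show "2 * x * exp (- pi * x\<^sup>2 - pi * x / 2) \<le> exp 4 * exp (- pi * x) / n" .
qed

lemma set_integral_sum:
  fixes f :: "'i \<Rightarrow> 'b \<Rightarrow> 'a :: {banach, second_countable_topology}"
  assumes "\<And>i. i \<in> I \<Longrightarrow> set_integrable M A (f i)"
  shows "set_integrable M A (\<lambda>x. \<Sum>i\<in>I. f i x)"
    and "(LINT x:A|M. (\<Sum>i\<in>I. f i x)) = (\<Sum>i\<in>I. LINT x:A|M. f i x)"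
  using assms unfolding set_integrable_def set_lebesgue_integral_def scaleR_sum_right
  by (auto intro!: Bochner_Integration.integrable_sum Bochner_Integration.integral_sum)

lemma set_integrable_gaussian_kernel:
  assumes "Im \<eta> \<ge> 1"
  shows "set_integrable lborel {- (Im \<eta> * (sqrt 2 / 2))..}
    (\<lambda>y. of_real (exp (- 2 * pi * y\<^sup>2)) * sine_kernel (saddle_line \<eta> y))"
  using gaussian_kernel_remainder(1)[OF assms, of 0] by (simp add: gaussian_mode_def)

text \<open>
  On the part of the line above height \<open>Im \<eta> / 2\<close> the kernel is a finite geometric sum of
  \<open>M \<approx> 2 Im \<eta>\<close> terms plus a remainder: for so few terms each of the Gaussian integrals can be
  completed to the whole line, and already so many terms make the remainder negligible.
\<close>

lemma gaussian_kernel_integral: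
  assumes "Im \<eta> \<ge> 1" "(norm \<eta>) ^ 4 \<le> exp ((Im \<eta>)\<^sup>2 + 3)"
  shows "norm ((LINT y:{- (Im \<eta> * (sqrt 2 / 2))..}|lborel.
       of_real (exp (- 2 * pi * y\<^sup>2)) * sine_kernel (saddle_line \<eta> y)) -
      of_real (1 / sqrt 2) * cis (- pi / 8) * mordell_main (exp (of_real pi * \<i> * \<eta>)))
    \<le> 7 * exp 4 * exp (- pi * Im \<eta>) / norm \<eta>"
proof -
  define x where "x = Im \<eta>"
  define D where "D = {- (Im \<eta> * (sqrt 2 / 2))..}"
  define M where "M = nat \<lfloor>2 * x\<rfloor>"
  define z where "z = exp (of_real pi * \<i> * \<eta>)"
  define c where "c = of_real (1 / sqrt 2) * cis (- pi / 8)"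
  define g where "g y = of_real (exp (- 2 * pi * y\<^sup>2)) * sine_kernel (saddle_line \<eta> y)" for y
  define r where "r y = gaussian_mode \<eta> (2 * M) y * sine_kernel (saddle_line \<eta> y)" for y
  define tail
    where "tail k = (LINT y:{..<- (Im \<eta> * (sqrt 2 / 2))}|lborel. gaussian_mode \<eta> (2 * k + 1) y)"
      for k
  define rem where "rem = (LINT y:D|lborel. r y)"
  have x: "x \<ge> 1" using assms by (simp add: x_def)
  have M: "real M \<le> 2 * x" "2 * x < real M + 1" using x unfolding M_def by linarith+
  have n0: "norm \<eta> > 0" using assms by (auto simp: complex_eq_iff)
  have nle: "norm \<eta> \<le> exp ((x\<^sup>2 + 3) / 4)" using norm_le_exp_quarter[OF assms(2)]
    by (simp add: x_def)
  have nz: "norm z = exp (- (pi * x))" by (simp add: z_def x_def)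
  have z2: "norm z \<le> 1 / 2"
  proof -
    have "pi * x \<ge> 3 * 1" using x pi_gt3 by (intro mult_mono) auto
    hence "exp (- (pi * x)) \<le> exp (- 1)" by simp
    also have "\<dots> \<le> 1 / 2" using exp_one_bounds(1) by (simp add: exp_minus field_simps)
    finally show ?thesis unfolding nz .
  qed
  have zP: "norm z ^ (2 * M + 1) = exp (- (real (2 * M + 1) * pi * x))"
    unfolding nz exp_of_nat_mult[symmetric] by (simp add: algebra_simps)
  have int_full: "integrable lborel (gaussian_mode \<eta> (2 * k + 1))" for k
    using has_bochner_integral_gaussian_mode by (rule integrable.intros)
  have set_int: "set_integrable lborel A (gaussian_mode \<eta> (2 * k + 1))" if "A \<in> sets borel" for A k
    unfolding set_integrable_def using integrable_mult_indicator[OF _ int_full] that by simp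
  have mode: "(LINT y:D|lborel. gaussian_mode \<eta> (2 * k + 1) y)
      = c * (mordell_sign k * z ^ (2 * k + 1)) - tail k" for k
  proof -
    have "(LINT y|lborel. gaussian_mode \<eta> (2 * k + 1) y) =
       (LINT y:(D \<union> {..<- (Im \<eta> * (sqrt 2 / 2))})|lborel. gaussian_mode \<eta> (2 * k + 1) y)"
    proof -
      have "D \<union> {..<- (Im \<eta> * (sqrt 2 / 2))} = UNIV" unfolding D_def by auto
      thus ?thesis by (simp add: set_lebesgue_integral_def)
    qed
    also have "\<dots> = (LINT y:D|lborel. gaussian_mode \<eta> (2 * k + 1) y) + tail k"
      unfolding tail_def by (rule set_integral_Un[OF _ set_int set_int]) (auto simp: D_def)
    finally have L: "(LINT y|lborel. gaussian_mode \<eta> (2 * k + 1) y) =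
        (LINT y:D|lborel. gaussian_mode \<eta> (2 * k + 1) y) + tail k" .
    have A: "(LINT y|lborel. gaussian_mode \<eta> (2 * k + 1) y)
        = c * (mordell_sign k * z ^ (2 * k + 1))"
      unfolding c_def z_def
        by (rule has_bochner_integral_integral_eq[OF has_bochner_integral_gaussian_mode])
    show ?thesis unfolding A[symmetric] L by (rule add_diff_cancel_right'[symmetric])
  qed
  have set_int': "set_integrable lborel D (\<lambda>y. \<Sum>k<M. gaussian_mode \<eta> (2 * k + 1) y)"
    by (rule set_integral_sum(1)[OF set_int]) (auto simp: D_def)
  have set_rem: "set_integrable lborel D r"
    unfolding D_def r_def by (rule gaussian_kernel_remainder(1)[OF assms(1)])
  have "(LINT y:D|lborel. g y) =
     (LINT y:D|lborel. (\<Sum>k<M. gaussian_mode \<eta> (2 * k + 1) y) + r y)"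
  proof (rule set_lebesgue_integral_cong)
    show "\<forall>y. y \<in> D \<longrightarrow> g y =
       (\<Sum>k<M. gaussian_mode \<eta> (2 * k + 1) y) + r y"
    proof (intro allI impI)
      fix y assume "y \<in> D"
      hence im: "Im (saddle_line \<eta> y) \<ge> 1 / 4"
        using Im_saddle_line_half[of \<eta> y] assms(1) unfolding D_def by simp
      show "g y = (\<Sum>k<M. gaussian_mode \<eta> (2 * k + 1) y) + r y"
        unfolding g_def r_def by (subst sine_kernel_geometric[OF im, of M])
          (simp only: gaussian_mode_def distrib_left sum_distrib_left mult.assoc)
    qed
  qed (simp add: D_def)
  also have "\<dots> = (LINT y:D|lborel. (\<Sum>k<M. gaussian_mode \<eta> (2 * k + 1) y)) + rem"
    unfolding rem_def by (rule set_integral_add(2)[OF set_int' set_rem])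
  also have "(LINT y:D|lborel. (\<Sum>k<M. gaussian_mode \<eta> (2 * k + 1) y))
      = (\<Sum>k<M. LINT y:D|lborel. gaussian_mode \<eta> (2 * k + 1) y)"
    by (rule set_integral_sum(2)[OF set_int]) (auto simp: D_def)
  also have "\<dots> = c * (\<Sum>k<M. mordell_sign k * z ^ (2 * k + 1)) - (\<Sum>k<M. tail k)"
    unfolding mode sum_subtractf sum_distrib_left ..
  finally have W: "(LINT y:D|lborel. g y) - c * mordell_main z =
     c * ((\<Sum>k<M. mordell_sign k * z ^ (2 * k + 1)) - mordell_main z) - (\<Sum>k<M. tail k) + rem"
    by (simp add: algebra_simps)
  have b1: "norm (c * ((\<Sum>k<M. mordell_sign k * z ^ (2 * k + 1)) - mordell_main z)) \<le>
      4 * exp (- 2 * pi * x\<^sup>2 + pi * x / 2)"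
  proof -
    have "norm c \<le> 1" unfolding c_def norm_mult by (simp add: norm_divide)
    hence "norm (c * ((\<Sum>k<M. mordell_sign k * z ^ (2 * k + 1)) - mordell_main z)) \<le>
       1 * (4 * norm z ^ (2 * M + 1))"
      unfolding norm_mult using mordell_main_truncation[OF z2] by (intro mult_mono) auto
    also have "\<dots> \<le> 4 * exp (- 2 * pi * x\<^sup>2 + pi * x / 2)"
    proof -
      define a where "a = pi * x"
      have "a * (4 * x - 1) \<le> a * real (2 * M + 1)"
        unfolding a_def using M x by (intro mult_left_mono) auto
      moreover have "a * 1 \<le> a * x" unfolding a_def using x by (intro mult_left_mono) auto
      moreover have "a \<ge> 0" using x by (simp add: a_def)
      moreover have "a * (4 * x - 1) = 4 * (a * x) - a" by (simp add: algebra_simps)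
      ultimately have i: "- (a * real (2 * M + 1)) \<le> - 2 * (a * x) + a / 2" by argo
      have "- (real (2 * M + 1) * pi * x) = - (a * real (2 * M + 1))"
        "- 2 * pi * x\<^sup>2 + pi * x / 2 = - 2 * (a * x) + a / 2"
        by (simp_all add: a_def power2_eq_square)
      thus ?thesis unfolding zP using i
        by (simp only: exp_le_cancel_iff mult_1 mult_le_cancel_left_pos zero_less_numeral)
    qed
    finally show ?thesis .
  qed
  have b2: "norm (\<Sum>k<M. tail k) \<le> 2 * x * exp (- pi * x\<^sup>2 - pi * x / 2)"
  proof -
    have "norm (tail k) \<le> exp (- pi * x\<^sup>2 - pi * x / 2)" if "k < M" for k
    proof -
      \<comment> \<open>The choice of \<open>M\<close> keeps the order 2 k + 1 below 4 Im \<eta>,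
        the range in which the tail lies beyond the peak.\<close>
      have "2 * real k + 2 \<le> 2 * real M" using that by (simp add: Suc_le_eq flip: of_nat_Suc)
      hence "real (2 * k + 1) \<le> 4 * Im \<eta>" using M unfolding x_def by simp
      hence "norm (tail k) \<le> exp (- pi * (Im \<eta>)\<^sup>2 - real (2 * k + 1) * pi * Im \<eta> / 2)"
        unfolding tail_def using assms by (intro gaussian_mode_tail) auto
      also have "\<dots> \<le> exp (- pi * x\<^sup>2 - pi * x / 2)"
      proof -
        have "1 * (pi * x) \<le> real (2 * k + 1) * (pi * x)" using x by (intro mult_right_mono) auto
        thus ?thesis unfolding x_def[symmetric] by (simp add: algebra_simps)
      qed
      finally show ?thesis .
    qed
    hence "norm (\<Sum>k<M. tail k) \<le> (\<Sum>k<M. exp (- pi * x\<^sup>2 - pi * x / 2))" by (intro sum_norm_le) auto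
    also have "\<dots> = real M * exp (- pi * x\<^sup>2 - pi * x / 2)" by simp
    also have "\<dots> \<le> 2 * x * exp (- pi * x\<^sup>2 - pi * x / 2)" using M by (intro mult_right_mono) auto
    finally show ?thesis .
  qed
  have b3: "norm rem \<le> 2 * exp (- 2 * pi * x\<^sup>2 + pi * x / 2)"
  proof -
    define P where "P = real (2 * M) + 1"
    have P: "P \<le> 8 * x" "P \<ge> 4 * x - 1" "P \<ge> 0" using M x by (auto simp: P_def)
    have "norm rem \<le> 2 * exp (- P * pi * x + P\<^sup>2 * pi / 16)"
      unfolding rem_def r_def D_def P_def x_def by (rule gaussian_kernel_remainder(2)[OF assms(1)])
    also have "\<dots> \<le> 2 * exp (- 2 * pi * x\<^sup>2 + pi * x / 2)"
    proof -
      define a where "a = pi * x"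
      \<comment> \<open>Bounding one factor P of P^2 by 8 x leaves the exponent -P pi x / 2, and
        then P >= 4 x - 1 is used.\<close>
      have "P * pi * P \<le> P * pi * (8 * x)" using P by (intro mult_left_mono) auto
      moreover have "a * (4 * x - 1) \<le> a * P" unfolding a_def using P x
        by (intro mult_left_mono) auto
      moreover have "a * (4 * x - 1) = 4 * (a * x) - a" "P * pi * (8 * x) = 8 * (a * P)"
        by (simp_all add: a_def algebra_simps)
      ultimately have i: "- (a * P) + (P * pi * P) / 16 \<le> - 2 * (a * x) + a / 2" by argo
      have "- P * pi * x + P\<^sup>2 * pi / 16 = - (a * P) + (P * pi * P) / 16"
        "- 2 * pi * x\<^sup>2 + pi * x / 2 = - 2 * (a * x) + a / 2"
        by (simp_all add: a_def power2_eq_square)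
      thus ?thesis using i
        by (simp only: exp_le_cancel_iff mult_le_cancel_left_pos zero_less_numeral)
    qed
    finally show ?thesis .
  qed
  have "norm ((LINT y:D|lborel. g y) - c * mordell_main z)
     \<le> 4 * exp (- 2 * pi * x\<^sup>2 + pi * x / 2) + 2 * x * exp (- pi * x\<^sup>2 - pi * x / 2) + 2 * exp (- 2
       * pi * x\<^sup>2 + pi * x / 2)"
    unfolding W by (intro norm_triangle_le norm_triangle_le_diff add_mono b1 b2 b3)
  also have "\<dots> \<le> 7 * (exp 4 * exp (- pi * x) / norm \<eta>)"
    using exp_quadratic_bounds[OF x n0 nle] by linarith
  finally show ?thesis unfolding D_def c_def z_def x_def g_def by simp
qed

subsection \<open>The integrand near the saddle point\<close>

text \<open>The mean value inequality on the segment from 0 to h. Only Re h enters the exponential: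
  the phase error is cubic in y, so a bound by exp |h| could not be absorbed by a Gaussian.\<close>

lemma norm_exp_minus_one_le:
  fixes h :: complex
  assumes "Re h \<le> M" "0 \<le> M"
  shows "norm (exp h - 1) \<le> norm h * exp M"
proof -
  have "norm (exp h - exp 0) \<le> exp M * norm (h - 0)"
  proof (rule field_differentiable_bound[of "closed_segment 0 h" exp exp])
    fix v assume "v \<in> closed_segment 0 h"
    then obtain u where u: "0 \<le> u" "u \<le> 1" "v = of_real u * h"
      by (auto simp: in_segment scaleR_conv_of_real)
    have "Re v = u * Re h" using u by simp
    also have "\<dots> \<le> u * M" using u assms by (intro mult_left_mono) auto
    also have "\<dots> \<le> 1 * M" using u assms by (intro mult_right_mono) auto
    finally show "norm (exp v) \<le> exp M" by simp
  qed (auto intro: DERIV_subset[OF DERIV_exp])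
  thus ?thesis by (simp add: mult.commute)
qed

text \<open>The exponent of f(\<eta>) / f(x) at the point x of the saddle line with parameter
  y.\<close>

definition saddle_phase :: "complex \<Rightarrow> complex \<Rightarrow> real \<Rightarrow> complex" where
  "saddle_phase s \<eta> y = - ((s - 1) * (Ln (saddle_line \<eta> y) - Ln \<eta>))
      + of_real pi * \<i> * ((saddle_line \<eta> y)\<^sup>2 - \<eta>\<^sup>2)"

text \<open>The first two claims come from Re (\<eta> cnj x) >= |\<eta>|^2 / 4, which is a sum of
  squares at the lower end; the other two hold because x stays at height at least Im \<eta> /
  2.\<close>

lemma saddle_line_far:
  assumes "Re \<eta> > 0" "Im \<eta> > 0" "y \<ge> - (Im \<eta> * (sqrt 2 / 2))"
  shows "Re (\<eta> / saddle_line \<eta> y) \<ge> 0" "norm (saddle_line \<eta> y) \<ge> norm \<eta> / 4"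
    "saddle_line \<eta> y \<notin> \<real>\<^sub>\<le>\<^sub>0" "saddle_line \<eta> y \<noteq> 0"
proof -
  define a b where "a = Re \<eta>" and "b = Im \<eta>"
  have ab: "a > 0" "b > 0" using assms by (auto simp: a_def b_def)
  have n2: "(norm \<eta>)\<^sup>2 = a\<^sup>2 + b\<^sup>2" by (simp add: a_def b_def cmod_power2)
  have n0: "norm \<eta> > 0" using ab by (auto simp: a_def b_def)
  have "Re (\<eta> * cnj (saddle_line \<eta> y)) = a\<^sup>2 + b\<^sup>2 + y * (sqrt 2 / 2) * (a + b)"
    by (simp add: Re_Im_saddle_line a_def b_def power2_eq_square algebra_simps)
  also have "y * (sqrt 2 / 2) \<ge> - (b * (sqrt 2 / 2)) * (sqrt 2 / 2)"
    using assms(3) unfolding b_def by (intro mult_right_mono) auto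
  hence "y * (sqrt 2 / 2) \<ge> - b / 2" by simp
  hence "y * (sqrt 2 / 2) * (a + b) \<ge> (- b / 2) * (a + b)" using ab by (intro mult_right_mono) auto
  hence "a\<^sup>2 + b\<^sup>2 + y * (sqrt 2 / 2) * (a + b) \<ge> a\<^sup>2 + b\<^sup>2 + (- b / 2) * (a + b)" by simp
  finally have "Re (\<eta> * cnj (saddle_line \<eta> y)) \<ge> a\<^sup>2 + b\<^sup>2 + (- b / 2) * (a + b)" .
  moreover have "a\<^sup>2 + b\<^sup>2 + (- b / 2) * (a + b) \<ge> (a\<^sup>2 + b\<^sup>2) / 4"
  proof -
    have "a\<^sup>2 + b\<^sup>2 + (- b / 2) * (a + b) - (a\<^sup>2 + b\<^sup>2) / 4 = (a - b)\<^sup>2 / 4 + a\<^sup>2 / 2"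
      by (simp add: power2_eq_square field_simps)
    also have "\<dots> \<ge> 0" by simp
    finally show ?thesis by simp
  qed
  ultimately have R: "Re (\<eta> * cnj (saddle_line \<eta> y)) \<ge> (norm \<eta>)\<^sup>2 / 4" unfolding n2
    by (meson order.trans)
  have "Re (\<eta> / saddle_line \<eta> y) = Re (\<eta> * cnj (saddle_line \<eta> y)) / (norm (saddle_line \<eta> y))\<^sup>2"
    by (simp add: Re_divide cmod_power2)
  moreover have "Re (\<eta> * cnj (saddle_line \<eta> y)) \<ge> 0" using R zero_le_power2[of "norm \<eta>"] by linarith
  ultimately show "Re (\<eta> / saddle_line \<eta> y) \<ge> 0" by simp
  have "(norm \<eta>)\<^sup>2 / 4 \<le> norm (\<eta> * cnj (saddle_line \<eta> y))" using R complex_Re_le_cmod order.trans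
    by blast
  also have "\<dots> = norm \<eta> * norm (saddle_line \<eta> y)" by (simp add: norm_mult)
  finally have "norm \<eta> * (norm \<eta> / 4) \<le> norm \<eta> * norm (saddle_line \<eta> y)"
    by (simp add: power2_eq_square)
  thus "norm (saddle_line \<eta> y) \<ge> norm \<eta> / 4" using n0 by simp
  have "Im (saddle_line \<eta> y) > 0" using Im_saddle_line_half[OF assms(3)] assms(2) by simp
  thus "saddle_line \<eta> y \<notin> \<real>\<^sub>\<le>\<^sub>0" "saddle_line \<eta> y \<noteq> 0" by (auto simp: complex_nonpos_Reals_iff)
qed

lemma saddle_line_has_vector_derivative:
  "(saddle_line \<eta> has_vector_derivative cis (pi / 4)) (at y within A)"
  unfolding saddle_line_def by (auto intro!: derivative_eq_intros)

text \<open>By s - 1 = 2 pi i \<eta>^2 the derivative in x is 2 pi i (x - \<eta>) (x + \<eta>) / x.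
  With x - \<eta> = y e and e^2 = i the factor in front of 1 + \<eta> / x becomes real, which is the
  steepest descent property.\<close>

lemma saddle_phase_deriv:
  assumes "s - 1 = 2 * of_real pi * \<i> * \<eta>\<^sup>2" "Re \<eta> > 0" "Im \<eta> > 0" "y \<ge> - (Im \<eta> * (sqrt 2 / 2))"
  shows "(saddle_phase s \<eta> has_vector_derivative
      of_real (- 2 * pi * y) * (1 + \<eta> / saddle_line \<eta> y)) (at y within A)"
proof -
  define x where "x = saddle_line \<eta> y"
  define e where "e = cis (pi / 4)"
  note far = saddle_line_far[OF assms(2-4), folded x_def]
  have "((\<lambda>v. - ((s - 1) * (Ln v - Ln \<eta>)) + of_real pi * \<i> * (v\<^sup>2 - \<eta>\<^sup>2)) has_field_derivative
     (- ((s - 1) / x) + of_real pi * \<i> * (2 * x))) (at (saddle_line \<eta> y))"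
    unfolding x_def[symmetric]
    using far by (auto intro!: derivative_eq_intros simp: field_simps)
  from field_vector_diff_chain_within[OF saddle_line_has_vector_derivative DERIV_subset[OF this
    subset_UNIV]]
  have "((\<lambda>v. - ((s - 1) * (Ln v - Ln \<eta>))
      + of_real pi * \<i> * (v\<^sup>2 - \<eta>\<^sup>2)) \<circ> saddle_line \<eta> has_vector_derivative
     e * (- ((s - 1) / x) + of_real pi * \<i> * (2 * x))) (at y within A)"
    unfolding e_def x_def by simp
  moreover have "e * (- ((s - 1) / x) + of_real pi * \<i> * (2 * x))
      = of_real (- 2 * pi * y) * (1 + \<eta> / x)"
  proof -
    have "- ((s - 1) / x) + of_real pi * \<i> * (2 * x) = 2 * of_real pi * \<i> * ((x - \<eta>) * (x + \<eta>)) / x"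
      unfolding assms(1) using far by (simp add: field_simps power2_eq_square)
    also have "x - \<eta> = of_real y * e" by (simp add: x_def saddle_line_def e_def)
    also have "e * (2 * of_real pi * \<i> * (of_real y * e * (x + \<eta>)) / x) =
       (e * e) * (2 * of_real pi * \<i> * (of_real y * (x + \<eta>)) / x)" by (simp add: mult_ac)
    also have "e * e = \<i>" unfolding e_def by (rule cis_pi_4_squared)
    also have "\<i> * (2 * of_real pi * \<i> * (of_real y * (x + \<eta>)) / x)
        = of_real (- 2 * pi * y) * ((x + \<eta>) / x)"
      by (simp add: mult_ac)
    also have "(x + \<eta>) / x = 1 + \<eta> / x" using far by (simp add: add_divide_distrib)
    finally show ?thesis .
  qed
  ultimately show ?thesis unfolding saddle_phase_def x_def o_def by simp
qed

lemma saddle_phase_zero: "saddle_phase s \<eta> 0 = 0"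
  by (simp add: saddle_phase_def saddle_line_def)

text \<open>The real part plus pi y^2 has derivative -2 pi y Re (\<eta> / x), of sign opposite to y,
  so it is largest at y = 0. Thus half of the Gaussian decay holds on the whole ray and not only
  near \<eta>.\<close>

lemma Re_saddle_phase_le:
  assumes "s - 1 = 2 * of_real pi * \<i> * \<eta>\<^sup>2" "Re \<eta> > 0" "Im \<eta> > 0" "y \<ge> - (Im \<eta> * (sqrt 2 / 2))"
  shows "Re (saddle_phase s \<eta> y) \<le> - pi * y\<^sup>2"
proof -
  define F where "F = (\<lambda>y. Re (saddle_phase s \<eta> y) + pi * y\<^sup>2)"
  have der: "(F has_real_derivative - 2 * pi * t * Re (\<eta> / saddle_line \<eta> t)) (at t)"
    if t: "t \<ge> - (Im \<eta> * (sqrt 2 / 2))" for t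
  proof -
    have "((\<lambda>y. Re (saddle_phase s \<eta> y)) has_vector_derivative
        Re (of_real (- 2 * pi * t) * (1 + \<eta> / saddle_line \<eta> t))) (at t)"
      by (rule bounded_linear.has_vector_derivative[OF bounded_linear_Re saddle_phase_deriv[OF
        assms(1-3) t]])
    hence "((\<lambda>y. Re (saddle_phase s \<eta> y)) has_real_derivative
        Re (of_real (- 2 * pi * t) * (1 + \<eta> / saddle_line \<eta> t))) (at t)"
      unfolding has_real_derivative_iff_has_vector_derivative .
    moreover have "Re (of_real (- 2 * pi * t) * (1 + \<eta> / saddle_line \<eta> t)) =
       - 2 * pi * t - 2 * pi * t * Re (\<eta> / saddle_line \<eta> t)"
      by (simp only: Re_complex_of_real Im_complex_of_real times_complex.sel plus_complex.sel
        one_complex.sel) (simp add: algebra_simps)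
    ultimately have "((\<lambda>y. Re (saddle_phase s \<eta> y)) has_real_derivative
        - 2 * pi * t - 2 * pi * t * Re (\<eta> / saddle_line \<eta> t)) (at t)" by (simp only:)
    moreover have "((\<lambda>y. pi * y\<^sup>2) has_real_derivative 2 * pi * t) (at t)"
      by (auto intro!: derivative_eq_intros)
    ultimately show ?thesis unfolding F_def by (auto dest: DERIV_add)
  qed
  have "F y \<le> F 0"
  proof (cases "y \<ge> 0")
    case True
    show ?thesis
    proof (rule DERIV_nonpos_imp_nonincreasing[OF True])
      fix t assume t: "0 \<le> t" "t \<le> y"
      have "- (Im \<eta> * (sqrt 2 / 2)) \<le> 0" using assms by simp
      hence t': "t \<ge> - (Im \<eta> * (sqrt 2 / 2))" using t by linarith
      have "- 2 * pi * t * Re (\<eta> / saddle_line \<eta> t) \<le> 0"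
        using saddle_line_far(1)[OF assms(2,3) t'] t by (intro mult_nonpos_nonneg) auto
      with der[OF t'] show "\<exists>y. (F has_real_derivative y) (at t) \<and> y \<le> 0" by blast
    qed
  next
    case False
    hence "y \<le> 0" by simp
    thus ?thesis
    proof (rule DERIV_nonneg_imp_nondecreasing)
      fix t assume t: "y \<le> t" "t \<le> 0"
      hence t': "t \<ge> - (Im \<eta> * (sqrt 2 / 2))" using assms(4) by linarith
      have "0 \<le> - 2 * pi * t * Re (\<eta> / saddle_line \<eta> t)"
      proof (rule mult_nonneg_nonneg)
        show "0 \<le> - 2 * pi * t" using t by (simp add: mult_le_0_iff)
      qed (rule saddle_line_far(1)[OF assms(2,3) t'])
      with der[OF t'] show "\<exists>y. (F has_real_derivative y) (at t) \<and> 0 \<le> y" by blast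
    qed
  qed
  thus ?thesis by (simp add: F_def saddle_phase_zero)
qed

lemma vector_derivative_bound:
  fixes h :: "real \<Rightarrow> 'a :: real_normed_vector"
  assumes "convex S" "\<And>t. t \<in> S \<Longrightarrow> (h has_vector_derivative h' t) (at t within S)"
    "\<And>t. t \<in> S \<Longrightarrow> norm (h' t) \<le> B" "x \<in> S" "y \<in> S"
  shows "norm (h x - h y) \<le> B * norm (x - y)"
proof (rule differentiable_bound[OF assms(1)])
  show "(h has_derivative (\<lambda>r. r *\<^sub>R h' t)) (at t within S)" if "t \<in> S" for t
    using assms(2)[OF that] unfolding has_vector_derivative_def .
  show "onorm (\<lambda>r. r *\<^sub>R h' t) \<le> B" if "t \<in> S" for t
    by (rule onorm_le) (use mult_right_mono[OF assms(3)[OF that] abs_ge_zero] in \<open>simp add: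
      mult.commute\<close>)
qed (use assms in auto)

text \<open>After adding 2 pi y^2 the derivative is 2 pi y (x - \<eta>) / x, of modulus at most 8 pi
  y^2 / |\<eta>| because |x| >= |\<eta>| / 4.\<close>

lemma saddle_phase_quadratic:
  assumes "s - 1 = 2 * of_real pi * \<i> * \<eta>\<^sup>2" "Re \<eta> > 0" "Im \<eta> > 0" "y \<ge> - (Im \<eta> * (sqrt 2 / 2))"
  shows "norm (saddle_phase s \<eta> y + of_real (2 * pi * y\<^sup>2)) \<le> 8 * pi * \<bar>y\<bar> ^ 3 / norm \<eta>"
proof -
  define h where "h = (\<lambda>y. saddle_phase s \<eta> y + of_real (2 * pi * y\<^sup>2))"
  have n0: "norm \<eta> > 0" using assms by auto
  have seg: "t \<ge> - (Im \<eta> * (sqrt 2 / 2))" "\<bar>t\<bar> \<le> \<bar>y\<bar>" if "t \<in> closed_segment 0 y" for t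
  proof -
    have "- (Im \<eta> * (sqrt 2 / 2)) \<le> 0" using assms by simp
    thus "t \<ge> - (Im \<eta> * (sqrt 2 / 2))" "\<bar>t\<bar> \<le> \<bar>y\<bar>"
      using that assms(4) by (auto simp: closed_segment_eq_real_ivl split: if_splits)
  qed
  have "norm (h y - h 0) \<le> (8 * pi * y\<^sup>2 / norm \<eta>) * norm (y - 0)"
  proof (rule vector_derivative_bound[of "closed_segment 0 y" h
        "\<lambda>t. of_real (- 2 * pi * t) * (1 + \<eta> / saddle_line \<eta> t) + of_real (2 * pi * (2 * t))"])
    fix t assume t: "t \<in> closed_segment 0 y"
    note far = saddle_line_far[OF assms(2,3) seg(1)[OF t]]
    have "((\<lambda>y. 2 * pi * y\<^sup>2) has_vector_derivative (2 * pi
        * (2 * t))) (at t within closed_segment 0 y)"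
      by (auto intro!: derivative_eq_intros simp flip:
        has_real_derivative_iff_has_vector_derivative)
    hence "((\<lambda>y. complex_of_real (2 * pi * y\<^sup>2)) has_vector_derivative of_real (2 * pi
        * (2 * t))) (at t within closed_segment 0 y)"
      by (rule bounded_linear.has_vector_derivative[OF bounded_linear_of_real])
    thus "(h has_vector_derivative
        of_real (- 2 * pi * t) * (1 + \<eta> / saddle_line \<eta> t) + of_real (2 * pi * (2 * t))) (at t
          within closed_segment 0 y)"
      unfolding h_def
      by (rule has_vector_derivative_add[OF saddle_phase_deriv[OF assms(1-3) seg(1)[OF t]]])
    define x where "x = saddle_line \<eta> t"
    have "of_real (- 2 * pi * t) * (1 + \<eta> / x) + of_real (2 * pi * (2 * t))
        = of_real (2 * pi * t) * ((x - \<eta>) / x)"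
      using far by (simp add: x_def diff_divide_distrib algebra_simps)
    also have "x - \<eta> = of_real t * cis (pi / 4)" by (simp add: x_def saddle_line_def)
    also have "norm (of_real (2 * pi * t) * (of_real t * cis (pi / 4) / x)) = 2 * pi * t\<^sup>2 / norm x"
      by (simp add: norm_mult norm_divide power2_eq_square abs_mult)
    also have "\<dots> \<le> 2 * pi * y\<^sup>2 / (norm \<eta> / 4)"
      using far n0 seg(2)[OF t] unfolding x_def
        by (intro frac_le mult_left_mono) (auto simp: abs_le_square_iff)
    finally show "norm (of_real (- 2 * pi * t) * (1 + \<eta> / saddle_line \<eta> t)
        + of_real (2 * pi * (2 * t)))
       \<le> 8 * pi * y\<^sup>2 / norm \<eta>" unfolding x_def by simp
  qed auto
  also have "(8 * pi * y\<^sup>2 / norm \<eta>) * norm (y - 0) = 8 * pi * \<bar>y\<bar> ^ 3 / norm \<eta>"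
    by (simp add: power3_eq_cube power2_eq_square abs_mult)
  finally show ?thesis by (simp add: h_def saddle_phase_zero)
qed

text \<open>The integrand is -\<open>sine_kernel x\<close> / (x f(x)); the factor f(\<eta>) \<eta>
  normalises it at the saddle point.\<close>

lemma aux_R_integrand_saddle:
  assumes "x \<noteq> 0" "\<eta> \<noteq> 0"
  shows "aux_R_integrand s x * (saddle_monomial s \<eta> * \<eta>) =
    - (\<eta> / x * exp (- ((s - 1) * (Ln x - Ln \<eta>)) + of_real pi * \<i> * (x\<^sup>2 - \<eta>\<^sup>2)) * sine_kernel x)"
proof -
  define a where "a = exp (of_real pi * \<i> * x) - exp (- (of_real pi * \<i> * x))"
  have k: "sine_kernel x = - (1 / a)"
    unfolding sine_kernel_def a_def by (metis minus_diff_eq minus_divide_right)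
  have xs: "x powr (- s) = exp (- ((s - 1) * Ln x)) / x"
  proof -
    have "x powr (- s) = exp (- ((s - 1) * Ln x) - Ln x)"
      using assms unfolding powr_def by (simp add: algebra_simps)
    thus ?thesis unfolding exp_diff using exp_Ln[OF assms(1)] by simp
  qed
  have sm: "saddle_monomial s \<eta> = exp ((s - 1) * Ln \<eta> + - (of_real pi * \<i> * \<eta>\<^sup>2))"
    using assms unfolding saddle_monomial_def powr_def exp_add by simp
  have "exp (- ((s - 1) * Ln x)) * exp (of_real pi * \<i> * x\<^sup>2) * saddle_monomial s \<eta> =
     exp (- ((s - 1) * (Ln x - Ln \<eta>)) + of_real pi * \<i> * (x\<^sup>2 - \<eta>\<^sup>2))"
    unfolding sm exp_add[symmetric] by (rule arg_cong[of _ _ exp]) (simp add: algebra_simps)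
  moreover have "aux_R_integrand s x * (saddle_monomial s \<eta> * \<eta>) =
     (\<eta> / x) * (exp (- ((s - 1) * Ln x)) * exp (of_real pi * \<i> * x\<^sup>2) * saddle_monomial s \<eta>) * (1 /
       a)"
    unfolding aux_R_integrand_def a_def[symmetric] xs by simp
  ultimately show ?thesis unfolding k by simp
qed

text \<open>One Gaussian pays for the cubic phase error and for the growth of the kernel towards the
  lower end of the ray. The 28 is 27 + 1, from r^3 <= 27 exp r and r <= exp r.\<close>

lemma cube_plus_abs_gaussian_bound:
  fixes y :: real
  shows "(\<bar>y\<bar> ^ 3 + \<bar>y\<bar>) * exp (- pi * y\<^sup>2 - pi * (y * (sqrt 2 / 2)))
      \<le> 28 * exp 2 * exp (- y\<^sup>2 / 2)"
proof -
  define r where "r = \<bar>y\<bar>"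
  have r: "r \<ge> 0" "y\<^sup>2 = r\<^sup>2" by (simp_all add: r_def)
  have "(1 + r / 3) ^ 3 \<le> exp (r / 3) ^ 3"
    using r by (intro power_mono exp_ge_add_one_self) auto
  also have "exp (r / 3) ^ 3 = exp r" unfolding exp_of_nat_mult[symmetric] by simp
  finally have "(1 + r / 3) ^ 3 \<le> exp r" .
  moreover have "r ^ 3 / 27 \<le> (1 + r / 3) ^ 3"
  proof -
    have "(r / 3) ^ 3 \<le> (1 + r / 3) ^ 3" using r by (intro power_mono) auto
    thus ?thesis by (simp add: power_divide)
  qed
  ultimately have "r ^ 3 \<le> 27 * exp r" by simp
  moreover have "r \<le> exp r" using exp_ge_add_one_self[of r] by linarith
  ultimately have c: "r ^ 3 + r \<le> 28 * exp r" by simp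
  have e: "r + (- pi * y\<^sup>2 - pi * (y * (sqrt 2 / 2))) \<le> 2 - y\<^sup>2 / 2"
  proof -
    have "- (pi * (y * (sqrt 2 / 2))) \<le> 3 * r"
    proof -
      have "\<bar>pi * (y * (sqrt 2 / 2))\<bar> = (pi * (sqrt 2 / 2)) * r" by (simp add: abs_mult r_def)
      also have "pi * (sqrt 2 / 2) \<le> 4 * (3 / 4)"
      proof (intro mult_mono)
        have "sqrt 2 \<le> 3 / 2" by (rule real_le_lsqrt) (auto simp: power2_eq_square)
        thus "sqrt 2 / 2 \<le> 3 / 4" by simp
      qed (use pi_less_4 in auto)
      finally show ?thesis using r by (simp add: mult_right_mono)
    qed
    moreover have "pi * y\<^sup>2 \<ge> 3 * r\<^sup>2" unfolding r(2) using pi_gt3 by (intro mult_right_mono) auto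
    moreover have "4 * r \<le> 2 * r\<^sup>2 + 2" using zero_le_power2[of "r - 1"]
      by (simp add: power2_eq_square algebra_simps)
    moreover have "r\<^sup>2 \<ge> 0" by simp
    moreover have "- pi * y\<^sup>2 = - (pi * y\<^sup>2)" by simp
    ultimately show ?thesis using r(2) by argo
  qed
  have "(r ^ 3 + r) * exp (- pi * y\<^sup>2 - pi * (y * (sqrt 2 / 2))) \<le>
     (28 * exp r) * exp (- pi * y\<^sup>2 - pi * (y * (sqrt 2 / 2)))"
    using c by (intro mult_right_mono) auto
  also have "\<dots> = 28 * exp (r + (- pi * y\<^sup>2 - pi * (y * (sqrt 2 / 2))))" unfolding exp_add
    by (simp only: mult.assoc)
  also have "\<dots> \<le> 28 * exp (2 + - y\<^sup>2 / 2)" using e by simp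
  also have "\<dots> = 28 * exp 2 * exp (- y\<^sup>2 / 2)" unfolding exp_add by (simp only: mult.assoc)
  finally show ?thesis by (simp only: r_def)
qed

text \<open>The phase error h is of order |y|^3 / |\<eta>|, and its real part is at most pi y^2, so
  half of exp (-2 pi y^2) is spent on exp h and exp (-pi y^2) remains. Replacing \<eta> / x by 1
  costs a further |y| / |\<eta>|.\<close>

lemma saddle_integrand_error:
  assumes "s - 1 = 2 * of_real pi * \<i> * \<eta>\<^sup>2" "Re \<eta> > 0" "Im \<eta> \<ge> 1" "y \<ge> - (Im \<eta> * (sqrt 2 / 2))"
  shows "norm (aux_R_integrand s (saddle_line \<eta> y) * (saddle_monomial s \<eta> * \<eta>) +
     of_real (exp (- 2 * pi * y\<^sup>2)) * sine_kernel (saddle_line \<eta> y)) \<le>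
     6000 * exp 2 * exp (- pi * Im \<eta>) / norm \<eta> * exp (- y\<^sup>2 / 2)"
proof -
  define x where "x = saddle_line \<eta> y"
  define \<psi> where "\<psi> = saddle_phase s \<eta> y"
  define h where "h = \<psi> + of_real (2 * pi * y\<^sup>2)"
  have e2: "Im \<eta> > 0" using assms by simp
  have n0: "norm \<eta> > 0" using e2 by auto
  note far = saddle_line_far[OF assms(2) e2 assms(4), folded x_def]
  have eta0: "\<eta> \<noteq> 0" using n0 by auto
  have "Re \<psi> \<le> - pi * y\<^sup>2"
    unfolding \<psi>_def by (rule Re_saddle_phase_le[OF assms(1,2) e2 assms(4)])
  hence Rh: "Re h \<le> pi * y\<^sup>2" by (simp add: h_def)
  have hn: "norm h \<le> 8 * pi * \<bar>y\<bar> ^ 3 / norm \<eta>"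
    unfolding h_def \<psi>_def by (rule saddle_phase_quadratic[OF assms(1,2) e2 assms(4)])
  have ex: "norm (\<eta> / x) \<le> 4"
  proof -
    have "norm (\<eta> / x) = norm \<eta> / norm x" by (rule norm_divide)
    also have "\<dots> \<le> norm \<eta> / (norm \<eta> / 4)" using far n0 by (intro divide_left_mono) auto
    finally show ?thesis using n0 by simp
  qed
  have ex1: "norm (\<eta> / x - 1) \<le> 4 * \<bar>y\<bar> / norm \<eta>"
  proof -
    have "\<eta> / x - 1 = - (of_real y * cis (pi / 4) / x)"
      using far(4) unfolding x_def saddle_line_def by (simp add: field_simps)
    hence "norm (\<eta> / x - 1) = \<bar>y\<bar> / norm x" by (simp add: norm_mult norm_divide)
    also have "\<dots> \<le> \<bar>y\<bar> / (norm \<eta> / 4)" using far n0 by (intro divide_left_mono) auto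
    finally show ?thesis by (simp add: mult.commute)
  qed
  have psi: "exp \<psi> = of_real (exp (- 2 * pi * y\<^sup>2)) * exp h"
    unfolding exp_of_real[symmetric] exp_add[symmetric] h_def by (rule arg_cong[of _ _ exp]) simp
  have split: "\<eta> / x * exp \<psi> - of_real (exp (- 2 * pi * y\<^sup>2)) =
     of_real (exp (- 2 * pi * y\<^sup>2)) * (\<eta> / x * (exp h - 1) + (\<eta> / x - 1))"
    unfolding psi by (simp add: algebra_simps)
  have "norm (\<eta> / x * (exp h - 1) + (\<eta> / x - 1)) \<le>
     4 * (8 * pi * \<bar>y\<bar> ^ 3 / norm \<eta> * exp (pi * y\<^sup>2)) + 4 * \<bar>y\<bar> / norm \<eta> * exp (pi * y\<^sup>2)"
  proof (rule norm_triangle_le[OF add_mono])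
    have "norm (exp h - 1) \<le> norm h * exp (pi * y\<^sup>2)" by (rule norm_exp_minus_one_le[OF Rh]) simp
    also have "\<dots> \<le> 8 * pi * \<bar>y\<bar> ^ 3 / norm \<eta> * exp (pi * y\<^sup>2)" using hn
      by (intro mult_right_mono) auto
    finally show "norm (\<eta> / x * (exp h - 1)) \<le> 4 * (8 * pi * \<bar>y\<bar> ^ 3 / norm \<eta> * exp (pi * y\<^sup>2))"
      unfolding norm_mult using ex by (intro mult_mono) auto
    have "4 * \<bar>y\<bar> / norm \<eta> * 1 \<le> 4 * \<bar>y\<bar> / norm \<eta> * exp (pi * y\<^sup>2)" by (intro mult_left_mono) auto
    thus "norm (\<eta> / x - 1) \<le> 4 * \<bar>y\<bar> / norm \<eta> * exp (pi * y\<^sup>2)" using ex1 by linarith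
  qed
  also have "\<dots> = (32 * pi * \<bar>y\<bar> ^ 3 + 4 * \<bar>y\<bar>) / norm \<eta> * exp (pi * y\<^sup>2)"
    by (simp add: add_divide_distrib algebra_simps)
  also have "\<dots> \<le> (103 * (\<bar>y\<bar> ^ 3 + \<bar>y\<bar>)) / norm \<eta> * exp (pi * y\<^sup>2)"
  proof (intro mult_right_mono divide_right_mono)
    \<comment> \<open>32 pi < 103; later 2 * 103 * 28 = 5768 is rounded up to 6000.\<close>
    have "32 * pi * \<bar>y\<bar> ^ 3 \<le> 103 * \<bar>y\<bar> ^ 3" using pi_approx by (intro mult_right_mono) auto
    thus "32 * pi * \<bar>y\<bar> ^ 3 + 4 * \<bar>y\<bar> \<le> 103 * (\<bar>y\<bar> ^ 3 + \<bar>y\<bar>)" by simp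
  qed auto
  finally have A: "norm (\<eta> / x * (exp h - 1) + (\<eta> / x - 1))
      \<le> (103 * (\<bar>y\<bar> ^ 3 + \<bar>y\<bar>)) / norm \<eta> * exp (pi * y\<^sup>2)" .
  have im: "Im x \<ge> 1 / 4" using Im_saddle_line_half[OF assms(4)] assms(3) by (simp add: x_def)
  have K: "norm (sine_kernel x) \<le> 2 * exp (- pi * Im \<eta> - pi * (y * (sqrt 2 / 2)))"
    using sine_kernel_bound(1)[OF im] unfolding x_def Re_Im_saddle_line by (simp add: algebra_simps)
  have "aux_R_integrand s x * (saddle_monomial s \<eta> * \<eta>) = - (\<eta> / x * exp \<psi> * sine_kernel x)"
    using aux_R_integrand_saddle[OF far(4) eta0] unfolding \<psi>_def saddle_phase_def x_def .
  hence "aux_R_integrand s x * (saddle_monomial s \<eta> * \<eta>)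
      + of_real (exp (- 2 * pi * y\<^sup>2)) * sine_kernel x =
     - ((\<eta> / x * exp \<psi> - of_real (exp (- 2 * pi * y\<^sup>2))) * sine_kernel x)"
    by (simp only: left_diff_distrib) simp
  hence "norm (aux_R_integrand s x * (saddle_monomial s \<eta> * \<eta>)
      + of_real (exp (- 2 * pi * y\<^sup>2)) * sine_kernel x) =
      exp (- 2 * pi * y\<^sup>2) * norm (\<eta> / x * (exp h - 1) + (\<eta> / x - 1)) * norm (sine_kernel x)"
    unfolding split by (simp only: norm_minus_cancel norm_mult norm_of_real abs_exp_cancel)
  also have "\<dots> \<le> exp (- 2 * pi * y\<^sup>2) * ((103 * (\<bar>y\<bar> ^ 3 + \<bar>y\<bar>)) / norm \<eta> * exp (pi * y\<^sup>2)) *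
      (2 * exp (- pi * Im \<eta> - pi * (y * (sqrt 2 / 2))))"
    using A K by (intro mult_mono mult_left_mono) auto
  also have "\<dots> = 206 / norm \<eta> * (\<bar>y\<bar> ^ 3 + \<bar>y\<bar>) *
      exp (- 2 * pi * y\<^sup>2 + pi * y\<^sup>2 + (- pi * Im \<eta> - pi * (y * (sqrt 2 / 2))))"
    unfolding exp_add by simp
  also have "- 2 * pi * y\<^sup>2 + pi * y\<^sup>2 + (- pi * Im \<eta> - pi * (y * (sqrt 2 / 2))) =
      - pi * Im \<eta> + (- pi * y\<^sup>2 - pi * (y * (sqrt 2 / 2)))" by simp
  also have "206 / norm \<eta> * (\<bar>y\<bar> ^ 3 + \<bar>y\<bar>) * exp (- pi * Im \<eta>
      + (- pi * y\<^sup>2 - pi * (y * (sqrt 2 / 2)))) =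
      206 * exp (- pi * Im \<eta>) / norm \<eta> * ((\<bar>y\<bar> ^ 3 + \<bar>y\<bar>) * exp (- pi * y\<^sup>2 - pi * (y * (sqrt 2 /
        2))))"
    unfolding exp_add by simp
  also have "\<dots> \<le> 206 * exp (- pi * Im \<eta>) / norm \<eta> * (28 * exp 2 * exp (- y\<^sup>2 / 2))"
    using n0 by (intro mult_left_mono cube_plus_abs_gaussian_bound) auto
  also have "\<dots> = 5768 * (exp (- pi * Im \<eta>) / norm \<eta> * exp 2 * exp (- y\<^sup>2 / 2))" by simp
  also have "\<dots> \<le> 6000 * (exp (- pi * Im \<eta>) / norm \<eta> * exp 2 * exp (- y\<^sup>2 / 2))"
    by (intro mult_right_mono) auto
  finally show ?thesis unfolding x_def by (simp add: mult_ac)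
qed

lemma integral_exp_half_square:
  "has_bochner_integral lborel (\<lambda>y. exp (- y\<^sup>2 / 2)) (sqrt (2 * pi))"
proof -
  have "has_bochner_integral lborel (\<lambda>y. sqrt (2 * pi) * std_normal_density y) (sqrt (2 * pi) * 1)"
    by (intro has_bochner_integral_mult_right)
       (auto simp: has_bochner_integral_iff intro: integrable_normal_density[OF zero_less_one]
         integral_normal_density[OF zero_less_one])
  thus ?thesis by (simp add: std_normal_density_def)
qed

text \<open>The pointwise error is integrated, and the kernel against the Gaussian is replaced by
  its value. The 18000 is 6000 * 3 with 3 >= sqrt (2 pi).\<close>

lemma saddle_ray_integral:
  assumes "s - 1 = 2 * of_real pi * \<i> * \<eta>\<^sup>2" "Re \<eta> > 0" "Im \<eta> \<ge> 1"
    "(norm \<eta>) ^ 4 \<le> exp ((Im \<eta>)\<^sup>2 + 3)"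
  shows "norm ((LINT y:{- (Im \<eta> * (sqrt 2 / 2))..}|lborel. aux_R_integrand s (saddle_line \<eta> y)) *
       (saddle_monomial s \<eta> * \<eta>) +
       of_real (1 / sqrt 2) * cis (- pi / 8) * mordell_main (exp (of_real pi * \<i> * \<eta>)))
    \<le> (18000 * exp 2 + 7 * exp 4) * exp (- pi * Im \<eta>) / norm \<eta>"
proof -
  define D where "D = {- (Im \<eta> * (sqrt 2 / 2))..}"
  define m where "m = saddle_monomial s \<eta> * \<eta>"
  define c where "c = of_real (1 / sqrt 2) * cis (- pi / 8)
      * mordell_main (exp (of_real pi * \<i> * \<eta>))"
  define g where "g = (\<lambda>y. of_real (exp (- 2 * pi * y\<^sup>2)) * sine_kernel (saddle_line \<eta> y))"
  define f where "f = (\<lambda>y. aux_R_integrand s (saddle_line \<eta> y) * m)"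
  define K where "K = 6000 * exp 2 * exp (- pi * Im \<eta>) / norm \<eta>"
  have e2: "Im \<eta> > 0" using assms by simp
  have K0: "K \<ge> 0" by (simp add: K_def)
  have far: "saddle_line \<eta> y \<notin> \<real>\<^sub>\<le>\<^sub>0" "saddle_line \<eta> y \<noteq> 0" "Im (saddle_line \<eta> y) \<ge> 1 / 4"
    if "y \<in> D" for y
    using saddle_line_far(3,4)[OF assms(2) e2, of y] Im_saddle_line_half[of \<eta> y] that assms(3)
      by (auto simp: D_def)
  have nz: "exp (of_real pi * \<i> * saddle_line \<eta> y) - exp (- (of_real pi * \<i> * saddle_line \<eta> y)) \<noteq> 0"
    if "y \<in> D" for y
    using sine_kernel_bound(2)[OF far(3)[OF that]] by (metis eq_iff_diff_eq_0)
  have cf: "continuous_on D f"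
    unfolding f_def aux_R_integrand_def powr_def using far nz
    by (intro continuous_intros continuous_on_saddle_line continuous_on_cases_le) (auto intro!:
      continuous_intros continuous_on_saddle_line)
  have cg: "continuous_on D g"
    unfolding g_def sine_kernel_def
    using sine_kernel_bound(2)[OF far(3)]
      by (intro continuous_intros continuous_on_saddle_line) auto
  have Kint: "has_bochner_integral lborel (\<lambda>y. K * exp (- y\<^sup>2 / 2)) (K * sqrt (2 * pi))"
    by (intro has_bochner_integral_mult_right integral_exp_half_square)
  have le: "norm (f y + g y) \<le> K * exp (- y\<^sup>2 / 2)" if "y \<in> D" for y
    unfolding f_def g_def m_def K_def using that
      by (intro saddle_integrand_error assms) (simp add: D_def)
  note d = set_integral_dominated[OF continuous_on_add[OF cf cg] _ has_bochner_integral_iff[THEN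
    iffD1, OF Kint, THEN conjunct1] le]
  have sum_int: "set_integrable lborel D (\<lambda>y. f y + g y)" by (rule d) (use K0 in \<open>auto simp: D_def\<close>)
  have "norm (LINT y:D|lborel. f y + g y) \<le> (LINT y|lborel. K * exp (- y\<^sup>2 / 2))"
    by (rule d) (use K0 in \<open>auto simp: D_def\<close>)
  also have "\<dots> = K * sqrt (2 * pi)" using Kint by (rule has_bochner_integral_integral_eq)
  also have "\<dots> \<le> K * 3"
  proof (intro mult_left_mono K0)
    show "sqrt (2 * pi) \<le> 3"
      by (rule real_le_lsqrt) (use pi_less_4 in \<open>auto simp: power2_eq_square\<close>)
  qed
  finally have B1: "norm (LINT y:D|lborel. f y + g y) \<le> K * 3" .
  have g_int: "set_integrable lborel D g"
    unfolding g_def D_def by (rule set_integrable_gaussian_kernel[OF assms(3)])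
  have "(LINT y:D|lborel. f y) = (LINT y:D|lborel. (f y + g y) - g y)" by simp
  also have "\<dots> = (LINT y:D|lborel. f y + g y) - (LINT y:D|lborel. g y)"
    by (rule set_integral_diff(2)[OF sum_int g_int])
  finally have fg: "(LINT y:D|lborel. f y) + c
      = (LINT y:D|lborel. f y + g y) - ((LINT y:D|lborel. g y) - c)" by simp
  have "norm ((LINT y:D|lborel. f y) + c) \<le> K * 3 + 7 * exp 4 * exp (- pi * Im \<eta>) / norm \<eta>"
    unfolding fg
  proof (rule norm_triangle_le_diff[OF add_mono[OF B1]])
    show "norm ((LINT y:D|lborel. g y) - c) \<le> 7 * exp 4 * exp (- pi * Im \<eta>) / norm \<eta>"
      unfolding g_def D_def c_def by (rule gaussian_kernel_integral[OF assms(3,4)])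
  qed
  moreover have "(LINT y:D|lborel. f y)
      = (LINT y:D|lborel. aux_R_integrand s (saddle_line \<eta> y)) * m"
    unfolding f_def by simp
  moreover have "K * 3 + 7 * exp 4 * exp (- pi * Im \<eta>) / norm \<eta>
      = (18000 * exp 2 + 7 * exp 4) * exp (- pi * Im \<eta>) / norm \<eta>"
    unfolding K_def by (simp add: add_divide_distrib ring_distribs)
  ultimately show ?thesis unfolding D_def m_def c_def by simp
qed

subsection \<open>Shifting rays of integration\<close>

lemma set_integrable_half_line_gaussian_decay:
  fixes h :: "real \<Rightarrow> complex"
  assumes "continuous_on {0..} h" "\<And>r. r \<ge> r0 \<Longrightarrow> norm (h r) \<le> C * exp (- r\<^sup>2 / 2)"
  shows "set_integrable lborel {0..} h"
proof -
  have "compact (h ` {0..r0})"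
    by (rule compact_continuous_image[OF continuous_on_subset[OF assms(1)]]) auto
  hence "bounded (h ` {0..r0})" by (rule compact_imp_bounded)
  then obtain M where M: "\<And>r. r \<in> {0..r0} \<Longrightarrow> norm (h r) \<le> M"
    unfolding bounded_iff by blast
  define B where "B = \<bar>M\<bar> * exp (r0\<^sup>2 / 2) + \<bar>C\<bar>"
  have B0: "B \<ge> 0" by (simp add: B_def)
  have le: "norm (h r) \<le> B * exp (- r\<^sup>2 / 2)" if "r \<in> {0..}" for r
  proof (cases "r \<le> r0")
    case True
    have "r\<^sup>2 \<le> r0\<^sup>2" using True that by (intro power_mono) auto
    have "norm (h r) \<le> \<bar>M\<bar> * 1" using M[of r] True that by auto
    also have "1 \<le> exp (r0\<^sup>2 / 2) * exp (- r\<^sup>2 / 2)"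
      unfolding exp_add[symmetric] using \<open>r\<^sup>2 \<le> r0\<^sup>2\<close> by simp
    hence "\<bar>M\<bar> * 1 \<le> \<bar>M\<bar> * (exp (r0\<^sup>2 / 2) * exp (- r\<^sup>2 / 2))" by (intro mult_left_mono) auto
    also have "\<dots> \<le> B * exp (- r\<^sup>2 / 2)" by (simp add: B_def distrib_right)
    finally show ?thesis .
  next
    case False
    hence "norm (h r) \<le> C * exp (- r\<^sup>2 / 2)" using assms(2) by simp
    also have "\<dots> \<le> B * exp (- r\<^sup>2 / 2)"
      by (intro mult_right_mono) (auto simp: B_def add.commute add_increasing2)
    finally show ?thesis .
  qed
  have "integrable lborel (\<lambda>y. B * exp (- y\<^sup>2 / 2))"
    using has_bochner_integral_mult_right[OF integral_exp_half_square, of B]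
      by (rule integrable.intros)
  thus ?thesis using set_integral_dominated(1)[OF assms(1) _ _ le] B0 by simp
qed

text \<open>A primitive on the convex set S takes the place of Cauchy's theorem for a truncated
  parallelogram: the far side is a difference of its values and vanishes by the decay. The
  exceptional set K admits rays that start at 0, where the integrand is merely continuous.\<close>

lemma ray_integral_shift:
  fixes f :: "complex \<Rightarrow> complex"
  assumes S: "convex S" "continuous_on S f" "finite K" "\<And>x. x \<in> S - K \<Longrightarrow> f field_differentiable at x"
    and rays: "\<And>r. r \<ge> 0 \<Longrightarrow> a + of_real r * d \<in> S" "\<And>r. r \<ge> 0 \<Longrightarrow> z + of_real r * d \<in> S"
    and decay: "\<And>r x. r \<ge> r0 \<Longrightarrow> x \<in> closed_segment a z \<Longrightarrow> norm (f (x + of_real r * d))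
        \<le> C * exp (- r\<^sup>2 / 2)"
  shows "d * (LINT r:{0..}|lborel. f (a + of_real r * d)) =
      contour_integral (linepath a z) f + d * (LINT r:{0..}|lborel. f (z + of_real r * d))"
proof -
  have "\<And>x. x \<in> interior S - K \<Longrightarrow> f field_differentiable at x"
    using S(4) interior_subset by blast
  then obtain g where g: "\<And>x. x \<in> S \<Longrightarrow> (g has_field_derivative f x) (at x within S)"
    using holomorphic_convex_primitive[OF S(1,3,2)] by blast
  have lim: "((\<lambda>N. g (b + of_real N * d) - g b)
      \<longlongrightarrow> d * (LINT r:{0..}|lborel. f (b + of_real r * d))) at_top"
    if b: "\<And>r. r \<ge> 0 \<Longrightarrow> b + of_real r * d \<in> S" "b \<in> closed_segment a z" for b
  proof -
    have cont: "continuous_on {0..} (\<lambda>r. f (b + of_real r * d))"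
      by (rule continuous_on_compose2[OF S(2)]) (auto intro!: continuous_intros b)
    have "set_integrable lborel {0..} (\<lambda>r. f (b + of_real r * d))"
      by (rule set_integrable_half_line_gaussian_decay[OF cont decay[OF _ b(2)]])
    hence "((\<lambda>N. LINT r:{0..N}|lborel. f (b + of_real r * d))
        \<longlongrightarrow> (LINT r:{0..}|lborel. f (b + of_real r * d))) at_top"
      by (intro tendsto_set_lebesgue_integral_at_top) auto
    hence t: "((\<lambda>N. d * (LINT r:{0..N}|lborel. f (b + of_real r * d)))
        \<longlongrightarrow> d * (LINT r:{0..}|lborel. f (b + of_real r * d))) at_top"
      by (intro tendsto_intros)
    have eq: "d * (LINT r:{0..N}|lborel. f (b + of_real r * d)) = g (b + of_real N * d) - g b"
      if N: "N \<ge> 0" for N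
    proof -
      have "(LINT r|lborel. indicator {0..N} r *\<^sub>R (d * f (b + of_real r * d))) =
          (g \<circ> (\<lambda>r. b + of_real r * d)) N - (g \<circ> (\<lambda>r. b + of_real r * d)) 0"
      proof (rule integral_FTC_Icc[OF N])
        fix r assume r: "0 \<le> r" "r \<le> N"
        have "((\<lambda>r. b + of_real r * d) has_vector_derivative d) (at r within {0..N})"
          by (auto intro!: derivative_eq_intros)
        moreover have "(g has_field_derivative f (b + of_real r * d)) (at (b
            + of_real r * d) within (\<lambda>r. b + of_real r * d) ` {0..N})"
          by (rule DERIV_subset[OF g[OF b(1)[OF r(1)]]]) (use b(1) in auto)
        ultimately show "(g \<circ> (\<lambda>r. b + of_real r * d) has_vector_derivative d * f (b
            + of_real r * d)) (at r within {0..N})"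
          by (rule field_vector_diff_chain_within)
      qed (intro continuous_on_mult continuous_on_const continuous_on_subset[OF cont], auto)
      thus ?thesis unfolding set_lebesgue_integral_def by (simp flip: mult_scaleR_right)
    qed
    show ?thesis
      by (rule Lim_transform_eventually[OF t]) (auto intro!: eventually_mono[OF
        eventually_ge_at_top[of 0]] eq)
  qed
  define Ia Iz where "Ia = d * (LINT r:{0..}|lborel. f (a + of_real r * d))"
    and "Iz = d * (LINT r:{0..}|lborel. f (z + of_real r * d))"
  have az: "a \<in> S" "z \<in> S" using rays[of 0] by auto
  have "((\<lambda>N. (g (a + of_real N * d) - g a) - (g (z + of_real N * d) - g z)) \<longlongrightarrow> Ia - Iz) at_top"
    unfolding Ia_def Iz_def by (intro tendsto_diff lim rays) auto
  moreover have "((\<lambda>N. (g (a + of_real N * d) - g a) - (g (z + of_real N * d) - g z))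
      \<longlongrightarrow> (g z - g a) + 0) at_top"
  proof -
    have "((\<lambda>N. g (a + of_real N * d) - g (z + of_real N * d)) \<longlongrightarrow> 0) at_top"
    proof (rule Lim_null_comparison)
      show "\<forall>\<^sub>F N in at_top. norm (g (a + of_real N * d) - g (z + of_real N * d))
          \<le> C * exp (- N\<^sup>2 / 2) * norm (a - z)"
        using eventually_ge_at_top[of "max r0 0"]
      proof eventually_elim
        case (elim N)
        have sub: "closed_segment (a + of_real N * d) (z + of_real N * d) \<subseteq> S"
          using rays[of N] elim S(1) by (simp add: closed_segment_subset)
        have "norm (g (a + of_real N * d) - g (z + of_real N * d)) \<le>
            C * exp (- N\<^sup>2 / 2) * norm ((a + of_real N * d) - (z + of_real N * d))"
        proof (rule field_differentiable_bound[of
          "closed_segment (a + of_real N * d) (z + of_real N * d)" g f])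
          fix x assume x: "x \<in> closed_segment (a + of_real N * d) (z + of_real N * d)"
          show "(g has_field_derivative f x) (at x within closed_segment (a + of_real N * d) (z
              + of_real N * d))"
            using DERIV_subset[OF g sub] x sub by blast
          have "x - of_real N * d \<in> closed_segment a z"
            using x closed_segment_translation_eq[of "of_real N * d" "x - of_real N * d" a z]
              by (simp add: add.commute)
          from decay[OF _ this, of N] show "norm (f x) \<le> C * exp (- N\<^sup>2 / 2)" using elim by simp
        qed auto
        thus ?case by simp
      qed
      have "((\<lambda>N. C * exp (- N\<^sup>2 / 2) * norm (a - z)) \<longlongrightarrow> C * 0 * norm (a - z)) at_top"
        by (intro tendsto_intros) real_asymp
      thus "((\<lambda>N. C * exp (- N\<^sup>2 / 2) * norm (a - z)) \<longlongrightarrow> 0) at_top" by simp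
    qed
    from tendsto_add[OF tendsto_const[of "g z - g a"] this] show ?thesis
      by (simp add: algebra_simps)
  qed
  ultimately have "Ia - Iz = (g z - g a) + 0" by (rule tendsto_unique[rotated]) simp
  moreover have "contour_integral (linepath a z) f = g z - g a"
  proof -
    have "(f has_contour_integral (g (pathfinish (linepath a z))
        - g (pathstart (linepath a z)))) (linepath a z)"
      by (rule contour_integral_primitive[OF g]) (use az S(1) in \<open>auto simp: closed_segment_subset\<close>)
    thus ?thesis by (simp add: contour_integral_unique)
  qed
  ultimately have "Ia - Iz = contour_integral (linepath a z) f" by simp
  hence "Ia = contour_integral (linepath a z) f + Iz" by (simp only: diff_eq_eq)
  thus ?thesis unfolding Ia_def Iz_def .
qed

lemma integral_split_reflect:
  fixes h :: "real \<Rightarrow> complex"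
  assumes "set_integrable lborel {0..} h" "set_integrable lborel {0..} (\<lambda>u. h (- u))"
  shows "(LINT u|lborel. h u) = (LINT u:{0..}|lborel. h u) + (LINT u:{0..}|lborel. h (- u))"
proof -
  define q where "q = (\<lambda>u. indicator {0<..} u *\<^sub>R h (- u))"
  have "set_integrable lborel {0<..} (\<lambda>u. h (- u))"
    by (rule set_integrable_subset[OF assms(2)]) auto
  hence iq: "integrable lborel q" unfolding q_def set_integrable_def .
  have iq': "integrable lborel (\<lambda>u. q (0 + (- 1) * u))"
    by (rule lborel_integrable_real_affine[OF iq]) simp
  have i1: "integrable lborel (\<lambda>u. indicator {0..} u *\<^sub>R h u)" using assms(1)
    unfolding set_integrable_def .
  have i2: "integrable lborel (\<lambda>u. indicator {0..} u *\<^sub>R h (- u))" using assms(2)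
    unfolding set_integrable_def .
  have eq: "h u = indicator {0..} u *\<^sub>R h u + q (0 + (- 1) * u)" for u
    by (auto simp: q_def indicator_def)
  have "(LINT u|lborel. h u) = (LINT u|lborel. indicator {0..} u *\<^sub>R h u + q (0 + (- 1) * u))"
    using eq by simp
  also have "\<dots> = (LINT u|lborel. indicator {0..} u *\<^sub>R h u) + (LINT u|lborel. q (0 + (- 1) * u))"
    by (rule Bochner_Integration.integral_add[OF i1 iq'])
  also have "(LINT u|lborel. q (0 + (- 1) * u)) = (LINT u|lborel. q u)"
    using lborel_integral_real_affine[of "-1" q 0] by simp
  also have "\<dots> = (LINT u|lborel. indicator {0..} u *\<^sub>R h (- u))"
  proof (rule integral_cong_AE)
    show "AE u in lborel. q u = indicator {0..} u *\<^sub>R h (- u)"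
      using AE_lborel_singleton[of "0::real"]
      by eventually_elim (auto simp: q_def indicator_def)
  qed (use iq i2 borel_measurable_integrable in auto)
  finally show ?thesis unfolding set_lebesgue_integral_def .
qed

section \<open>Decay, differentiability and reflection of the integrand\<close>

lemma sine_kernel_minus: "sine_kernel (- x) = - sine_kernel x"
  unfolding sine_kernel_def by (simp add: minus_divide_right)

lemma aux_R_integrand_eq:
  "aux_R_integrand s x = - (x powr (- s) * exp (of_real pi * \<i> * x\<^sup>2) * sine_kernel x)"
proof -
  have "sine_kernel x = - (1 / (exp (of_real pi * \<i> * x) - exp (- (of_real pi * \<i> * x))))"
    unfolding sine_kernel_def by (metis minus_diff_eq minus_divide_right)
  thus ?thesis unfolding aux_R_integrand_def by simp
qed

lemma norm_powr_minus_le: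
  fixes x s :: complex
  assumes "norm x \<ge> 1"
  shows "norm (x powr (- s)) \<le> exp (norm s * (norm x + pi))"
proof -
  have x0: "x \<noteq> 0" using assms by auto
  have "norm (x powr (- s)) = exp (Re (- s * Ln x))" using x0 by (simp add: powr_def)
  also have "Re (- s * Ln x) \<le> norm s * norm (Ln x)"
    using complex_Re_le_cmod[of "- s * Ln x"] by (simp add: norm_mult)
  also have "norm (Ln x) \<le> norm x + pi"
  proof -
    have "norm (Ln x) \<le> \<bar>Re (Ln x)\<bar> + \<bar>Im (Ln x)\<bar>" by (rule cmod_le)
    moreover have "\<bar>Re (Ln x)\<bar> \<le> norm x"
      using assms x0 ln_le_minus_one[of "norm x"] by simp
    moreover have "\<bar>Im (Ln x)\<bar> \<le> pi" using mpi_less_Im_Ln[OF x0] Im_Ln_le_pi[OF x0] by simp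
    ultimately show ?thesis by linarith
  qed
  finally show ?thesis by (simp add: mult_left_mono)
qed

text \<open>On lines of direction cis (pi / 4) the product Re x Im x is close to r^2 / 2 at both
  ends, so |exp (pi i x^2)| decays like exp (-pi r^2) up to a factor exponential in |r|; the crude
  bound for the power is also only exponential in |r|. Uniformity in w covers the segments between
  parallel rays.\<close>

lemma aux_R_integrand_decay:
  "\<exists>C r0. \<forall>w r. norm w \<le> R \<longrightarrow> \<bar>r\<bar> \<ge> r0 \<longrightarrow>
     norm (aux_R_integrand s (w + of_real r * cis (pi / 4))) \<le> C * exp (- r\<^sup>2 / 2)"
proof -
  define R' where "R' = \<bar>R\<bar>"
  define K where "K = norm s + 4 * pi * R'"
  define C0 where "C0 = norm s * (R' + pi) + 2 * pi * R'\<^sup>2"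
  define h where "h = sqrt 2 / 2"
  have h: "h * h = 1 / 2" "h \<ge> 1 / 2" "h \<le> 1"
  proof -
    show "h * h = 1 / 2" by (simp add: h_def)
    have "1 \<le> sqrt 2" by simp
    thus "h \<ge> 1 / 2" by (simp add: h_def)
    have "sqrt 2 \<le> 2" by (rule real_le_lsqrt) auto
    thus "h \<le> 1" by (simp add: h_def)
  qed
  have R'0: "R' \<ge> 0" by (simp add: R'_def)
  have main: "norm (aux_R_integrand s (w + of_real r * cis (pi / 4)))
      \<le> 2 * exp (C0 + K\<^sup>2 / 2) * exp (- r\<^sup>2 / 2)"
    if w: "norm w \<le> R" and r: "\<bar>r\<bar> \<ge> 2 * (R' + 1)" for w r
  proof -
    define x where "x = w + of_real r * cis (pi / 4)"
    have w': "norm w \<le> R'" using w by (simp add: R'_def)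
    have wR: "\<bar>Re w\<bar> \<le> R'" "\<bar>Im w\<bar> \<le> R'" using abs_Re_le_cmod[of w] abs_Im_le_cmod[of w] w'
      by linarith+
    have re: "Re x = Re w + r * h" and im: "Im x = Im w + r * h"
      unfolding x_def h_def by (simp_all add: cos_45 sin_45)
    \<comment> \<open>The threshold 2 (R' + 1) for |r| forces |Im x| >= 1, away from the poles of
      the kernel.\<close>
    have "\<bar>r\<bar> * h \<ge> (2 * (R' + 1)) * (1 / 2)" using h r R'0 by (intro mult_mono) auto
    hence rh: "\<bar>r * h\<bar> \<ge> R' + 1" using h by (simp add: abs_mult)
    hence im1: "\<bar>Im x\<bar> \<ge> 1" unfolding im using wR by linarith
    have nx1: "norm x \<ge> 1" using abs_Im_le_cmod[of x] im1 by linarith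
    have nx: "norm x \<le> R' + \<bar>r\<bar>"
      unfolding x_def by (rule norm_triangle_le) (use w' in \<open>simp add: norm_mult\<close>)
    have p: "norm (x powr (- s)) \<le> exp (norm s * (R' + \<bar>r\<bar> + pi))"
      by (rule order.trans[OF norm_powr_minus_le[OF nx1]]) (use nx in \<open>simp add: mult_left_mono\<close>)
    have q: "norm (exp (of_real pi * \<i> * x\<^sup>2)) \<le> exp (2 * pi * R'\<^sup>2 + 4 * pi * R' * \<bar>r\<bar> - pi * r\<^sup>2)"
    proof -
      have "norm (exp (of_real pi * \<i> * x\<^sup>2)) = exp (- 2 * pi * (Re x * Im x))"
        by (simp add: power2_eq_square)
      also have "- (Re x * Im x) \<le> R'\<^sup>2 + 2 * R' * \<bar>r\<bar> - r\<^sup>2 / 2"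
      proof -
        have "Re x * Im x = Re w * Im w + (r * h) * (Re w + Im w) + r\<^sup>2 * (h * h)"
          unfolding re im by (simp add: power2_eq_square algebra_simps)
        moreover have "\<bar>Re w * Im w\<bar> \<le> R' * R'"
          unfolding abs_mult using wR R'0 by (intro mult_mono) auto
        moreover have "\<bar>(r * h) * (Re w + Im w)\<bar> \<le> (\<bar>r\<bar> * 1) * (2 * R')"
          unfolding abs_mult using wR R'0 h by (intro mult_mono) auto
        ultimately show ?thesis unfolding h(1) by (simp add: power2_eq_square) argo
      qed
      hence "2 * pi * (- (Re x * Im x)) \<le> 2 * pi * (R'\<^sup>2 + 2 * R' * \<bar>r\<bar> - r\<^sup>2 / 2)"
        by (intro mult_left_mono) auto
      hence "- 2 * pi * (Re x * Im x) \<le> 2 * pi * R'\<^sup>2 + 4 * pi * R' * \<bar>r\<bar> - pi * r\<^sup>2"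
        by (simp add: algebra_simps)
      finally show ?thesis by simp
    qed
    have k: "norm (sine_kernel x) \<le> 2"
    proof (cases "Im x \<ge> 1 / 4")
      case True
      have "exp (- (pi * Im x)) \<le> 1" using True by simp
      thus ?thesis using sine_kernel_bound(1)[OF True] by linarith
    next
      case False
      hence m: "Im (- x) \<ge> 1 / 4" using im1 by simp
      have "pi * Im (- x) \<ge> 0" by (rule mult_nonneg_nonneg) (use m in auto)
      hence "exp (- (pi * Im (- x))) \<le> 1" by simp
      hence "norm (sine_kernel (- x)) \<le> 2" using sine_kernel_bound(1)[OF m] by linarith
      thus ?thesis unfolding sine_kernel_minus by simp
    qed
    have "norm (aux_R_integrand s x) \<le> exp (norm s * (R' + \<bar>r\<bar> + pi)) *
        exp (2 * pi * R'\<^sup>2 + 4 * pi * R' * \<bar>r\<bar> - pi * r\<^sup>2) * 2"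
      unfolding aux_R_integrand_eq norm_minus_cancel norm_mult using p q k by (intro mult_mono) auto
    also have "\<dots> = 2 * exp (C0 + (K * \<bar>r\<bar> - pi * r\<^sup>2))"
      unfolding exp_add[symmetric] C0_def K_def by (simp add: algebra_simps)
    also have "K * \<bar>r\<bar> - pi * r\<^sup>2 \<le> K\<^sup>2 / 2 - r\<^sup>2 / 2"
    proof -
      have "2 * (K * \<bar>r\<bar>) \<le> K\<^sup>2 + r\<^sup>2" using zero_le_power2[of "K - \<bar>r\<bar>"]
        by (simp add: power2_eq_square algebra_simps)
      moreover have "1 * r\<^sup>2 \<le> pi * r\<^sup>2" using pi_gt3 by (intro mult_right_mono) auto
      ultimately show ?thesis by argo
    qed
    hence "2 * exp (C0 + (K * \<bar>r\<bar> - pi * r\<^sup>2)) \<le> 2 * exp ((C0 + K\<^sup>2 / 2) + - r\<^sup>2 / 2)" by simp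
    also have "\<dots> = 2 * exp (C0 + K\<^sup>2 / 2) * exp (- r\<^sup>2 / 2)" unfolding exp_add
      by (simp only: mult.assoc)
    finally show ?thesis unfolding x_def .
  qed
  show ?thesis
    by (rule exI[of _ "2 * exp (C0 + K\<^sup>2 / 2)"], rule exI[of _ "2 * (R' + 1)"]) (use main in blast)
qed

lemma sine_kernel_denominator_nonzero:
  assumes "Im x \<noteq> 0 \<or> Re x \<notin> \<int>"
  shows "exp (of_real pi * \<i> * x) - exp (- (of_real pi * \<i> * x)) \<noteq> 0"
proof
  assume "exp (of_real pi * \<i> * x) - exp (- (of_real pi * \<i> * x)) = 0"
  hence "exp (\<i> * (of_real pi * x)) - exp (- (\<i> * (of_real pi * x))) = 0" by (simp add: mult_ac)
  hence "sin (of_real pi * x) = 0" by (simp add: sin_exp_eq)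
  then obtain n :: int where "of_real pi * x = of_real (of_int n * pi)"
    unfolding sin_eq_0 by auto
  hence "x = of_int n" by (simp add: field_simps)
  thus False using assms by simp
qed

lemma aux_R_integrand_differentiable:
  assumes "Im x \<noteq> 0 \<or> 0 < Re x \<and> Re x < 1"
  shows "aux_R_integrand s field_differentiable at x"
proof -
  have "Re x \<notin> \<int>" if "0 < Re x" "Re x < 1"
    using that by (auto elim!: Ints_cases)
  hence "exp (of_real pi * \<i> * x) - exp (- (of_real pi * \<i> * x)) \<noteq> 0"
    using assms by (intro sine_kernel_denominator_nonzero) auto
  moreover have "x \<notin> \<real>\<^sub>\<le>\<^sub>0" using assms by (auto simp: complex_nonpos_Reals_iff)
  moreover have "x \<noteq> 0" using assms by auto
  moreover have "(\<lambda>x. x powr (- s)) field_differentiable at x"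
    using has_field_derivative_powr[OF \<open>x \<notin> \<real>\<^sub>\<le>\<^sub>0\<close>, of "- s"] unfolding field_differentiable_def
      by blast
  moreover have "(\<lambda>x. exp (of_real pi * \<i> * x\<^sup>2)) field_differentiable at x"
    "(\<lambda>x. exp (of_real pi * \<i> * x) - exp (- (of_real pi * \<i> * x))) field_differentiable at x"
    unfolding field_differentiable_def by (auto intro!: exI derivative_eq_intros)
  ultimately show ?thesis unfolding aux_R_integrand_def
    by (intro field_differentiable_divide field_differentiable_mult)
qed

text \<open>Above the real axis Ln (-y) = Ln y - i pi, which produces exp (i pi s), and the kernel
  is odd. At y = 0 both sides are 0 by division by zero, so rays starting at 0 are covered.\<close>

lemma aux_R_integrand_reflect:
  assumes "Im y > 0 \<or> y = 0"
  shows "aux_R_integrand s (- y) = - (exp (\<i> * of_real pi * s) * aux_R_integrand s y)"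
proof (cases "y = 0")
  case False
  hence "Ln (- y) = Ln y - \<i> * of_real pi" using assms Ln_minus[of y] by auto
  hence "(- y) powr (- s) = exp (- s * (Ln y - \<i> * of_real pi))"
    using False by (simp add: powr_def)
  also have "- s * (Ln y - \<i> * of_real pi) = - s * Ln y + \<i> * of_real pi * s"
    by (simp add: algebra_simps)
  also have "exp \<dots> = y powr (- s) * exp (\<i> * of_real pi * s)" using False unfolding exp_add powr_def
    by simp
  finally show ?thesis unfolding aux_R_integrand_eq sine_kernel_minus by simp
qed (simp add: aux_R_integrand_def)

subsection \<open>The auxiliary function as an integral over a ray\<close>

definition aux_ray :: "complex \<Rightarrow> complex \<Rightarrow> complex \<Rightarrow> complex" where
  "aux_ray s z d = (LINT r:{0..}|lborel. aux_R_integrand s (z + of_real r * d))"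

text \<open>For k = 1 or k = -1 an open half-plane with a real interval attached, so that it
  contains the crossing point together with the ray from it. For 0 <= l and u < 1 it meets neither
  the negative axis nor a pole at a nonzero integer.\<close>

definition slit_half_plane :: "real \<Rightarrow> real \<Rightarrow> real \<Rightarrow> complex set" where
  "slit_half_plane k l u = {x. k * Im x > 0 \<or> Im x = 0 \<and> l \<le> Re x \<and> Re x \<le> u}"

lemma convex_slit_half_plane: "convex (slit_half_plane k l u)"
proof (rule convexI)
  fix x y a b assume xy: "x \<in> slit_half_plane k l u" "y \<in> slit_half_plane k l u"
    and ab: "0 \<le> a" "0 \<le> b" "a + b = (1::real)"
  show "a *\<^sub>R x + b *\<^sub>R y \<in> slit_half_plane k l u"
  proof (cases "a = 0 \<or> b = 0")
    case True
    thus ?thesis using xy ab by auto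
  next
    case False
    hence ab': "a > 0" "b > 0" using ab by auto
    have im: "k * Im (a *\<^sub>R x + b *\<^sub>R y) = a * (k * Im x) + b * (k * Im y)"
      by (simp add: algebra_simps)
    have nn: "k * Im x \<ge> 0" "k * Im y \<ge> 0" using xy by (auto simp: slit_half_plane_def)
    show ?thesis
    proof (cases "k * Im x > 0 \<or> k * Im y > 0")
      case True
      hence "a * (k * Im x) + b * (k * Im y) > 0" using ab' nn
        by (auto intro: add_pos_nonneg add_nonneg_pos mult_pos_pos mult_nonneg_nonneg)
      thus ?thesis unfolding slit_half_plane_def using im by simp
    next
      case False
      hence z: "Im x = 0" "Im y = 0" "Re x \<in> {l..u}" "Re y \<in> {l..u}"
        using xy by (auto simp: slit_half_plane_def)
      have "a *\<^sub>R Re x + b *\<^sub>R Re y \<in> {l..u}"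
        using z ab by (intro convexD[OF convex_real_interval(5)]) auto
      thus ?thesis unfolding slit_half_plane_def using z by simp
    qed
  qed
qed

text \<open>The power is O(|x|^2) whatever the argument of x, against a simple zero of the sine. The
  limit 0 agrees with the value that division by zero gives at 0.\<close>

lemma isCont_aux_R_integrand_0:
  assumes "Re s \<le> - 2"
  shows "isCont (aux_R_integrand s) 0"
proof -
  define D where "D = (\<lambda>x. exp (of_real pi * \<i> * x) - exp (- (of_real pi * \<i> * x)))"
  define c where "c = exp (\<bar>Im s\<bar> * pi)"
  have "(D has_field_derivative 2 * of_real pi * \<i>) (at 0)"
    unfolding D_def by (auto intro!: derivative_eq_intros)
  hence "((\<lambda>x. D x / x) \<longlongrightarrow> 2 * of_real pi * \<i>) (at 0)"
    by (simp add: has_field_derivative_iff D_def)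
  hence l1: "((\<lambda>x. inverse (D x / x)) \<longlongrightarrow> inverse (2 * of_real pi * \<i>)) (at 0)"
    by (intro tendsto_inverse) auto
  have l2: "((\<lambda>x. exp (of_real pi * \<i> * x\<^sup>2)) \<longlongrightarrow> exp (of_real pi * \<i> * 0\<^sup>2)) (at (0::complex))"
    by (intro tendsto_intros)
  have l3: "((\<lambda>x. x powr (- s) / x) \<longlongrightarrow> 0) (at 0)"
  proof (rule Lim_null_comparison)
    have "\<forall>\<^sub>F x in at (0::complex). x \<in> ball 0 1 - {0}"
      by (rule eventually_at_in_open) auto
    thus "\<forall>\<^sub>F x in at 0. norm (x powr (- s) / x) \<le> c * norm x"
    proof eventually_elim
      case (elim x)
      hence x: "x \<noteq> 0" "norm x < 1" by auto
      have "norm (x powr (- s)) = exp (- Re s * ln (norm x) + Im s * Im (Ln x))"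
        using x by (simp add: powr_def)
      also have "\<dots> \<le> exp (2 * ln (norm x) + \<bar>Im s\<bar> * pi)"
      proof -
        have "(- Re s) * ln (norm x) \<le> 2 * ln (norm x)"
          using x assms by (intro mult_right_mono_neg) auto
        moreover have "Im s * Im (Ln x) \<le> \<bar>Im s\<bar> * pi"
        proof -
          have "\<bar>Im (Ln x)\<bar> \<le> pi" using mpi_less_Im_Ln[OF x(1)] Im_Ln_le_pi[OF x(1)] by simp
          hence "\<bar>Im s\<bar> * \<bar>Im (Ln x)\<bar> \<le> \<bar>Im s\<bar> * pi" by (intro mult_left_mono) auto
          thus ?thesis using abs_le_D1[of "Im s * Im (Ln x)"] by (simp add: abs_mult)
        qed
        ultimately show ?thesis by simp
      qed
      also have "\<dots> = norm x * norm x * c"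
        unfolding exp_add c_def using x by (simp add: exp_double power2_eq_square)
      finally have "norm (x powr (- s)) / norm x \<le> norm x * norm x * c / norm x"
        by (intro divide_right_mono) auto
      thus ?case using x by (simp add: norm_divide mult.commute)
    qed
    have "((\<lambda>x::complex. c * norm x) \<longlongrightarrow> c * norm (0::complex)) (at 0)"
      by (rule tendsto_mult[OF tendsto_const tendsto_norm[OF tendsto_ident_at]])
    thus "((\<lambda>x. c * norm x) \<longlongrightarrow> 0) (at (0::complex))" by simp
  qed
  have lim: "((\<lambda>x. (x powr (- s) / x) * exp (of_real pi * \<i> * x\<^sup>2) * inverse (D x / x)) \<longlongrightarrow>
      0 * exp (of_real pi * \<i> * 0\<^sup>2) * inverse (2 * of_real pi * \<i>)) (at 0)"
    by (intro tendsto_mult l1 l2 l3)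
  have cancel: "(p / x) * E * inverse (d / x) = p * E / d" if "x \<noteq> 0" for p E d x :: complex
    using that by (cases "d = 0") (auto simp: field_simps)
  have "\<forall>\<^sub>F x in at 0. (x powr (- s) / x) * exp (of_real pi * \<i> * x\<^sup>2) * inverse (D x / x)
      = aux_R_integrand s x"
    using eventually_neq_at_within[of 0 0 UNIV]
  proof eventually_elim
    case (elim x)
    show ?case unfolding aux_R_integrand_def D_def by (rule cancel[OF elim])
  qed
  from Lim_transform_eventually[OF lim this]
  have "(aux_R_integrand s \<longlongrightarrow> 0) (at 0)" by simp
  moreover have "aux_R_integrand s 0 = 0" by (simp add: aux_R_integrand_def)
  ultimately show ?thesis by (simp add: isCont_def)
qed

lemma aux_R_integrand_slit_half_plane:
  assumes "0 < l \<or> 0 \<le> l \<and> Re s \<le> - 2" "u < 1" "k \<noteq> 0"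
  shows "continuous_on (slit_half_plane k l u) (aux_R_integrand s)"
    and "\<And>x. x \<in> slit_half_plane k l u - {0} \<Longrightarrow> aux_R_integrand s field_differentiable at x"
proof -
  show d: "aux_R_integrand s field_differentiable at x" if "x \<in> slit_half_plane k l u - {0}" for x
  proof (rule aux_R_integrand_differentiable)
    show "Im x \<noteq> 0 \<or> 0 < Re x \<and> Re x < 1"
      using that assms by (auto simp: slit_half_plane_def complex_eq_iff)
  qed
  show "continuous_on (slit_half_plane k l u) (aux_R_integrand s)"
  proof (rule continuous_at_imp_continuous_on, rule ballI)
    fix x assume x: "x \<in> slit_half_plane k l u"
    show "isCont (aux_R_integrand s) x"
    proof (cases "x = 0")
      case True
      hence "Re s \<le> - 2" using x assms by (auto simp: slit_half_plane_def)
      thus ?thesis using True isCont_aux_R_integrand_0 by simp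
    next
      case False
      thus ?thesis using d x by (intro field_differentiable_imp_continuous_at) auto
    qed
  qed
qed

lemma slit_half_plane_ray:
  assumes "x \<in> slit_half_plane k l u" "k = 1 \<and> d = cis (pi / 4) \<or> k = - 1 \<and> d = - cis (pi / 4)" "r
      \<ge> 0"
  shows "x + of_real r * d \<in> slit_half_plane k l u"
proof (cases "r = 0")
  case False
  hence r: "r > 0" using assms by simp
  have "k * Im (x + of_real r * d) = k * Im x + r * (sqrt 2 / 2)"
    using assms(2) by (auto simp: cos_45 sin_45 algebra_simps)
  moreover have "k * Im x \<ge> 0" using assms(1) by (auto simp: slit_half_plane_def)
  ultimately have "k * Im (x + of_real r * d) > 0" using r by (simp add: add_nonneg_pos)
  thus ?thesis by (simp add: slit_half_plane_def)
qed (use assms in simp)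

lemma aux_ray_decay:
  assumes "d = cis (pi / 4) \<or> d = - cis (pi / 4)"
  shows "\<exists>C r0. \<forall>r x. r \<ge> r0 \<longrightarrow> x \<in> closed_segment a z \<longrightarrow>
     norm (aux_R_integrand s (x + of_real r * d)) \<le> C * exp (- r\<^sup>2 / 2)"
proof -
  obtain C r0 where C: "\<And>w r. norm w \<le> norm a + norm z \<Longrightarrow> \<bar>r\<bar> \<ge> r0 \<Longrightarrow>
     norm (aux_R_integrand s (w + of_real r * cis (pi / 4))) \<le> C * exp (- r\<^sup>2 / 2)"
    using aux_R_integrand_decay[of "norm a + norm z" s] by metis
  have "norm (aux_R_integrand s (x + of_real r * d)) \<le> C * exp (- r\<^sup>2 / 2)"
    if r: "r \<ge> max r0 0" and x: "x \<in> closed_segment a z" for r x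
  proof -
    obtain u where u: "0 \<le> u" "u \<le> 1" "x = (1 - u) *\<^sub>R a + u *\<^sub>R z" using x
      by (auto simp: in_segment)
    have "norm x \<le> (1 - u) * norm a + u * norm z"
      unfolding u(3) by (rule norm_triangle_le) (use u in simp)
    also have "\<dots> \<le> 1 * norm a + 1 * norm z" using u by (intro add_mono mult_right_mono) auto
    finally have nx: "norm x \<le> norm a + norm z" by simp
    show ?thesis using assms C[OF nx, of r] C[OF nx, of "- r"] r by auto
  qed
  thus ?thesis by blast
qed

lemma aux_ray_shift:
  assumes "0 < l \<or> 0 \<le> l \<and> Re s \<le> - 2" "u < 1"
    and kd: "k = 1 \<and> d = cis (pi / 4) \<or> k = - 1 \<and> d = - cis (pi / 4)"
    and az: "a \<in> slit_half_plane k l u" "z \<in> slit_half_plane k l u"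
  shows "d * aux_ray s a d = contour_integral (linepath a z) (aux_R_integrand s)
      + d * aux_ray s z d"
proof -
  have k0: "k \<noteq> 0" using kd by auto
  obtain C r0 where C: "\<And>r x. r \<ge> r0 \<Longrightarrow> x \<in> closed_segment a z \<Longrightarrow>
     norm (aux_R_integrand s (x + of_real r * d)) \<le> C * exp (- r\<^sup>2 / 2)"
    using aux_ray_decay[of d a z s] kd by metis
  \<comment> \<open>Differentiability can fail only at 0, which belongs to the set only if l =
    0.\<close>
  show ?thesis unfolding aux_ray_def
    by (rule ray_integral_shift[where K =
      "{0}", OF convex_slit_half_plane aux_R_integrand_slit_half_plane(1)[OF assms(1,2) k0] _
          aux_R_integrand_slit_half_plane(2)[OF assms(1,2) k0] slit_half_plane_ray[OF az(1) kd]
          slit_half_plane_ray[OF az(2) kd] C]) auto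
qed

lemma aux_ray_set_integrable:
  assumes "0 < l" "u < 1"
    and kd: "k = 1 \<and> d = cis (pi / 4) \<or> k = - 1 \<and> d = - cis (pi / 4)"
    and a: "a \<in> slit_half_plane k l u"
  shows "set_integrable lborel {0..} (\<lambda>r. aux_R_integrand s (a + of_real r * d))"
proof -
  have k0: "k \<noteq> 0" using kd by auto
  obtain C r0 where C: "\<And>r x. r \<ge> r0 \<Longrightarrow> x \<in> closed_segment a a \<Longrightarrow>
     norm (aux_R_integrand s (x + of_real r * d)) \<le> C * exp (- r\<^sup>2 / 2)"
    using aux_ray_decay[of d a a s] kd by metis
  have "continuous_on {0..} (\<lambda>r. aux_R_integrand s (a + of_real r * d))"
    by (rule continuous_on_compose2[OF aux_R_integrand_slit_half_plane(1)[of l s u k]])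
       (use assms k0 slit_half_plane_ray[OF a kd] in \<open>auto intro!: continuous_intros\<close>)
  thus ?thesis by (rule set_integrable_half_line_gaussian_decay) (use C in auto)
qed

text \<open>The line is cut at its crossing point. Its direction is -cis (pi / 4), so positive
  parameters run to the lower left and negative ones to the upper right.\<close>

lemma aux_R_eq_rays:
  assumes "0 < c" "c < 1"
  shows "aux_R c s = - cis (pi / 4) * aux_ray s (of_real c) (- cis (pi / 4))
     - cis (pi / 4) * aux_ray s (of_real c) (cis (pi / 4))"
proof -
  define e where "e = cis (pi / 4)"
  define h where "h = (\<lambda>u. aux_R_integrand s (of_real c + of_real u * (- e)))"
  have om: "exp (- (3 * of_real pi * \<i> / 4)) = - e"
  proof -
    have "exp (- (3 * of_real pi * \<i> / 4)) = cis (pi / 4 + - pi)"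
      unfolding cis_conv_exp by (rule arg_cong[of _ _ exp]) (simp add: field_simps)
    also have "\<dots> = - e" unfolding cis_mult[symmetric] e_def by (simp add: complex_eq_iff)
    finally show ?thesis .
  qed
  have cS: "of_real c \<in> slit_half_plane k c c" for k by (simp add: slit_half_plane_def)
  have i1: "set_integrable lborel {0..} h"
    unfolding h_def by (rule aux_ray_set_integrable[OF assms _ cS[of "- 1"]]) (simp add: e_def)
  have i2: "set_integrable lborel {0..} (\<lambda>u. h (- u))"
    using aux_ray_set_integrable[OF assms _ cS[of 1], of "e" s] by (simp add: e_def h_def)
  have "aux_R c s = (LINT u|lborel. h u * (- e))"
    unfolding aux_R_def Let_def om h_def ..
  also have "\<dots> = (LINT u|lborel. h u) * (- e)" by simp
  also have "(LINT u|lborel. h u) = aux_ray s (of_real c) (- e) + aux_ray s (of_real c) e"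
    using integral_split_reflect[OF i1 i2] unfolding aux_ray_def h_def by simp
  also have "(aux_ray s (of_real c) (- e) + aux_ray s (of_real c) e) * (- e) =
     - e * aux_ray s (of_real c) (- e) - e * aux_ray s (of_real c) e" by (simp add: algebra_simps)
  finally show ?thesis unfolding e_def .
qed

lemma aux_ray_reflect:
  assumes "Im z > 0 \<or> z = 0"
  shows "aux_ray s (- z) (- cis (pi / 4))
      = - (exp (\<i> * of_real pi * s) * aux_ray s z (cis (pi / 4)))"
proof -
  have "(LINT r:{0..}|lborel. aux_R_integrand s (- z + of_real r * (- cis (pi / 4)))) =
     (LINT r:{0..}|lborel. - exp (\<i> * of_real pi * s) * aux_R_integrand s (z + of_real r * cis (pi /
       4)))"
  proof (rule set_lebesgue_integral_cong)
    show "\<forall>r. r \<in> {0..} \<longrightarrow> aux_R_integrand s (- z + of_real r * (- cis (pi / 4))) =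
       - exp (\<i> * of_real pi * s) * aux_R_integrand s (z + of_real r * cis (pi / 4))"
    proof (intro allI impI)
      fix r :: real assume r: "r \<in> {0..}"
      have "Im (z + of_real r * cis (pi / 4)) > 0 \<or> z + of_real r * cis (pi / 4) = 0"
      proof (cases "r = 0")
        case False
        have "Im (z + of_real r * cis (pi / 4)) = Im z + r * (sqrt 2 / 2)" by (simp add: sin_45)
        moreover have "r * (sqrt 2 / 2) > 0" using r False by simp
        moreover have "Im z \<ge> 0" using assms by auto
        ultimately have "Im (z + of_real r * cis (pi / 4)) > 0" by linarith
        thus ?thesis ..
      qed (use assms in auto)
      from aux_R_integrand_reflect[OF this, of s]
      show "aux_R_integrand s (- z + of_real r * (- cis (pi / 4))) =
       - exp (\<i> * of_real pi * s) * aux_R_integrand s (z + of_real r * cis (pi / 4))" by simp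
    qed
  qed simp
  also have "\<dots> = - exp (\<i> * of_real pi * s)
      * (LINT r:{0..}|lborel. aux_R_integrand s (z + of_real r * cis (pi / 4)))"
    by (rule set_integral_mult_right)
  finally show ?thesis unfolding aux_ray_def by (simp only: mult_minus_left)
qed

text \<open>Moving both rays from c to 0 produces the same integral over the real segment with
  opposite signs. At 0 the rays are mirror images, so the reflection formula splits off the factor
  exactly; only then is the upper ray moved to z.\<close>

lemma aux_R_far_left:
  assumes "Re s \<le> - 2" "0 < c" "c < 1" "Im z > 0"
  shows "aux_R c s = (exp (\<i> * of_real pi * s) - 1) *
     (contour_integral (linepath 0 z) (aux_R_integrand s) + cis (pi / 4) * aux_ray s z (cis (pi /
       4)))"
proof -
  define e where "e = cis (pi / 4)"
  define CI where "CI = contour_integral (linepath (of_real c) 0) (aux_R_integrand s)"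
  have mem: "of_real c \<in> slit_half_plane k 0 c" "0 \<in> slit_half_plane k 0 c" for k
    using assms by (auto simp: slit_half_plane_def)
  have zm: "z \<in> slit_half_plane 1 0 c" using assms by (simp add: slit_half_plane_def)
  have l: "0 < (0::real) \<or> 0 \<le> (0::real) \<and> Re s \<le> - 2" using assms by simp
  have a: "- e * aux_ray s (of_real c) (- e) = CI + - e * aux_ray s 0 (- e)"
    unfolding CI_def e_def by (rule aux_ray_shift[OF l assms(3) _ mem[of "-1"]]) simp
  have b: "e * aux_ray s (of_real c) e = CI + e * aux_ray s 0 e"
    unfolding CI_def e_def by (rule aux_ray_shift[OF l assms(3) _ mem[of 1]]) simp
  have c: "e * aux_ray s 0 e = contour_integral (linepath 0 z) (aux_R_integrand s)
      + e * aux_ray s z e"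
    unfolding e_def by (rule aux_ray_shift[OF l assms(3) _ mem(2)[of 1] zm]) simp
  have d: "aux_ray s 0 (- e) = - (exp (\<i> * of_real pi * s) * aux_ray s 0 e)"
    using aux_ray_reflect[of 0 s] by (simp add: e_def)
  have "aux_R c s = - e * aux_ray s 0 (- e) - e * aux_ray s 0 e"
    unfolding aux_R_eq_rays[OF assms(2,3)] e_def[symmetric] a b by simp
  also have "\<dots> = (exp (\<i> * of_real pi * s) - 1) * (e * aux_ray s 0 e)"
    unfolding d by (simp add: algebra_simps)
  finally show ?thesis unfolding c unfolding e_def .
qed

text \<open>Without a bound on Re s the integrand may be singular at 0. The pivot is therefore 1/2,
  midway between two integers, at the price of two segments that do not combine.\<close>

lemma aux_R_via_half:
  assumes "0 < c" "c < 1" "Im z > 0"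
  shows "aux_R c s = (exp (\<i> * of_real pi * s) - 1) * (cis (pi / 4) * aux_ray s z (cis (pi / 4))) +
     contour_integral (linepath (1 / 2) (- z)) (aux_R_integrand s) -
     contour_integral (linepath (1 / 2) z) (aux_R_integrand s)"
proof -
  define e where "e = cis (pi / 4)"
  define l u where "l = min c (1 / 2)" and "u = max c (1 / 2)"
  define CI where "CI = contour_integral (linepath (of_real c) (1 / 2)) (aux_R_integrand s)"
  have lu: "0 < l \<or> 0 \<le> l \<and> Re s \<le> - 2" "u < 1" using assms by (auto simp: l_def u_def)
  have mem: "of_real c \<in> slit_half_plane k l u" "1 / 2 \<in> slit_half_plane k l u" for k
    using assms by (auto simp: slit_half_plane_def l_def u_def)
  have zm: "z \<in> slit_half_plane 1 l u" "- z \<in> slit_half_plane (- 1) l u"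
    using assms by (auto simp: slit_half_plane_def)
  have a: "- e * aux_ray s (of_real c) (- e) = CI + - e * aux_ray s (1 / 2) (- e)"
    unfolding CI_def e_def by (rule aux_ray_shift[OF lu _ mem[of "-1"]]) simp
  have a': "- e * aux_ray s (1 / 2) (- e)
      = contour_integral (linepath (1 / 2) (- z)) (aux_R_integrand s) + - e * aux_ray s (- z) (- e)"
    unfolding e_def by (rule aux_ray_shift[OF lu _ mem(2)[of "-1"] zm(2)]) simp
  have b: "e * aux_ray s (of_real c) e = CI + e * aux_ray s (1 / 2) e"
    unfolding CI_def e_def by (rule aux_ray_shift[OF lu _ mem[of 1]]) simp
  have b': "e * aux_ray s (1 / 2) e
      = contour_integral (linepath (1 / 2) z) (aux_R_integrand s) + e * aux_ray s z e"
    unfolding e_def by (rule aux_ray_shift[OF lu _ mem(2)[of 1] zm(1)]) simp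
  have d: "aux_ray s (- z) (- e) = - (exp (\<i> * of_real pi * s) * aux_ray s z e)"
    unfolding e_def by (rule aux_ray_reflect) (use assms in simp)
  show ?thesis
    unfolding aux_R_eq_rays[OF assms(1,2)] e_def[symmetric] a a' b b' d by (simp add: algebra_simps)
qed

lemma aux_ray_saddle_line:
  "aux_ray s (saddle_line \<eta> (- y0)) (cis (pi / 4))
      = (LINT y:{- y0..}|lborel. aux_R_integrand s (saddle_line \<eta> y))"
proof -
  have "(LINT y:{- y0..}|lborel. aux_R_integrand s (saddle_line \<eta> y)) =
     (LINT r|lborel. indicator {- y0..} (- y0 + 1 * r) *\<^sub>R aux_R_integrand s (saddle_line \<eta> (- y0 +
       1 * r)))"
    unfolding set_lebesgue_integral_def
    using lborel_integral_real_affine[of 1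
      "\<lambda>y. indicator {- y0..} y *\<^sub>R aux_R_integrand s (saddle_line \<eta> y)" "- y0"] by simp
  also have "\<dots> = aux_ray s (saddle_line \<eta> (- y0)) (cis (pi / 4))"
    unfolding aux_ray_def set_lebesgue_integral_def
    by (rule Bochner_Integration.integral_cong) (auto simp: indicator_def saddle_line_def
      algebra_simps)
  finally show ?thesis by simp
qed

subsection \<open>The segments below the saddle point\<close>

lemma sine_kernel_eq_sin: "norm (sine_kernel x) = 1 / (2 * norm (sin (of_real pi * x)))"
proof -
  have "sin (of_real pi * x) = - (exp (- (of_real pi * \<i> * x))
      - exp (of_real pi * \<i> * x)) / (2 * \<i>)"
    unfolding sin_exp_eq by (simp add: mult_ac)
  hence "norm (sin (of_real pi * x))
      = norm (exp (- (of_real pi * \<i> * x)) - exp (of_real pi * \<i> * x)) / 2"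
    unfolding norm_divide norm_minus_cancel by (simp add: norm_mult norm_minus_commute)
  thus ?thesis unfolding sine_kernel_def norm_divide by simp
qed

text \<open>This is sinh v >= v. The bound holds down to the real axis, as required on a segment
  that starts at 0.\<close>

lemma sine_kernel_le_inverse_Im:
  assumes "Im x > 0"
  shows "norm (sine_kernel x) \<le> 1 / (2 * pi * Im x)"
proof -
  define v where "v = pi * Im x"
  have v: "v > 0" using assms by (simp add: v_def)
  have "norm (exp (- (of_real pi * \<i> * x))) - norm (exp (of_real pi * \<i> * x)) \<le>
      norm (exp (- (of_real pi * \<i> * x)) - exp (of_real pi * \<i> * x))"
    by (rule norm_triangle_ineq2)
  moreover have "norm (exp (- (of_real pi * \<i> * x))) = exp v" "norm (exp (of_real pi * \<i> * x))
      = exp (- v)"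
    unfolding norm_exp_eq_Re v_def by simp_all
  moreover have "2 * v \<le> exp v - exp (- v)"
  proof -
    have "(\<lambda>v. exp v - exp (- v) - 2 * v) 0 \<le> (\<lambda>v. exp v - exp (- v) - 2 * v) v"
    proof (rule DERIV_nonneg_imp_nondecreasing[of 0 v])
      fix t :: real
      have "((\<lambda>v. exp v - exp (- v) - 2 * v) has_real_derivative exp t + exp (- t) - 2) (at t)"
        by (auto intro!: derivative_eq_intros)
      moreover have "exp t + exp (- t) - 2 \<ge> 0"
        using zero_le_power2[of "exp t - 1"] by (simp add: exp_minus field_simps power2_eq_square)
      ultimately show "\<exists>y. ((\<lambda>v. exp v - exp (- v) - 2 * v) has_real_derivative y) (at t) \<and> 0 \<le> y"
        by blast
    qed (use v in simp)
    thus ?thesis by simp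
  qed
  ultimately have "2 * v \<le> norm (exp (- (of_real pi * \<i> * x)) - exp (of_real pi * \<i> * x))"
    by linarith
  hence "norm (sine_kernel x) \<le> 1 / (2 * v)"
    unfolding sine_kernel_def norm_divide norm_one using v by (intro frac_le) auto
  thus ?thesis by (simp add: v_def mult_ac)
qed

text \<open>4 |sin (pi x)|^2 = 2 cosh (2 pi Im x) - 2 cos (2 pi Re x), which is at least 2 if the
  cosine is not positive.\<close>

lemma sine_kernel_le_one:
  assumes "cos (2 * (pi * Re x)) \<le> 0"
  shows "norm (sine_kernel x) \<le> 1"
proof -
  define u where "u = exp (2 * Im (of_real pi * x))"
  have u: "u > 0" by (simp add: u_def)
  have "2 \<le> u + inverse u"
    using u zero_le_power2[of "u - 1"] by (simp add: field_simps power2_eq_square)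
  moreover have "(norm (sin (of_real pi * x)))\<^sup>2 = (u + inverse u - 2 * cos (2 * (pi * Re x))) / 4"
    unfolding norm_sin_squared u_def by simp
  ultimately have "(1 / 2)\<^sup>2 \<le> (norm (sin (of_real pi * x)))\<^sup>2" using assms
    by (simp add: power2_eq_square)
  hence "1 / 2 \<le> norm (sin (of_real pi * x))" by (rule power2_le_imp_le) simp
  hence "1 \<le> 2 * norm (sin (of_real pi * x))" by simp
  thus ?thesis unfolding sine_kernel_eq_sin using frac_le[of 1 1 1] by simp
qed

text \<open>The logarithm of |1 / f(x)|.\<close>

definition saddle_height :: "complex \<Rightarrow> complex \<Rightarrow> real" where
  "saddle_height s x = (1 - Re s) * ln (norm x) + Im s * Im (Ln x) - 2 * pi * (Re x * Im x)"

lemma norm_aux_R_integrand_saddle: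
  assumes "x \<noteq> 0" "\<eta> \<noteq> 0"
  shows "norm (aux_R_integrand s x) * norm (saddle_monomial s \<eta> * \<eta>) =
     norm \<eta> / norm x * exp (saddle_height s x - saddle_height s \<eta>) * norm (sine_kernel x)"
proof -
  have "Re (- ((s - 1) * (Ln x - Ln \<eta>)) + of_real pi * \<i> * (x\<^sup>2 - \<eta>\<^sup>2))
      = saddle_height s x - saddle_height s \<eta>"
    using assms by (simp add: saddle_height_def power2_eq_square algebra_simps)
  thus ?thesis
    using arg_cong[OF aux_R_integrand_saddle[OF assms, of s], of norm]
    unfolding norm_minus_cancel norm_mult norm_divide norm_exp_eq_Re by simp
qed

definition saddle_base :: "complex \<Rightarrow> complex" where
  "saddle_base \<eta> = saddle_line \<eta> (- (Im \<eta> * (sqrt 2 / 2)))"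

lemma Re_Im_saddle_base: "Re (saddle_base \<eta>) = Re \<eta> - Im \<eta> / 2" "Im (saddle_base \<eta>) = Im \<eta> / 2"
  unfolding saddle_base_def Re_Im_saddle_line by simp_all

text \<open>The decay of the phase at the lower end of the ray, where y^2 = (Im \<eta>)^2 /
  2.\<close>

lemma saddle_height_base:
  assumes "s - 1 = 2 * of_real pi * \<i> * \<eta>\<^sup>2" "Re \<eta> > 0" "Im \<eta> > 0"
  shows "saddle_height s (saddle_base \<eta>) - saddle_height s \<eta> \<le> - (pi * (Im \<eta>)\<^sup>2 / 2)"
proof -
  define y where "y = - (Im \<eta> * (sqrt 2 / 2))"
  have x0: "saddle_base \<eta> \<noteq> 0" "\<eta> \<noteq> 0" using assms Re_Im_saddle_base[of \<eta>] by auto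
  have "Re (saddle_phase s \<eta> y) \<le> - pi * y\<^sup>2"
    by (rule Re_saddle_phase_le[OF assms]) (simp add: y_def)
  moreover have "Re (saddle_phase s \<eta> y) = saddle_height s (saddle_base \<eta>) - saddle_height s \<eta>"
    using x0 unfolding saddle_phase_def saddle_base_def y_def[symmetric] saddle_height_def
    by (simp add: power2_eq_square algebra_simps)
  moreover have "y\<^sup>2 = (Im \<eta>)\<^sup>2 / 2" by (simp add: y_def power_mult_distrib power_divide)
  ultimately show ?thesis by simp
qed

lemma norm_saddle_base_le: "norm (saddle_base \<eta>) \<le> 2 * norm \<eta>"
proof -
  have "norm (saddle_base \<eta>) \<le> norm \<eta> + \<bar>Im \<eta>\<bar> * (sqrt 2 / 2)"
    unfolding saddle_base_def saddle_line_def by (rule norm_triangle_le) (simp add: norm_mult)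
  also have "\<bar>Im \<eta>\<bar> * (sqrt 2 / 2) \<le> norm \<eta> * 1"
    using abs_Im_le_cmod[of \<eta>] real_le_lsqrt[of 2 2] by (intro mult_mono) auto
  finally show ?thesis by simp
qed

text \<open>Along the ray from \<open>0\<close> the height increases, so the segment is dominated by its endpoint.\<close>

lemma contour_integral_far_left:
  assumes s: "s - 1 = 2 * of_real pi * \<i> * \<eta>\<^sup>2" and pos: "Re \<eta> > 0" "Im \<eta> \<ge> 1" and s5: "Re s \<le> - 5"
  shows "norm (contour_integral (linepath 0 (saddle_base \<eta>)) (aux_R_integrand s)) *
    norm (saddle_monomial s \<eta> * \<eta>) \<le> norm \<eta> * exp (- (pi * (Im \<eta>)\<^sup>2 / 2))"
proof -
  define x0 where "x0 = saddle_base \<eta>"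
  define m where "m = norm (saddle_monomial s \<eta> * \<eta>)"
  define a b where "a = Re x0" and "b = Im x0"
  define A where "A = 1 - Re s"
  have e2: "Im \<eta> > 0" and eta0: "\<eta> \<noteq> 0" using pos by auto
  have ab: "a = Re \<eta> - Im \<eta> / 2" "b = Im \<eta> / 2" unfolding a_def b_def x0_def Re_Im_saddle_base
    by simp_all
  have b0: "b > 0" using e2 ab by simp
  have x0n: "x0 \<noteq> 0" using b0 by (auto simp: b_def)
  have nx0: "norm x0 > 0" using x0n by simp
  have A6: "A \<ge> 6" using s5 by (simp add: A_def)
  have m0: "m > 0" unfolding m_def using eta0 by (auto simp: saddle_monomial_def powr_def)
  have AE: "A = 4 * pi * Re \<eta> * Im \<eta>" unfolding A_def by (rule saddle_coordinates(1)[OF s])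
  \<comment> \<open>With 1 - u^2 <= -2 ln u, the bound A / 4 lets the Gaussian term use up only half
    of the term A ln u.\<close>
  have abA: "2 * pi * (a * b) \<le> A / 4"
  proof -
    have "a * b \<le> Re \<eta> * (Im \<eta> / 2)" unfolding ab using e2 by (intro mult_right_mono) auto
    hence "2 * pi * (a * b) \<le> 2 * pi * (Re \<eta> * (Im \<eta> / 2))" by (intro mult_left_mono) auto
    thus ?thesis unfolding AE by simp
  qed
  define M where "M = norm \<eta> * exp (- (pi * (Im \<eta>)\<^sup>2 / 2)) / (norm x0 * m)"
  have M0: "M \<ge> 0" using m0 by (simp add: M_def)
  have le: "norm (aux_R_integrand s x) \<le> M" if x: "x \<in> closed_segment 0 x0" for x
  proof (cases "x = 0")
    case True
    thus ?thesis using M0 by (simp add: aux_R_integrand_def)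
  next
    case False
    obtain u where u: "0 \<le> u" "u \<le> 1" "x = u *\<^sub>R x0" using x by (auto simp: in_segment)
    hence u0: "u > 0" using False by (cases "u = 0") auto
    have lnu: "ln u \<le> 0" using u u0 by simp
    have Lnx: "Ln x = of_real (ln u) + Ln x0"
      unfolding u(3) scaleR_conv_of_real using Ln_times_of_real[OF u0 x0n] u0
        by (simp add: Ln_of_real)
    have "saddle_height s x = A * (ln u + ln (norm x0)) + Im s * Im (Ln x0)
        - 2 * pi * (u\<^sup>2 * (a * b))"
      unfolding saddle_height_def Lnx A_def using u u0 x0n
      by (simp add: ln_mult a_def b_def power2_eq_square mult_ac)
    hence "saddle_height s x = saddle_height s x0 + A * ln u + (2 * pi * (a * b)) * (1 - u\<^sup>2)"
      unfolding saddle_height_def a_def[symmetric] b_def[symmetric] A_def[symmetric]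
        by (simp add: algebra_simps)
    also have "(2 * pi * (a * b)) * (1 - u\<^sup>2) \<le> (A / 4) * (1 - u\<^sup>2)"
      using u by (intro mult_right_mono abA) (auto simp: power_le_one)
    also have "(A / 4) * (1 - u\<^sup>2) \<le> (A / 4) * (- 2 * ln u)"
    proof (intro mult_left_mono)
      have "ln (u\<^sup>2) \<le> u\<^sup>2 - 1" using u0 by (intro ln_le_minus_one) auto
      thus "1 - u\<^sup>2 \<le> - 2 * ln u" using u0 by (simp add: ln_realpow)
    qed (use A6 in auto)
    finally have "saddle_height s x \<le> saddle_height s x0 + (A / 2) * ln u"
      by (simp add: algebra_simps)
    \<comment> \<open>The bound Re s <= -5 is used here: u^3 absorbs 1 / u from 1 / |x| and another
      1 / u from the kernel.\<close>
    also have "(A / 2) * ln u \<le> 3 * ln u" using A6 lnu by (intro mult_right_mono_neg) auto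
    finally have "saddle_height s x - saddle_height s \<eta> \<le> 3 * ln u + - (pi * (Im \<eta>)\<^sup>2 / 2)"
      using saddle_height_base[OF s pos(1) e2] unfolding x0_def by linarith
    hence "exp (saddle_height s x - saddle_height s \<eta>) \<le> exp (3 * ln u + - (pi * (Im \<eta>)\<^sup>2 / 2))"
      by simp
    also have "exp (3 * ln u) = u ^ 3" using exp_of_nat_mult[of 3 "ln u"] u0 by simp
    hence "exp (3 * ln u + - (pi * (Im \<eta>)\<^sup>2 / 2)) = u ^ 3 * exp (- (pi * (Im \<eta>)\<^sup>2 / 2))"
      unfolding exp_add by simp
    finally have E: "exp (saddle_height s x - saddle_height s \<eta>)
        \<le> u ^ 3 * exp (- (pi * (Im \<eta>)\<^sup>2 / 2))" .
    have imx: "Im x = u * b" unfolding u(3) b_def by simp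
    have K: "norm (sine_kernel x) \<le> 1 / u"
    proof -
      have "norm (sine_kernel x) \<le> 1 / (2 * pi * Im x)"
        by (rule sine_kernel_le_inverse_Im) (use imx u0 b0 in simp)
      also have "\<dots> \<le> 1 / u"
      proof (rule divide_left_mono)
        have "1 * 1 \<le> pi * Im \<eta>" using pi_gt3 pos by (intro mult_mono) auto
        hence "u * 1 \<le> u * (pi * Im \<eta>)" using u0 by (intro mult_left_mono) auto
        thus "u \<le> 2 * pi * Im x" unfolding imx ab by (simp add: mult_ac)
      qed (use u0 imx b0 in auto)
      finally show ?thesis .
    qed
    have "norm (aux_R_integrand s x) * m
        = norm \<eta> / norm x * exp (saddle_height s x - saddle_height s \<eta>) * norm (sine_kernel x)"
      unfolding m_def by (rule norm_aux_R_integrand_saddle[OF False eta0])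
    also have "\<dots> \<le> norm \<eta> / norm x * (u ^ 3 * exp (- (pi * (Im \<eta>)\<^sup>2 / 2))) * (1 / u)"
      using E K u0 by (intro mult_mono mult_left_mono) auto
    also have "norm x = u * norm x0" unfolding u(3) using u0 by simp
    also have "norm \<eta> / (u * norm x0) * (u ^ 3 * exp (- (pi * (Im \<eta>)\<^sup>2 / 2))) * (1 / u) =
       u * (norm \<eta> / norm x0 * exp (- (pi * (Im \<eta>)\<^sup>2 / 2)))"
      using u0 nx0 by (simp add: power3_eq_cube field_simps)
    also have "\<dots> \<le> 1 * (norm \<eta> / norm x0 * exp (- (pi * (Im \<eta>)\<^sup>2 / 2)))" using u
      by (intro mult_right_mono) auto
    also have "\<dots> = M * m" using m0 by (simp add: M_def)
    finally show ?thesis using m0 by simp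
  qed
  have S: "0 \<in> slit_half_plane 1 0 0" "x0 \<in> slit_half_plane 1 0 0" using b0
    by (auto simp: slit_half_plane_def b_def)
  have "continuous_on (closed_segment 0 x0) (aux_R_integrand s)"
    by (rule continuous_on_subset[OF aux_R_integrand_slit_half_plane(1)[of 0 s 0 1]])
       (use s5 S closed_segment_subset[OF S convex_slit_half_plane] in auto)
  hence "norm (contour_integral (linepath 0 x0) (aux_R_integrand s)) \<le> M * norm (x0 - 0)"
    by (intro contour_integral_bound_linepath contour_integrable_continuous_linepath M0 le)
  hence "norm (contour_integral (linepath 0 x0) (aux_R_integrand s)) * m \<le> M * norm (x0 - 0) * m"
    using m0 by (intro mult_right_mono) auto
  also have "\<dots> = norm \<eta> * exp (- (pi * (Im \<eta>)\<^sup>2 / 2))" unfolding M_def using m0 nx0 by simp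
  finally show ?thesis unfolding x0_def m_def .
qed

text \<open>Both arguments lie in (0, pi), so the sign of the sine of their difference decides their
  order.\<close>

lemma Im_Ln_mono:
  assumes "Im x > 0" "Im y > 0" "Im (y * cnj x) \<ge> 0"
  shows "Im (Ln x) \<le> Im (Ln y)"
proof (rule ccontr)
  assume "\<not> ?thesis"
  hence lt: "Im (Ln y) < Im (Ln x)" by simp
  have x0: "x \<noteq> 0" "y \<noteq> 0" using assms by auto
  have bd: "0 < Im (Ln x)" "Im (Ln x) < pi" "0 < Im (Ln y)" "Im (Ln y) < pi"
    using Im_Ln_pos_lt[of x] Im_Ln_pos_lt[of y] assms x0 by auto
  have "y * cnj x = exp (Ln y) * cnj (exp (Ln x))" using x0 by simp
  also have "\<dots> = exp (Ln y + cnj (Ln x))" by (simp add: exp_add exp_cnj)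
  finally have "Im (y * cnj x) = exp (Re (Ln y + cnj (Ln x))) * sin (Im (Ln y) - Im (Ln x))"
    by (simp add: Im_exp)
  moreover have "sin (Im (Ln y) - Im (Ln x)) < 0"
    using sin_gt_zero[of "Im (Ln x) - Im (Ln y)"] lt bd sin_minus[of "Im (Ln x) - Im (Ln y)"]
      by simp
  ultimately show False using assms(3) by (simp add: mult_less_0_iff flip: not_less)
qed

lemma saddle_height_le:
  assumes "Re s \<le> 1" "y \<noteq> 0" "norm y \<le> norm x"
    "Im s * Im (Ln y) \<le> Im s * Im (Ln x) + d" "- (Re y * Im y) \<le> - (Re x * Im x)"
  shows "saddle_height s y \<le> saddle_height s x + d"
proof -
  have "ln (norm y) \<le> ln (norm x)" using assms
    by (subst ln_le_cancel_iff) (auto intro: less_le_trans[of 0 "norm y"])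
  hence "(1 - Re s) * ln (norm y) \<le> (1 - Re s) * ln (norm x)" using assms
    by (intro mult_left_mono) auto
  moreover have "2 * pi * (- (Re y * Im y)) \<le> 2 * pi * (- (Re x * Im x))" using assms
    by (intro mult_left_mono) auto
  ultimately show ?thesis using assms(4) unfolding saddle_height_def by linarith
qed

lemma norm_exp_pi_s: "norm (exp (\<i> * of_real pi * s)) = exp (- (pi * Im s))"
  by simp

lemma cos_nonpos_near_half:
  assumes "\<bar>\<bar>x\<bar> - 1 / 2\<bar> \<le> 1 / 4"
  shows "cos (2 * (pi * x)) \<le> 0"
proof -
  have x: "1 / 4 \<le> \<bar>x\<bar>" "\<bar>x\<bar> \<le> 3 / 4" using assms by linarith+
  have "cos (2 * (pi * \<bar>x\<bar>) - pi) \<ge> 0"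
  proof (rule cos_ge_zero)
    have "pi * (1 / 4) \<le> pi * \<bar>x\<bar>" "pi * \<bar>x\<bar> \<le> pi * (3 / 4)" using x
      by (intro mult_left_mono; simp)+
    thus "- (pi / 2) \<le> 2 * (pi * \<bar>x\<bar>) - pi" "2 * (pi * \<bar>x\<bar>) - pi \<le> pi / 2" by argo+
  qed
  moreover have "cos (2 * (pi * x)) = cos (2 * (pi * \<bar>x\<bar>))" by (cases "x \<ge> 0") auto
  moreover have "cos (2 * (pi * \<bar>x\<bar>)) = - cos (2 * (pi * \<bar>x\<bar>) - pi)" by (simp add: cos_diff)
  ultimately show ?thesis by linarith
qed

text \<open>For segments from 1/2 or -1/2: either the real part is still far from the integers, or
  the point is already high enough.\<close>

lemma sine_kernel_le_two:
  assumes "\<bar>\<bar>Re x\<bar> - 1 / 2\<bar> \<le> 1 / 4 \<or> Im x \<ge> 1 / 8"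
  shows "norm (sine_kernel x) \<le> 2"
  using assms
proof
  assume "\<bar>\<bar>Re x\<bar> - 1 / 2\<bar> \<le> 1 / 4"
  from sine_kernel_le_one[OF cos_nonpos_near_half[OF this]] show ?thesis by simp
next
  assume im: "Im x \<ge> 1 / 8"
  have "norm (sine_kernel x) \<le> 1 / (2 * pi * Im x)" using im
    by (intro sine_kernel_le_inverse_Im) simp
  also have "\<dots> \<le> 1 / (1 / 2)"
  proof (rule divide_left_mono)
    have "2 * 3 * (1 / 8) \<le> 2 * pi * Im x" using im pi_gt3 by (intro mult_mono) auto
    thus "1 / 2 \<le> 2 * pi * Im x" by simp
  qed (use im in auto)
  finally show ?thesis by simp
qed

section \<open>The case Re s > -5, where Im s is large and negative\<close>

context
  fixes s \<eta> :: complex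
  assumes s: "s - 1 = 2 * of_real pi * \<i> * \<eta>\<^sup>2" and pos: "Re \<eta> > 0" "Im \<eta> > 0"
    and s5: "Re s > - 5" and t30: "Im s < - 30"
begin

text \<open>Here Re \<eta> Im \<eta> < 1/2 and Im \<eta> > 2, so \<eta> is close to the imaginary
  axis and the base point lies well inside the second quadrant.\<close>

lemma saddle_base_upper_left:
  "Re (saddle_base \<eta>) \<le> - 1 / 2" "Im (saddle_base \<eta>) \<ge> 1" "- Re (saddle_base \<eta>)
      \<le> Im (saddle_base \<eta>)"
  "Re s \<le> 1"
proof -
  define a b where "a = Re \<eta>" and "b = Im \<eta>"
  have ab: "a > 0" "b > 0" using pos by (auto simp: a_def b_def)
  note sc = saddle_coordinates[OF s, folded a_def b_def]
  have ab0: "a * b > 0" using ab by simp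
  have "1 - Re s = 4 * pi * (a * b)" using sc(1) by simp
  thus "Re s \<le> 1" using ab0 by (smt (verit) mult_pos_pos pi_gt_zero)
  have "4 * pi * (a * b) < 6" using sc(1) s5 by simp
  moreover have "4 * 3 * (a * b) \<le> 4 * pi * (a * b)" using pi_gt3 ab0
    by (intro mult_right_mono) auto
  ultimately have p: "a * b < 1 / 2" by simp
  have "b\<^sup>2 > 4"
  proof (rule ccontr)
    assume "\<not> ?thesis"
    hence "a\<^sup>2 - b\<^sup>2 \<ge> - 4" using zero_le_power2[of a] by linarith
    hence "2 * pi * (a\<^sup>2 - b\<^sup>2) \<ge> 2 * pi * (- 4)" by (intro mult_left_mono) auto
    moreover have "2 * pi * (- 4) \<ge> - 30" using pi_approx by simp
    ultimately show False using sc(2) t30 by simp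
  qed
  hence b2: "b > 2" using ab by (intro power2_less_imp_less[of 2 b]) auto
  have "a * 2 \<le> a * b" using ab b2 by (intro mult_left_mono) auto
  hence a4: "a < 1 / 4" using p by simp
  show "Re (saddle_base \<eta>) \<le> - 1 / 2" "Im (saddle_base \<eta>) \<ge> 1" "- Re (saddle_base \<eta>)
      \<le> Im (saddle_base \<eta>)"
    unfolding Re_Im_saddle_base a_def[symmetric] b_def[symmetric] using a4 b2 ab by argo+
qed

text \<open>The terms of the height are compared one by one with those at the base point; d is the
  loss allowed in the argument term. The 16 is 8 for 1 / |y| times 2 for the kernel.\<close>

lemma norm_aux_R_integrand_dominated:
  assumes "\<bar>\<bar>Re y\<bar> - 1 / 2\<bar> \<le> 1 / 4 \<or> Im y \<ge> 1 / 8" "norm y \<le> norm (saddle_base \<eta>)"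
    "Im s * Im (Ln y) \<le> Im s * Im (Ln (saddle_base \<eta>)) + d"
    "- (Re y * Im y) \<le> - (Re (saddle_base \<eta>) * Im (saddle_base \<eta>))"
  shows "norm (aux_R_integrand s y) * norm (saddle_monomial s \<eta> * \<eta>) \<le>
    16 * norm \<eta> * (exp d * exp (- (pi * (Im \<eta>)\<^sup>2 / 2)))"
proof -
  have eta0: "\<eta> \<noteq> 0" using pos by auto
  have ny: "norm y \<ge> 1 / 8" using assms(1) abs_Re_le_cmod[of y] abs_Im_le_cmod[of y] by linarith
  hence y0: "y \<noteq> 0" by auto
  have "saddle_height s y \<le> saddle_height s (saddle_base \<eta>) + d"
    by (rule saddle_height_le[OF saddle_base_upper_left(4) y0 assms(2-4)])
  hence "saddle_height s y - saddle_height s \<eta> \<le> d + - (pi * (Im \<eta>)\<^sup>2 / 2)"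
    using saddle_height_base[OF s pos] by linarith
  hence E: "exp (saddle_height s y - saddle_height s \<eta>) \<le> exp d * exp (- (pi * (Im \<eta>)\<^sup>2 / 2))"
    unfolding exp_add[symmetric] by simp
  have "norm \<eta> / norm y \<le> norm \<eta> / (1 / 8)" using ny y0 by (intro divide_left_mono) auto
  hence N: "norm \<eta> / norm y \<le> 8 * norm \<eta>" by simp
  have "norm (aux_R_integrand s y) * norm (saddle_monomial s \<eta> * \<eta>) =
     norm \<eta> / norm y * exp (saddle_height s y - saddle_height s \<eta>) * norm (sine_kernel y)"
    by (rule norm_aux_R_integrand_saddle[OF y0 eta0])
  also have "\<dots> \<le> (8 * norm \<eta>) * (exp d * exp (- (pi * (Im \<eta>)\<^sup>2 / 2))) * 2"
    using N E sine_kernel_le_two[OF assms(1)] by (intro mult_mono) auto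
  finally show ?thesis by (simp add: mult_ac)
qed

lemma norm_segment_le_saddle_base:
  assumes "x = (1 - u) *\<^sub>R v + u *\<^sub>R saddle_base \<eta>" "norm v \<le> 1 / 2" "0 \<le> u" "u \<le> 1"
  shows "norm x \<le> norm (saddle_base \<eta>)"
proof -
  have "norm v \<le> norm (saddle_base \<eta>)"
    using assms(2) saddle_base_upper_left(2) abs_Im_le_cmod[of "saddle_base \<eta>"] by linarith
  hence "(1 - u) * norm v \<le> (1 - u) * norm (saddle_base \<eta>)" using assms
    by (intro mult_left_mono) auto
  moreover have "norm x \<le> (1 - u) * norm v + u * norm (saddle_base \<eta>)"
    unfolding assms(1) by (rule norm_triangle_le) (use assms in simp)
  ultimately show ?thesis by (simp add: algebra_simps)
qed

text \<open>The argument starts at 0, so up to pi |Im s| is lost against the base point. This is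
  affordable: it is the size of exp (pi i s), which later divides the segments.\<close>

lemma norm_aux_R_integrand_from_half:
  assumes "x \<in> closed_segment (1 / 2) (saddle_base \<eta>)"
  shows "norm (aux_R_integrand s x) * norm (saddle_monomial s \<eta> * \<eta>) \<le>
    16 * norm \<eta> * (exp (- (pi * Im s)) * exp (- (pi * (Im \<eta>)\<^sup>2 / 2)))"
proof (rule norm_aux_R_integrand_dominated)
  define a b where "a = Re (saddle_base \<eta>)" and "b = Im (saddle_base \<eta>)"
  note ab = saddle_base_upper_left[folded a_def b_def]
  obtain u where u: "0 \<le> u" "u \<le> 1" "x = (1 - u) *\<^sub>R (1 / 2) + u *\<^sub>R saddle_base \<eta>"
    using assms by (auto simp: in_segment)
  have re: "Re x = 1 / 2 - u * (1 / 2 - a)" and im: "Im x = u * b"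
    unfolding u(3) by (simp_all add: a_def b_def algebra_simps)
  have ux: "0 \<le> u * (1 / 2 - a)" "u * (1 / 2 - a) \<le> 1 * (1 / 2 - a)"
    using u ab by (simp, intro mult_right_mono) auto
  have imb: "0 \<le> Im x" "Im x \<le> b" using u ab unfolding im by (auto intro: mult_left_le_one_le)
  show dich: "\<bar>\<bar>Re x\<bar> - 1 / 2\<bar> \<le> 1 / 4 \<or> Im x \<ge> 1 / 8"
  proof (cases "u * (1 / 2 - a) \<le> 1 / 4")
    case True
    hence "Re x \<ge> 1 / 4" "Re x \<le> 1 / 2" using ux unfolding re by linarith+
    thus ?thesis by linarith
  next
    case False
    \<comment> \<open>Since 1/2 <= b and -a <= b, a horizontal displacement above 1/4 forces a
      height above 1/8.\<close>
    have "u * (1 / 2 - a) \<le> u * (2 * b)" using u ab by (intro mult_left_mono) auto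
    thus ?thesis using False unfolding im by simp
  qed
  hence x0: "x \<noteq> 0" by auto
  have xb0: "saddle_base \<eta> \<noteq> 0" using ab(2) by (auto simp: b_def)
  show "norm x \<le> norm (saddle_base \<eta>)"
    by (rule norm_segment_le_saddle_base[OF u(3) _ u(1,2)]) (simp add: norm_divide)
  have "Im (Ln x) \<ge> 0" using Im_Ln_eq_0 imb x0 Im_Ln_pos_le by blast
  hence "Im s * Im (Ln x) \<le> 0" using t30 by (intro mult_nonpos_nonneg) auto
  moreover have "(- Im s) * Im (Ln (saddle_base \<eta>)) \<le> (- Im s) * pi"
    using t30 Im_Ln_le_pi[OF xb0] by (intro mult_left_mono) auto
  ultimately show "Im s * Im (Ln x) \<le> Im s * Im (Ln (saddle_base \<eta>)) + (- (pi * Im s))"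
    by (simp add: mult.commute)
  have "(- Re x) * Im x \<le> (- a) * Im x" using imb ux unfolding re by (intro mult_right_mono) auto
  also have "\<dots> \<le> (- a) * b" using imb ab by (intro mult_left_mono) auto
  finally show "- (Re x * Im x) \<le> - (Re (saddle_base \<eta>) * Im (saddle_base \<eta>))"
    by (simp add: a_def b_def)
qed

text \<open>Reflection to y = -x costs the factor |exp (pi i s)|. The reflected segment from -1/2
  has arguments at least that of the base point, so with Im s < 0 nothing more is lost and d =
  0.\<close>

lemma norm_aux_R_integrand_from_half_lower:
  assumes "x \<in> closed_segment (1 / 2) (- saddle_base \<eta>)"
  shows "norm (aux_R_integrand s x) * norm (saddle_monomial s \<eta> * \<eta>) \<le>
    16 * norm \<eta> * (exp (- (pi * Im s)) * exp (- (pi * (Im \<eta>)\<^sup>2 / 2)))"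
proof -
  define a b where "a = Re (saddle_base \<eta>)" and "b = Im (saddle_base \<eta>)"
  note ab = saddle_base_upper_left[folded a_def b_def]
  obtain u where u: "0 \<le> u" "u \<le> 1" "x = (1 - u) *\<^sub>R (1 / 2) + u *\<^sub>R (- saddle_base \<eta>)"
    using assms by (auto simp: in_segment)
  show ?thesis
  \<comment> \<open>The reflection formula asks for Im y > 0, so the real endpoint 1/2 is treated as
    a point of the upper segment.\<close>
  proof (cases "u = 0")
    case True
    hence "x = 1 / 2" using u(3) by simp
    hence "x \<in> closed_segment (1 / 2) (saddle_base \<eta>)" by (simp only: ends_in_segment)
    thus ?thesis by (rule norm_aux_R_integrand_from_half)
  next
    case False
    hence u0: "u > 0" using u by simp
    define y where "y = - x"
    have yu: "y = (1 - u) *\<^sub>R (- 1 / 2) + u *\<^sub>R saddle_base \<eta>" unfolding y_def u(3)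
      by (simp add: algebra_simps)
    have re: "Re y = - 1 / 2 - u * (- a - 1 / 2)" and im: "Im y = u * b"
      unfolding yu by (simp_all add: a_def b_def algebra_simps)
    have imp: "Im y > 0" unfolding im using u0 ab by simp
    have imb: "Im y \<le> b" unfolding im using u ab by (intro mult_left_le_one_le) auto
    have c0: "0 \<le> - a - 1 / 2" using ab by simp
    have ux: "0 \<le> u * (- a - 1 / 2)" "u * (- a - 1 / 2) \<le> 1 * (- a - 1 / 2)"
      by (rule mult_nonneg_nonneg[OF u(1) c0], rule mult_right_mono[OF u(2) c0])
    have reb: "Re y \<le> - 1 / 2" "- Re y \<le> - a" using ux unfolding re mult_1 by argo+
    have "norm (aux_R_integrand s y) * norm (saddle_monomial s \<eta> * \<eta>) \<le>
      16 * norm \<eta> * (exp 0 * exp (- (pi * (Im \<eta>)\<^sup>2 / 2)))"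
    proof (rule norm_aux_R_integrand_dominated)
      show "\<bar>\<bar>Re y\<bar> - 1 / 2\<bar> \<le> 1 / 4 \<or> Im y \<ge> 1 / 8"
      proof (cases "Im y \<ge> 1 / 8")
        case False
        have "u * (- a - 1 / 2) \<le> u * b" using u ab by (intro mult_left_mono) auto
        hence w: "u * (- a - 1 / 2) \<le> 1 / 8" using False unfolding im by simp
        have "Re y \<le> - 1 / 2" "Re y \<ge> - 5 / 8" using ux(1) w unfolding re by argo+
        thus ?thesis by linarith
      qed simp
      show "norm y \<le> norm (saddle_base \<eta>)"
        by (rule norm_segment_le_saddle_base[OF yu _ u(1,2)]) (simp add: norm_divide)
      have "Im (y * cnj (saddle_base \<eta>)) = (1 - u) * (b / 2)"
        unfolding times_complex.sel complex_cnj re im by (simp add: a_def b_def algebra_simps)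
      also have "\<dots> \<ge> 0" using u ab by simp
      finally have "Im (Ln (saddle_base \<eta>)) \<le> Im (Ln y)"
        using imp ab by (intro Im_Ln_mono) (auto simp: b_def)
      hence "Im s * Im (Ln y) \<le> Im s * Im (Ln (saddle_base \<eta>))" using t30
        by (intro mult_left_mono_neg) auto
      thus "Im s * Im (Ln y) \<le> Im s * Im (Ln (saddle_base \<eta>)) + 0" by simp
      have "(- Re y) * Im y \<le> (- a) * Im y" using imp reb by (intro mult_right_mono) auto
      also have "\<dots> \<le> (- a) * b" using imb ab by (intro mult_left_mono) auto
      finally show "- (Re y * Im y) \<le> - (Re (saddle_base \<eta>) * Im (saddle_base \<eta>))"
        by (simp add: a_def b_def)
    qed
    hence "exp (- (pi * Im s)) * (norm (aux_R_integrand s y) * norm (saddle_monomial s \<eta> * \<eta>)) \<le>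
      exp (- (pi * Im s)) * (16 * norm \<eta> * (exp 0 * exp (- (pi * (Im \<eta>)\<^sup>2 / 2))))"
      by (intro mult_left_mono) auto
    moreover have "norm (aux_R_integrand s x) = exp (- (pi * Im s)) * norm (aux_R_integrand s y)"
      using aux_R_integrand_reflect[of y s] imp unfolding y_def minus_minus
      by (simp only: norm_minus_cancel norm_mult norm_exp_pi_s simp_thms)
    ultimately show ?thesis by (simp add: mult_ac)
  qed
qed

text \<open>Each segment has length at most 3 |\<eta>|, which gives 2 * 3 * 16 = 96. As Im s < -30,
  |exp (pi i s)| is at most 2 |exp (pi i s) - 1|, which gives 192.\<close>

lemma contour_integrals_from_half:
  "norm (contour_integral (linepath (1 / 2) (- saddle_base \<eta>)) (aux_R_integrand s) -
     contour_integral (linepath (1 / 2) (saddle_base \<eta>)) (aux_R_integrand s)) * norm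
       (saddle_monomial s \<eta> * \<eta>) \<le>
   200 * (norm \<eta>)\<^sup>2 * (norm (exp (\<i> * of_real pi * s) - 1) * exp (- (pi * (Im \<eta>)\<^sup>2 / 2)))"
proof -
  define x0 where "x0 = saddle_base \<eta>"
  define m where "m = norm (saddle_monomial s \<eta> * \<eta>)"
  define Q where "Q = exp (- (pi * (Im \<eta>)\<^sup>2 / 2))"
  define B where "B = 16 * norm \<eta> * (exp (- (pi * Im s)) * Q) / m"
  note ab = saddle_base_upper_left[folded x0_def]
  have eta0: "\<eta> \<noteq> 0" using pos by auto
  have m0: "m > 0" unfolding m_def using eta0 by (auto simp: saddle_monomial_def powr_def)
  have B0: "B \<ge> 0" using m0 by (simp add: B_def Q_def)
  have n1: "norm \<eta> \<ge> 1"
    using ab(2) abs_Im_le_cmod[of \<eta>] pos unfolding x0_def Re_Im_saddle_base by linarith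
  have len: "norm (x0 - 1 / 2) \<le> 3 * norm \<eta>" "norm (- x0 - 1 / 2) \<le> 3 * norm \<eta>"
  proof -
    have "norm (x0 - 1 / 2) \<le> norm x0 + 1 / 2" "norm (- x0 - 1 / 2) \<le> norm x0 + 1 / 2"
      using norm_triangle_ineq4[of x0 "1 / 2"] norm_triangle_ineq4[of "- x0" "1 / 2"]
        by (simp_all add: norm_divide)
    thus "norm (x0 - 1 / 2) \<le> 3 * norm \<eta>" "norm (- x0 - 1 / 2) \<le> 3 * norm \<eta>"
      using norm_saddle_base_le[of \<eta>] n1 unfolding x0_def by linarith+
  qed
  have bound: "norm (contour_integral (linepath (1 / 2) w) (aux_R_integrand s)) \<le> B * (3 * norm \<eta>)"
    if w: "k * Im w > 0" "k \<noteq> 0" "norm (w - 1 / 2) \<le> 3 * norm \<eta>"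
      "\<And>x. x \<in> closed_segment (1 / 2) w \<Longrightarrow> norm (aux_R_integrand s x) * m \<le> B * m" for w k
  proof -
    have S: "1 / 2 \<in> slit_half_plane k (1 / 2) (1 / 2)" "w \<in> slit_half_plane k (1 / 2) (1 / 2)"
      using w(1) by (auto simp: slit_half_plane_def)
    have "continuous_on (closed_segment (1 / 2) w) (aux_R_integrand s)"
      by (rule continuous_on_subset[OF aux_R_integrand_slit_half_plane(1)[of "1 / 2" s "1 / 2" k]])
         (use w(2) closed_segment_subset[OF S convex_slit_half_plane] in auto)
    hence "norm (contour_integral (linepath (1 / 2) w) (aux_R_integrand s)) \<le> B * norm (w - 1 / 2)"
      using w(4) m0
        by (intro contour_integral_bound_linepath contour_integrable_continuous_linepath B0) auto
    also have "\<dots> \<le> B * (3 * norm \<eta>)" using w(3) B0 by (intro mult_left_mono) auto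
    finally show ?thesis .
  qed
  have Bm: "B * m = 16 * norm \<eta> * (exp (- (pi * Im s)) * Q)" using m0 by (simp add: B_def)
  have lo: "norm (contour_integral (linepath (1 / 2) (- x0)) (aux_R_integrand s))
      \<le> B * (3 * norm \<eta>)"
  proof (rule bound[of "- 1"])
    show "norm (aux_R_integrand s x) * m \<le> B * m" if "x \<in> closed_segment (1 / 2) (- x0)" for x
      unfolding Bm unfolding m_def Q_def
        by (rule norm_aux_R_integrand_from_half_lower[OF that[unfolded x0_def]])
    show "(- 1) * Im (- x0) > 0" using ab(2) by simp
  qed (simp, rule len(2))
  have up: "norm (contour_integral (linepath (1 / 2) x0) (aux_R_integrand s)) \<le> B * (3 * norm \<eta>)"
  proof (rule bound[of 1])
    show "norm (aux_R_integrand s x) * m \<le> B * m" if "x \<in> closed_segment (1 / 2) x0" for x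
      unfolding Bm unfolding m_def Q_def
        by (rule norm_aux_R_integrand_from_half[OF that[unfolded x0_def]])
    show "1 * Im x0 > 0" using ab(2) by simp
  qed (simp, rule len(1))
  have "norm (contour_integral (linepath (1 / 2) (- x0)) (aux_R_integrand s) -
     contour_integral (linepath (1 / 2) x0) (aux_R_integrand s)) \<le> B * (3 * norm \<eta>) + B * (3 * norm
       \<eta>)"
    by (rule norm_triangle_le_diff[OF add_mono[OF lo up]])
  hence "norm (contour_integral (linepath (1 / 2) (- x0)) (aux_R_integrand s) -
     contour_integral (linepath (1 / 2) x0) (aux_R_integrand s)) * m \<le> (B * (3 * norm \<eta>) + B * (3 *
       norm \<eta>)) * m"
    using m0 by (intro mult_right_mono) auto
  also have "\<dots> = (B * m) * (6 * norm \<eta>)" by (simp add: algebra_simps)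
  also have "\<dots> = 96 * (norm \<eta>)\<^sup>2 * (exp (- (pi * Im s)) * Q)" unfolding Bm
    by (simp add: power2_eq_square)
  also have "\<dots> \<le> 96 * (norm \<eta>)\<^sup>2 * ((2 * norm (exp (\<i> * of_real pi * s) - 1)) * Q)"
  proof (intro mult_left_mono mult_right_mono)
    have "3 * 30 \<le> pi * (- Im s)" using pi_gt3 t30 by (intro mult_mono) auto
    hence "2 \<le> 1 + - (pi * Im s)" by simp
    hence "2 \<le> exp (- (pi * Im s))" using exp_ge_add_one_self order.trans by blast
    moreover have "norm (exp (\<i> * of_real pi * s)) - norm (1::complex)
        \<le> norm (exp (\<i> * of_real pi * s) - 1)"
      by (rule norm_triangle_ineq2)
    ultimately show "exp (- (pi * Im s)) \<le> 2 * norm (exp (\<i> * of_real pi * s) - 1)"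
      unfolding norm_exp_pi_s norm_one by linarith
  qed (auto simp: Q_def)
  also have "\<dots> = 192 * ((norm \<eta>)\<^sup>2 * (norm (exp (\<i> * of_real pi * s) - 1) * Q))" by simp
  also have "\<dots> \<le> 200 * ((norm \<eta>)\<^sup>2 * (norm (exp (\<i> * of_real pi * s) - 1) * Q))"
    by (intro mult_right_mono) (auto simp: Q_def)
  finally show ?thesis unfolding x0_def m_def Q_def by (simp only: mult.assoc)
qed

end

subsection \<open>The asymptotic formula\<close>

text \<open>The third hypothesis gives n^3 <= exp (3 (x^2 + 3) / 4), and 3/4 < pi / 2 leaves enough
  quadratic decay to dominate pi x.\<close>

lemma cube_exp_quadratic_bound:
  fixes x n :: real
  assumes "x \<ge> 1" "n > 0" "n \<le> exp ((x\<^sup>2 + 3) / 4)"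
  shows "n\<^sup>2 * exp (- (pi * x\<^sup>2 / 2)) \<le> exp 8 * exp (- pi * x) / n"
proof -
  have "n ^ 3 \<le> exp ((x\<^sup>2 + 3) / 4) ^ 3" using assms by (intro power_mono) auto
  also have "\<dots> = exp (3 * ((x\<^sup>2 + 3) / 4))" using exp_of_nat_mult[of 3 "(x\<^sup>2 + 3) / 4"] by simp
  finally have "n ^ 3 * exp (- (pi * x\<^sup>2 / 2)) \<le> exp (3 * ((x\<^sup>2 + 3) / 4)) * exp (- (pi * x\<^sup>2 / 2))"
    by (intro mult_right_mono) auto
  also have "\<dots> = exp (3 * ((x\<^sup>2 + 3) / 4) + - (pi * x\<^sup>2 / 2))" unfolding exp_add ..
  also have "\<dots> \<le> exp (8 + - pi * x)"
  proof -
    have "pi * x\<^sup>2 \<ge> (31 / 10) * x\<^sup>2" using pi_approx by (intro mult_right_mono) auto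
    moreover have "pi * x \<le> 4 * x" using pi_less_4 assms by (intro mult_right_mono) auto
    moreover have "4 * x \<le> (8 / 10) * x\<^sup>2 + 5"
      using zero_le_power2[of "x - 5 / 2"] by (simp add: power2_eq_square algebra_simps)
    moreover have "- pi * x = - (pi * x)" by simp
    ultimately have "3 * ((x\<^sup>2 + 3) / 4) + - (pi * x\<^sup>2 / 2) \<le> 8 + - pi * x" by argo
    thus ?thesis by simp
  qed
  finally have "n ^ 3 * exp (- (pi * x\<^sup>2 / 2)) / n \<le> exp (8 + - pi * x) / n"
    using assms by (intro divide_right_mono) auto
  moreover have "n ^ 3 * exp (- (pi * x\<^sup>2 / 2)) / n = n\<^sup>2 * exp (- (pi * x\<^sup>2 / 2))"
    using assms by (simp add: power3_eq_cube power2_eq_square)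
  ultimately show ?thesis unfolding exp_add by simp
qed

text \<open>The first two terms come from the saddle ray, the third from the segments below
  it.\<close>

definition saddle_constant :: real where
  "saddle_constant = 18000 * exp 2 + 7 * exp 4 + 200 * exp 8"

text \<open>The common target of both sides: the main term of the kernel integrated against the
  Gaussian, and (-1)^m / (2 i) times the cosine part of \<open>G_bar\<close>.\<close>

definition saddle_limit :: "complex \<Rightarrow> complex" where
  "saddle_limit \<eta> = of_real (1 / sqrt 2) * cis (- pi / 8) * mordell_main (exp (of_real pi * \<i> * \<eta>))"

text \<open>The form with X unites both ranges of Re s. For Re s <= -5 the factor splits off
  exactly, even where it vanishes; otherwise it is nonzero, and the segments divided by it become
  part of X.\<close>

lemma aux_R_asymptotic:
  assumes N: "s \<in> region_N" and c: "0 < c" "c < 1"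
  defines "\<eta> \<equiv> eta s"
  obtains X where "aux_R c s = (exp (\<i> * of_real pi * s) - 1) * X"
    "norm (X * (saddle_monomial s \<eta> * \<eta>) + cis (pi / 4) * saddle_limit \<eta>) \<le>
       saddle_constant * exp (- pi * Im \<eta>) / norm \<eta>"
proof -
  have R1: "Re s < 1" using N by (auto simp: region_N_def)
  note b = eta_basic[OF R1, folded \<eta>_def]
  note rN = region_N_eta[OF N, folded \<eta>_def]
  define e where "e = cis (pi / 4)"
  define m where "m = saddle_monomial s \<eta> * \<eta>"
  define E where "E = exp (\<i> * of_real pi * s)"
  define Q where "Q = aux_ray s (saddle_base \<eta>) e"
  define q where "q = exp (- (pi * (Im \<eta>)\<^sup>2 / 2))"
  have e2: "Im \<eta> \<ge> 1" using rN(2) b(3) by (intro power2_le_imp_le[of 1]) auto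
  have n1: "norm \<eta> \<ge> 1" using e2 abs_Im_le_cmod[of \<eta>] by linarith
  have n0: "norm \<eta> > 0" using n1 by linarith
  have zb: "Im (saddle_base \<eta>) > 0" unfolding Re_Im_saddle_base using b(3) by simp
  have Qb: "norm (Q * m + saddle_limit \<eta>)
      \<le> (18000 * exp 2 + 7 * exp 4) * exp (- pi * Im \<eta>) / norm \<eta>"
    unfolding Q_def saddle_base_def e_def aux_ray_saddle_line m_def saddle_limit_def
    by (rule saddle_ray_integral[OF b(1,2) e2 rN(3)])
  have qb: "(norm \<eta>)\<^sup>2 * q \<le> exp 8 * exp (- pi * Im \<eta>) / norm \<eta>"
    unfolding q_def by (rule cube_exp_quadratic_bound[OF e2 n0 norm_le_exp_quarter[OF rN(3)]])
  have *: "norm ((Y + e * Q) * m + e * saddle_limit \<eta>)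
      \<le> saddle_constant * exp (- pi * Im \<eta>) / norm \<eta>"
    if Y: "norm Y * norm m \<le> 200 * ((norm \<eta>)\<^sup>2 * q)" for Y
  proof -
    have "(Y + e * Q) * m + e * saddle_limit \<eta> = e * (Q * m + saddle_limit \<eta>) + Y * m"
      by (simp add: algebra_simps)
    hence "norm ((Y + e * Q) * m + e * saddle_limit \<eta>)
        \<le> norm (e * (Q * m + saddle_limit \<eta>)) + norm (Y * m)"
      by (simp only: norm_triangle_ineq)
    also have "\<dots> = norm (Q * m + saddle_limit \<eta>) + norm Y * norm m" by (simp add: norm_mult e_def)
    also have "\<dots> \<le> (18000 * exp 2 + 7 * exp 4) * exp (- pi * Im \<eta>) / norm \<eta>
        + 200 * (exp 8 * exp (- pi * Im \<eta>) / norm \<eta>)"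
      using Qb Y qb by (intro add_mono) auto
    also have "\<dots> = saddle_constant * exp (- pi * Im \<eta>) / norm \<eta>"
      unfolding saddle_constant_def by (simp add: add_divide_distrib ring_distribs)
    finally show ?thesis .
  qed
  show ?thesis
  proof (cases "Re s \<le> - 5")
    case True
    define Y where "Y = contour_integral (linepath 0 (saddle_base \<eta>)) (aux_R_integrand s)"
    have "norm Y * norm m \<le> norm \<eta> * q"
      unfolding Y_def m_def q_def by (rule contour_integral_far_left[OF b(1,2) e2 True])
    also have "\<dots> \<le> 200 * ((norm \<eta>)\<^sup>2 * q)"
    proof -
      have "norm \<eta> * 1 \<le> norm \<eta> * norm \<eta>" using n1 by (intro mult_left_mono) auto
      also have "\<dots> \<le> 200 * (norm \<eta>)\<^sup>2" by (simp add: power2_eq_square)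
      finally have "norm \<eta> * q \<le> 200 * (norm \<eta>)\<^sup>2 * q" by (intro mult_right_mono) (auto simp: q_def)
      thus ?thesis by simp
    qed
    finally have Yb: "norm Y * norm m \<le> 200 * ((norm \<eta>)\<^sup>2 * q)" .
    have "aux_R c s = (E - 1) * (Y + e * Q)"
      unfolding Y_def Q_def E_def e_def by (rule aux_R_far_left[OF _ c zb]) (use True in simp)
    from that[OF this[unfolded E_def e_def] *[OF Yb, unfolded m_def e_def]] show ?thesis .
  next
    case False
    hence s5: "Re s > - 5" by simp
    have t30: "Im s < - 30" by (rule rN(4)[OF s5])
    define Z where "Z = contour_integral (linepath (1 / 2) (- saddle_base \<eta>)) (aux_R_integrand s) -
      contour_integral (linepath (1 / 2) (saddle_base \<eta>)) (aux_R_integrand s)"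
    have "3 * 30 \<le> pi * (- Im s)" using pi_gt3 t30 by (intro mult_mono) auto
    hence "norm E \<noteq> 1" unfolding E_def norm_exp_pi_s exp_eq_one_iff by linarith
    hence E1: "E - 1 \<noteq> 0" by auto
    hence nE: "norm (E - 1) > 0" by simp
    have Zb: "norm Z * norm m \<le> 200 * (norm \<eta>)\<^sup>2 * (norm (E - 1) * q)"
      unfolding Z_def m_def E_def q_def by (rule contour_integrals_from_half[OF b(1,2,3) s5 t30])
    have "norm (Z / (E - 1)) * norm m = norm Z * norm m / norm (E - 1)" by (simp add: norm_divide)
    also have "\<dots> \<le> 200 * (norm \<eta>)\<^sup>2 * (norm (E - 1) * q) / norm (E - 1)"
      using Zb by (intro divide_right_mono) auto
    also have "\<dots> = 200 * ((norm \<eta>)\<^sup>2 * q)" using nE by (simp add: field_simps)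
    finally have Yb: "norm (Z / (E - 1)) * norm m \<le> 200 * ((norm \<eta>)\<^sup>2 * q)" .
    have "aux_R c s = (E - 1) * (e * Q) + Z"
      unfolding aux_R_via_half[OF c zb] Z_def E_def Q_def e_def by simp
    also have "\<dots> = (E - 1) * (Z / (E - 1) + e * Q)" using E1 by (simp add: distrib_left)
    finally have "aux_R c s = (E - 1) * (Z / (E - 1) + e * Q)" .
    from that[OF this[unfolded E_def e_def] *[OF Yb, unfolded m_def e_def E_def]] show ?thesis .
  qed
qed

text \<open>The reference size that makes the errors relative. From |z| = exp (-pi Im \<eta>) <= 2/5
  follows |\<open>mordell_main z\<close>| >= 7/9 |z|, and 7/9 * 2/3 > 1/4.\<close>

lemma saddle_limit_lower_bound:
  assumes "Im \<eta> \<ge> 1"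
  shows "norm (saddle_limit \<eta>) \<ge> exp (- pi * Im \<eta>) / 4"
proof -
  define z where "z = exp (of_real pi * \<i> * \<eta>)"
  have nz: "norm z = exp (- pi * Im \<eta>)" by (simp add: z_def)
  have "1 * 1 \<le> pi * Im \<eta>" using assms pi_gt3 by (intro mult_mono) auto
  hence "exp (- pi * Im \<eta>) \<le> exp (- 1)" by simp
  also have "\<dots> \<le> 2 / 5" using exp_one_bounds(1) by (simp add: exp_minus field_simps)
  finally have z: "norm z \<le> 2 / 5" unfolding nz .
  have p2: "norm z ^ 2 \<le> (2 / 5) ^ 2" "norm z ^ 4 \<le> (2 / 5) ^ 4" using z
    by (intro power_mono; simp)+
  have "1 - norm (z\<^sup>2) \<le> norm (1 - z\<^sup>2)" using norm_triangle_ineq2[of 1 "z\<^sup>2"] by simp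
  moreover have "norm (z\<^sup>2) \<le> 4 / 25" using p2(1) unfolding norm_power
    by (simp add: power2_eq_square)
  ultimately have a: "norm (1 - z\<^sup>2) \<ge> 21 / 25" by linarith
  have z4: "norm (z ^ 4) \<le> 16 / 625" using p2(2) unfolding norm_power by (simp add: power4_eq_xxxx)
  have "norm (1 + z ^ 4) \<le> 1 + norm (z ^ 4)" using norm_triangle_ineq[of 1 "z ^ 4"] by simp
  hence b: "norm (1 + z ^ 4) \<le> 27 / 25" using z4 by linarith
  have "1 - norm (z ^ 4) \<le> norm (1 + z ^ 4)" using norm_triangle_ineq2[of 1 "- (z ^ 4)"] by simp
  hence b0: "norm (1 + z ^ 4) > 0" using z4 by linarith
  have "norm z * (21 / 25) / (27 / 25) \<le> norm z * norm (1 - z\<^sup>2) / norm (1 + z ^ 4)"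
    using a b b0 by (intro frac_le mult_left_mono) auto
  hence M: "norm (mordell_main z) \<ge> norm z * (7 / 9)"
    unfolding mordell_main_def norm_divide norm_mult by simp
  have "sqrt 2 \<le> 3 / 2" by (rule real_le_lsqrt) (auto simp: power2_eq_square)
  hence "1 / (3 / 2) \<le> 1 / sqrt 2" by (intro divide_left_mono) auto
  hence "(2 / 3) * (norm z * (7 / 9)) \<le> (1 / sqrt 2) * norm (mordell_main z)"
    using M by (intro mult_mono) auto
  moreover have "norm (saddle_limit \<eta>) = (1 / sqrt 2) * norm (mordell_main z)"
    unfolding saddle_limit_def z_def norm_mult by (simp add: norm_divide)
  ultimately show ?thesis using nz norm_ge_zero[of z] by linarith
qed

text \<open>Dividing by the predicted value leaves (1 - \<delta>) exp (-\<mu>) / (1 + \<epsilon>3),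
  where \<delta> is the error of the saddle ray and the segments, \<mu> is Binet's function at 1 -
  s, and \<epsilon>3 stems from the Gaussian part of \<open>G_bar\<close>.\<close>

theorem theorem29:
  shows "\<exists>C::real. \<forall>c::real. \<forall>s::complex. 0 < c \<and> c < 1 \<and> s \<in> region_N \<longrightarrow>
    (\<exists>\<epsilon>::complex. norm \<epsilon> \<le> C / norm (eta s) \<and>
      aux_R c s = (- 1) powi m_of s / (2 * \<i>) * chi s * eta s powr (s - 1)
        * exp (- (of_real pi * \<i> * (eta s)\<^sup>2)) * G_bar (p_of s) * (1 + \<epsilon>))"
proof -
  define K where "K = 4 * saddle_constant"
  \<comment> \<open>The factor 2 bounds 1 / |1 + \<epsilon>3|; the multiple of 1 + K covers exp
    (-\<mu>) - 1, K covers \<delta>, and 1 covers \<epsilon>3.\<close>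
  define C where "C = 2 * ((1 + K) * 6 + K + 1)"
  have K0: "K \<ge> 0" by (simp add: K_def saddle_constant_def)
  show ?thesis
  proof (rule exI[of _ C], intro allI impI)
    fix c :: real and s :: complex
    assume "0 < c \<and> c < 1 \<and> s \<in> region_N"
    hence c: "0 < c" "c < 1" and N: "s \<in> region_N" by auto
    define \<eta> where "\<eta> = eta s"
    have R1: "Re s < 1" using N by (auto simp: region_N_def)
    note b = eta_basic[OF R1, folded \<eta>_def]
    note rN = region_N_eta[OF N, folded \<eta>_def]
    define e where "e = cis (pi / 4)"
    define f where "f = saddle_monomial s \<eta>"
    define E where "E = exp (\<i> * of_real pi * s)"
    define S where "S = saddle_limit \<eta>"
    define \<mu> where "\<mu> = stirling_mu (1 - s)"
    have e2: "Im \<eta> \<ge> 1" using rN(2) b(3) by (intro power2_le_imp_le[of 1]) auto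
    have eta0: "\<eta> \<noteq> 0" using e2 by auto
    have n25: "norm \<eta> \<ge> 5 / 2"
      by (rule power2_le_imp_le) (use rN(1) in \<open>auto simp: power2_eq_square\<close>)
    have n0: "norm \<eta> > 0" using n25 by linarith
    have f0: "f \<noteq> 0" using eta0 by (auto simp: f_def saddle_monomial_def powr_def)
    have e0: "e \<noteq> 0" by (simp add: e_def)
    have Sb: "norm S \<ge> exp (- pi * Im \<eta>) / 4" unfolding S_def
      by (rule saddle_limit_lower_bound[OF e2])
    hence nS: "norm S > 0" by (rule less_le_trans[rotated]) simp
    hence S0: "S \<noteq> 0" by auto
    obtain X where X: "aux_R c s = (E - 1) * X"
      "norm (X * (f * \<eta>) + e * S) \<le> saddle_constant * exp (- pi * Im \<eta>) / norm \<eta>"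
      using aux_R_asymptotic[OF N c] unfolding E_def f_def e_def S_def \<eta>_def by blast
    define \<delta> where "\<delta> = (X * (f * \<eta>) + e * S) / (e * S)"
    have Xe: "X = - (e * S * (1 - \<delta>) / (f * \<eta>))"
      using e0 S0 f0 eta0 by (simp add: \<delta>_def field_simps)
    have \<delta>: "norm \<delta> \<le> K / norm \<eta>"
    proof -
      have "norm \<delta> = norm (X * (f * \<eta>) + e * S) / norm S"
        unfolding \<delta>_def norm_divide norm_mult by (simp add: e_def)
      also have "\<dots> \<le> (saddle_constant * exp (- pi * Im \<eta>) / norm \<eta>) / (exp (- pi * Im \<eta>) / 4)"
        using X(2) Sb by (intro frac_le) (auto intro: order.trans[OF norm_ge_zero])
      also have "\<dots> = K / norm \<eta>" by (simp add: K_def)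
      finally show ?thesis .
    qed
    obtain \<epsilon>3 where \<epsilon>3: "norm \<epsilon>3 \<le> 1 / norm \<eta>"
      "(- 1) powi m_of s / (2 * \<i>) * G_bar (p_of s) = S * (1 + \<epsilon>3)"
    proof (rule G_bar_saddle[OF rN(2) b(3) rN(3), of "m_of s" "p_of s"])
      show "m_of s = \<lfloor>Re \<eta> + Im \<eta>\<rfloor>" by (simp add: m_of_def \<eta>_def)
      show "p_of s = - 2 * (of_int (m_of s) + 1 / 2 - \<eta>)" by (simp add: p_of_def \<eta>_def)
    qed (use that in \<open>simp add: S_def saddle_limit_def\<close>)
    have ws: "norm (1 - s) = 2 * pi * (norm \<eta>)\<^sup>2"
      using saddle_coordinates(3)[OF b(1)] by (simp add: norm_minus_commute)
    have w6: "norm (1 - s) \<ge> 6 * (norm \<eta>)\<^sup>2" unfolding ws using pi_gt3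
      by (intro mult_right_mono) auto
    have n2: "(norm \<eta>)\<^sup>2 \<ge> norm \<eta> * (5 / 2)"
      unfolding power2_eq_square using n25 by (intro mult_left_mono) auto
    have w2: "norm (1 - s) \<ge> 2" using w6 rN(1) by linarith
    \<comment> \<open>The 12 matches the numerator in \<open>norm_stirling_mu_le\<close>; |1 - s| is
      of order |\<eta>|^2, and 6 * 5/2 >= 12.\<close>
    have wn: "norm (1 - s) \<ge> 12 * norm \<eta>" using w6 n2 n0 by linarith
    have \<mu>: "norm \<mu> \<le> 1 / norm \<eta>"
    proof -
      have "norm \<mu> \<le> 12 / norm (1 - s)"
        unfolding \<mu>_def by (rule norm_stirling_mu_le) (use R1 w2 in auto)
      also have "\<dots> \<le> 12 / (12 * norm \<eta>)" using wn n0 by (intro frac_le) auto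
      finally show ?thesis by simp
    qed
    have ninv: "1 / norm \<eta> \<le> 2 / 5" using frac_le[of 1 1 "5 / 2" "norm \<eta>"] n25 by simp
    have chi: "chi s * f = e * (1 - E) * exp \<mu> / (f * \<eta>)"
    proof -
      have "chi s * f\<^sup>2 * \<eta> = e * (1 - E) * exp \<mu>"
        unfolding f_def e_def E_def \<mu>_def by (rule chi_saddle[OF b(1,4) R1 w2 eta0])
      thus ?thesis using f0 eta0 by (simp add: field_simps power2_eq_square)
    qed
    have h3: "norm (1 + \<epsilon>3) \<ge> 1 / 2"
      using norm_triangle_ineq2[of 1 "- \<epsilon>3"] \<epsilon>3(1) ninv by simp
    hence n3: "1 + \<epsilon>3 \<noteq> 0" by auto
    define \<epsilon> where "\<epsilon> = (1 - \<delta>) * exp (- \<mu>) / (1 + \<epsilon>3) - 1"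
    have "(- 1) powi m_of s / (2 * \<i>) * chi s * \<eta> powr (s
        - 1) * exp (- (of_real pi * \<i> * \<eta>\<^sup>2)) * G_bar (p_of s) * (1 + \<epsilon>)
       = (chi s * f) * ((- 1) powi m_of s / (2 * \<i>) * G_bar (p_of s)) * (1 + \<epsilon>)"
      by (simp add: f_def saddle_monomial_def)
    also have "\<dots> = e * (1 - E) * S / (f * \<eta>) * (exp \<mu> * ((1 + \<epsilon>3) * (1 + \<epsilon>)))"
      unfolding chi \<epsilon>3(2) by simp
    also have "exp \<mu> * ((1 + \<epsilon>3) * (1 + \<epsilon>)) = 1 - \<delta>"
    proof -
      have "(1 + \<epsilon>3) * (1 + \<epsilon>) = (1 - \<delta>) * exp (- \<mu>)" unfolding \<epsilon>_def using n3 by simp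
      hence "exp \<mu> * ((1 + \<epsilon>3) * (1 + \<epsilon>)) = (1 - \<delta>) * (exp \<mu> * exp (- \<mu>))" by (simp only: mult_ac)
      thus ?thesis by (simp only: exp_minus_inverse mult_1_right)
    qed
    also have "e * (1 - E) * S / (f * \<eta>) * (1 - \<delta>) = aux_R c s"
      unfolding X(1) Xe by (simp add: algebra_simps diff_divide_distrib)
    finally have eq: "aux_R c s = (- 1) powi m_of s / (2 * \<i>) * chi s * eta s powr (s - 1)
        * exp (- (of_real pi * \<i> * (eta s)\<^sup>2)) * G_bar (p_of s) * (1 + \<epsilon>)"
      unfolding \<eta>_def by simp
    have "norm \<epsilon> \<le> C / norm \<eta>"
    proof -
      have "norm (exp (- \<mu>) - 1) \<le> norm (- \<mu>) * exp 1"
      proof (rule norm_exp_minus_one_le)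
        show "Re (- \<mu>) \<le> 1" using complex_Re_le_cmod[of "- \<mu>"] \<mu> ninv by simp
      qed simp
      also have "\<dots> \<le> (1 / norm \<eta>) * 3" using \<mu> exp_one_bounds(2) by (intro mult_mono) auto
      finally have m3: "norm (exp (- \<mu>) - 1) \<le> 3 / norm \<eta>" by simp
      have d1: "norm (1 - \<delta>) \<le> 1 + K"
      proof -
        have "K / norm \<eta> \<le> K / 1" using n25 K0 by (intro divide_left_mono) auto
        thus ?thesis using norm_triangle_ineq4[of 1 \<delta>] \<delta> by simp
      qed
      have "\<epsilon> = ((1 - \<delta>) * (exp (- \<mu>) - 1) - \<delta> - \<epsilon>3) / (1 + \<epsilon>3)"
        unfolding \<epsilon>_def using n3 by (simp add: field_simps)
      hence "norm \<epsilon> = norm ((1 - \<delta>) * (exp (- \<mu>) - 1) - \<delta> - \<epsilon>3) / norm (1 + \<epsilon>3)"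
        by (simp add: norm_divide)
      also have "\<dots> \<le> ((1 + K) * (3 / norm \<eta>) + K / norm \<eta> + 1 / norm \<eta>) / (1 / 2)"
      proof (rule frac_le)
        have "norm ((1 - \<delta>) * (exp (- \<mu>) - 1)) \<le> (1 + K) * (3 / norm \<eta>)"
          unfolding norm_mult using d1 m3 K0 by (intro mult_mono) auto
        thus "norm ((1 - \<delta>) * (exp (- \<mu>) - 1) - \<delta> - \<epsilon>3)
            \<le> (1 + K) * (3 / norm \<eta>) + K / norm \<eta> + 1 / norm \<eta>"
          using \<delta> \<epsilon>3(1) by (intro norm_triangle_le_diff add_mono)
      qed (use h3 K0 n0 in auto)
      also have "\<dots> = 2 * ((1 + K) * 3 + K + 1) / norm \<eta>"
        by (simp add: add_divide_distrib ring_distribs)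
      also have "\<dots> \<le> C / norm \<eta>" unfolding C_def using K0 n0 by (intro divide_right_mono) auto
      finally show ?thesis .
    qed
    thus "\<exists>\<epsilon>::complex. norm \<epsilon> \<le> C / norm (eta s) \<and>
      aux_R c s = (- 1) powi m_of s / (2 * \<i>) * chi s * eta s powr (s - 1)
        * exp (- (of_real pi * \<i> * (eta s)\<^sup>2)) * G_bar (p_of s) * (1 + \<epsilon>)"
      using eq unfolding \<eta>_def by blast
  qed
qed

end
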